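(* Let $A_N$ and $\Delta_N$ be as in the spectral norm setting, with $\mathbb EX^{(N)}_{i,j}=0$ for all $i\le j$, satisfying (S.1), (S.2), (S.3) and additionally (S.4): for some $0<r\le1$, $$\lim_{N\to\infty}\sup_{1\le i\le N}\Big|\frac1N\sum_{j=1}^N\sigma_N(i,j)^2-r\Big|=0.$$ Then $\displaystyle\lim_{N\to\infty}\frac{\|\Delta_N\|}{\sqrt{2N\log N}}=\sqrt r$ in probability, where $\|\cdot\|$ is the spectral norm.
   Context: For each $N$, $\{X^{(N)}_{i,j}:1\le i\le j\le N\}$ are independent real random variables, $A_N(i,j)=X^{(N)}_{i\wedge j,i\vee j}$, $\Delta_N(i,j)=A_N(i,j)$ ($i\ne j$), $\Delta_N(i,i)=-\sum_{k\ne i}A_N(i,k)$, $\sigma_N(i,j)^2=\mathrm{Var}(X^{(N)}_{i\wedge j,i\vee j})$. (S.1) $\inf_{N,i,j}\sigma_N(i,j)^2>0$ and $\sup_{N,i,j}\sigma_N(i,j)^2\le1$. (S.2) For some $\delta>0$, $K<\infty$: $\mathbb E|X^{(N)}_{i,j}-\mathbb EX^{(N)}_{i,j}|^{6+\delta}\le K$ for all $i,j,N$. (S.3) The empirical graphon $W_N$ ($W_N=\sigma_N(i,j)^2$ on $I_i\times I_j$, $I_j=[\frac{j-1}N,\frac jN)$, $I_N$ closed) converges in cut metric $\delta_\Box$ to some graphon $W$. *)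

theory Defs
  imports "HOL-Probability.Probability"
begin

definition L01 :: "real measure" where
  "L01 = restrict_space lborel {0..1}"

definition graphon :: "(real \<Rightarrow> real \<Rightarrow> real) \<Rightarrow> bool" where
  "graphon W \<longleftrightarrow>
     (\<lambda>p. W (fst p) (snd p)) \<in> borel_measurable (L01 \<Otimes>\<^sub>M L01) \<and>
     (\<forall>x\<in>{0..1}. \<forall>y\<in>{0..1}. W x y = W y x \<and> 0 \<le> W x y \<and> W x y \<le> 1)"

definition cut_norm :: "(real \<Rightarrow> real \<Rightarrow> real) \<Rightarrow> real" where
  "cut_norm U = (SUP ST \<in> sets L01 \<times> sets L01.
      \<bar>integral\<^sup>L (L01 \<Otimes>\<^sub>M L01)
         (\<lambda>p. indicator (fst ST \<times> snd ST) p * U (fst p) (snd p))\<bar>)"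

definition mpres :: "(real \<Rightarrow> real) \<Rightarrow> bool" where
  "mpres f \<longleftrightarrow> f \<in> measurable L01 L01 \<and> distr L01 L01 f = L01"

definition mp_bij :: "(real \<Rightarrow> real) set" where
  "mp_bij = {\<phi>. bij_betw \<phi> {0..1} {0..1} \<and> mpres \<phi> \<and>
                 mpres (inv_into {0..1} \<phi>)}"

definition cut_dist :: "(real \<Rightarrow> real \<Rightarrow> real) \<Rightarrow> (real \<Rightarrow> real \<Rightarrow> real) \<Rightarrow> real" where
  "cut_dist U W = (INF \<phi> \<in> mp_bij. cut_norm (\<lambda>x y. U x y - W (\<phi> x) (\<phi> y)))"

text \<open>Index of the interval I_i = [(i-1)/N, i/N) containing x (I_N closed).\<close>
definition cell :: "nat \<Rightarrow> real \<Rightarrow> nat" where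
  "cell N x = min N (nat \<lfloor>real N * x\<rfloor> + 1)"

definition emp_graphon :: "nat \<Rightarrow> (nat \<Rightarrow> nat \<Rightarrow> real) \<Rightarrow> real \<Rightarrow> real \<Rightarrow> real" where
  "emp_graphon N s x y = s (cell N x) (cell N y)"

definition spec_norm :: "nat \<Rightarrow> (nat \<Rightarrow> nat \<Rightarrow> real) \<Rightarrow> real" where
  "spec_norm N B = (SUP x \<in> {x :: nat \<Rightarrow> real. (\<Sum>i=1..N. (x i)\<^sup>2) = 1}.
       sqrt (\<Sum>i=1..N. (\<Sum>j=1..N. B i j * x j)\<^sup>2))"

definition symA :: "(nat \<Rightarrow> nat \<Rightarrow> real) \<Rightarrow> nat \<Rightarrow> nat \<Rightarrow> real" where
  "symA x i j = x (min i j) (max i j)"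

definition lapl :: "nat \<Rightarrow> (nat \<Rightarrow> nat \<Rightarrow> real) \<Rightarrow> nat \<Rightarrow> nat \<Rightarrow> real" where
  "lapl N x i j = (if i \<noteq> j then symA x i j
                   else - (\<Sum>k\<in>{1..N} - {i}. symA x i k))"

end

(* The Laplacian is A - diag(S), with S the vector of full row sums of A, so its norm differs from
   max |S_i| by at most a multiple of the norm of A.

   Norm of A: it suffices to have ||A|| = o(sqrt(N log N)). Truncate at N^(1/3) (harmless, since more
   than six moments are bounded) and split the entries at the level (log N)^(2/5). The bounded part
   has norm O((log N)^(2/5) sqrt N) by a net argument with Hoeffding's inequality. The entries of the
   other part have variance O((log N)^(-8/5)); a crude count of closed walks of length 2k with
   k ~ log N, which loses a factor k, therefore still gives the norm O((log N)^(1/5) sqrt N).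

   Row sums: exponential moments of the truncated entries give the upper bound through a union bound.
   For the lower bound, the row sums of the first m = kappa N vertices over the columns beyond m are
   independent, each exceeds (1 - theta) sqrt(2 r N log N) with probability N^(-1 + theta^2) at least,
   and the remaining parts of these rows are negligible. *)

theory Submission
  imports Defs "HOL-Real_Asymp.Real_Asymp"
begin

section \<open>Operator bounds for matrices\<close>

text \<open>Neither norm estimate can handle the whole truncated matrix. The net argument costs a
  factor equal to the entry bound, which must therefore be of smaller order than (log N)^(1/2). The
  walk count bounds the norm by a multiple of k sqrt(N b), where b bounds the variances; entries
  above a level L have b = O(L^(-4)), and with k of order log N this forces L to be of larger order
  than (log N)^(1/4). The exponent 2/5 is one choice between 1/4 and 1/2. Because the two ranges
  overlap, a walk count without Catalan numbers suffices.

  The exponent 1/3 is also constrained from both sides. The N^2 entries exceed N^(1/3) with total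
  probability O(N^(2 - p/3)), which vanishes for p > 6; and the tilting parameters of the row sums,
  of order sqrt(log N / N), times the entry bound must tend to zero, so that log moment generating
  functions are quadratic to leading order.

  Any two full rows share an entry, hence the restriction to columns beyond m in the lower bound.
  One large row sum is enough there, since a single diagonal entry bounds the norm from
  below.\<close>

definition mat_vec :: "'i set \<Rightarrow> ('i \<Rightarrow> 'i \<Rightarrow> real) \<Rightarrow> ('i \<Rightarrow> real) \<Rightarrow> 'i \<Rightarrow> real" where
  "mat_vec V B x i = (\<Sum>j\<in>V. B i j * x j)"

text \<open>Operator norm bounds as a predicate: they can be added and weakened without first
  showing that a supremum is taken over a bounded set.\<close>

definition op_le :: "'i set \<Rightarrow> ('i \<Rightarrow> 'i \<Rightarrow> real) \<Rightarrow> real \<Rightarrow> bool" where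
  "op_le V B t \<longleftrightarrow> (\<forall>x. L2_set (mat_vec V B x) V \<le> t * L2_set x V)"

lemma op_leD: "op_le V B t \<Longrightarrow> L2_set (mat_vec V B x) V \<le> t * L2_set x V"
  by (simp add: op_le_def)

lemma L2_set_scale: "L2_set (\<lambda>i. c * x i) V = \<bar>c\<bar> * L2_set x V"
  by (simp add: L2_set_def power_mult_distrib real_sqrt_mult flip: sum_distrib_left)

lemma L2_set_square: "(L2_set x V)\<^sup>2 = (\<Sum>i\<in>V. (x i)\<^sup>2)"
  by (simp add: L2_set_def sum_nonneg)

lemma abs_sum_mult_le_L2: "\<bar>\<Sum>i\<in>V. x i * y i\<bar> \<le> L2_set x V * L2_set y V"
  by (rule order_trans[OF sum_abs]) (simp add: abs_mult L2_set_mult_ineq)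

lemma mat_vec_cong: "(\<And>i j. i \<in> V \<Longrightarrow> j \<in> V \<Longrightarrow> B i j = C i j) \<Longrightarrow> i \<in> V \<Longrightarrow> mat_vec V B x i = mat_vec V C x i"
  by (simp add: mat_vec_def)

lemma op_le_cong:
  assumes "\<And>i j. i \<in> V \<Longrightarrow> j \<in> V \<Longrightarrow> B i j = C i j"
  shows "op_le V B t \<longleftrightarrow> op_le V C t"
proof -
  have "L2_set (mat_vec V B x) V = L2_set (mat_vec V C x) V" for x
    by (rule L2_set_cong) (auto intro: mat_vec_cong assms)
  then show ?thesis by (simp add: op_le_def)
qed

lemma op_le_mono: "op_le V B s \<Longrightarrow> s \<le> t \<Longrightarrow> op_le V B t"
  unfolding op_le_def by (meson L2_set_nonneg mult_right_mono order_trans)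

lemma op_le_add:
  assumes "op_le V B s" "op_le V C t"
  shows "op_le V (\<lambda>i j. B i j + C i j) (s + t)"
  unfolding op_le_def
proof
  fix x
  have "mat_vec V (\<lambda>i j. B i j + C i j) x = (\<lambda>i. mat_vec V B x i + mat_vec V C x i)"
    by (auto simp: mat_vec_def algebra_simps sum.distrib)
  then have "L2_set (mat_vec V (\<lambda>i j. B i j + C i j) x) V
      \<le> L2_set (mat_vec V B x) V + L2_set (mat_vec V C x) V"
    by (simp add: L2_set_triangle_ineq)
  also have "\<dots> \<le> s * L2_set x V + t * L2_set x V"
    using assms by (intro add_mono op_leD)
  finally show "L2_set (mat_vec V (\<lambda>i j. B i j + C i j) x) V \<le> (s + t) * L2_set x V"
    by (simp add: algebra_simps)
qed

text \<open>Cauchy-Schwarz on every row. The bound is attained by constant matrices; it serves for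
  the tiny means that truncation creates, and to show that the supremum in \<open>spec_norm\<close>
  is finite.\<close>

lemma op_le_const:
  fixes c :: real
  assumes "finite V" "\<And>i j. i \<in> V \<Longrightarrow> j \<in> V \<Longrightarrow> \<bar>B i j\<bar> \<le> c"
  shows "op_le V B (real (card V) * c)"
proof (cases "V = {}")
  case True
  then show ?thesis by (simp add: op_le_def)
next
  case False
  with assms have c: "0 \<le> c" by (metis abs_ge_zero all_not_in_conv order_trans)
  show ?thesis
    unfolding op_le_def
  proof
    fix x
    have "\<bar>mat_vec V B x i\<bar> \<le> c * sqrt (real (card V)) * L2_set x V" if "i \<in> V" for i
    proof -
      have "\<bar>mat_vec V B x i\<bar> \<le> (\<Sum>j\<in>V. c * \<bar>x j\<bar>)"
        unfolding mat_vec_def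
        by (rule order_trans[OF sum_abs]) (auto simp: abs_mult intro!: sum_mono mult_right_mono assms that)
      also have "\<dots> \<le> L2_set (\<lambda>_. c) V * L2_set x V"
        using L2_set_mult_ineq[of "\<lambda>_. c" x V] c by simp
      finally show ?thesis using c by (simp add: L2_set_constant mult_ac)
    qed
    then have "L2_set (mat_vec V B x) V \<le> L2_set (\<lambda>_. c * sqrt (real (card V)) * L2_set x V) V"
      using c unfolding L2_set_def
      by (intro real_sqrt_le_mono sum_mono) (auto simp: abs_le_square_iff[symmetric] abs_mult sum_nonneg)
    also have "\<dots> = real (card V) * c * L2_set x V"
      using c by (simp add: L2_set_constant abs_mult)
    finally show "L2_set (mat_vec V B x) V \<le> real (card V) * c * L2_set x V" .
  qed
qed

lemma op_le_diag:
  assumes "\<And>i. i \<in> V \<Longrightarrow> \<bar>d i\<bar> \<le> u" "0 \<le> u" "finite V"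
  shows "op_le V (\<lambda>i j. if i = j then d i else 0) u"
  unfolding op_le_def
proof
  fix x
  have "L2_set (mat_vec V (\<lambda>i j. if i = j then d i else 0) x) V = L2_set (\<lambda>i. d i * x i) V"
    by (rule L2_set_cong) (auto simp: mat_vec_def if_distrib[of "\<lambda>y. y * _"] sum.delta assms cong: if_cong)
  also have "\<dots> \<le> L2_set (\<lambda>i. u * x i) V"
    unfolding L2_set_def
    by (intro real_sqrt_le_mono sum_mono) (auto simp: power_mult_distrib intro!: mult_right_mono power2_le_iff_abs_le[THEN iffD2] assms)
  also have "\<dots> = u * L2_set x V" using assms by (simp add: L2_set_scale)
  finally show "L2_set (mat_vec V (\<lambda>i j. if i = j then d i else 0) x) V \<le> u * L2_set x V" .
qed

lemma op_le_unit:
  assumes "\<And>x. L2_set x V = 1 \<Longrightarrow> L2_set (mat_vec V B x) V \<le> t" "finite V"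
  shows "op_le V B t"
  unfolding op_le_def
proof
  fix x
  show "L2_set (mat_vec V B x) V \<le> t * L2_set x V"
  proof (cases "L2_set x V = 0")
    case True
    then have "x j = 0" if "j \<in> V" for j using that assms(2) by (simp add: L2_set_eq_0_iff)
    then have "L2_set (mat_vec V B x) V = 0"
      by (intro L2_set_0') (simp add: mat_vec_def)
    then show ?thesis using True by simp
  next
    case False
    define c where "c = L2_set x V"
    have c: "c > 0" using False by (simp add: c_def less_le)
    have "L2_set (\<lambda>i. (1/c) * x i) V = 1"
      using c False by (simp only: L2_set_scale) (simp add: c_def)
    then have "L2_set (mat_vec V B (\<lambda>i. (1/c) * x i)) V \<le> t" by (rule assms)
    also have "mat_vec V B (\<lambda>i. (1/c) * x i) = (\<lambda>i. (1/c) * mat_vec V B x i)"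
      by (auto simp: mat_vec_def sum_distrib_left mult_ac)
    finally have "(1/c) * L2_set (mat_vec V B x) V \<le> t" using c by (simp only: L2_set_scale) simp
    then show ?thesis using c by (simp add: c_def field_simps)
  qed
qed

text \<open>Test the bound on the j-th basis vector. Applied to a diagonal entry of the Laplacian,
  this turns a single large row sum into a lower bound for the norm.\<close>

lemma abs_entry_le_of_op_le:
  assumes "op_le V B t" "finite V" "i \<in> V" "j \<in> V"
  shows "\<bar>B i j\<bar> \<le> t"
proof -
  let ?e = "\<lambda>k. if k = j then 1 else 0 :: real"
  have "(L2_set ?e V)\<^sup>2 = 1\<^sup>2"
    using assms by (simp add: L2_set_square sum.delta if_distrib[of "\<lambda>y. y\<^sup>2"] cong: if_cong)
  then have 1: "L2_set ?e V = 1" by (subst (asm) power2_eq_iff_nonneg) auto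
  have mv: "mat_vec V B ?e k = B k j" for k
    using assms by (simp add: mat_vec_def if_distrib[of "\<lambda>y. _ * y"] sum.delta cong: if_cong)
  have "\<bar>B i j\<bar> \<le> L2_set (\<lambda>k. \<bar>B k j\<bar>) V"
    using member_le_L2_set[of V i "\<lambda>k. \<bar>B k j\<bar>"] assms by simp
  also have "\<dots> = L2_set (mat_vec V B ?e) V" by (simp add: L2_set_def mv)
  also have "\<dots> \<le> t" using op_leD[OF assms(1), of ?e] 1 by simp
  finally show ?thesis .
qed

section \<open>The spectral norm and its bounds for the Laplacian\<close>

lemma spec_norm_eq: "spec_norm N B = (SUP x \<in> {x. L2_set x {1..N} = 1}. L2_set (mat_vec {1..N} B x) {1..N})"
proof -
  have "{x :: nat \<Rightarrow> real. (\<Sum>i=1..N. (x i)\<^sup>2) = 1} = {x. L2_set x {1..N} = 1}"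
    by (simp add: L2_set_def)
  then show ?thesis unfolding spec_norm_def by (simp add: L2_set_def mat_vec_def)
qed

lemma L2_unit_vector_exists:
  assumes "(N::nat) \<ge> 1"
  shows "{x. L2_set x {1..N} = 1} \<noteq> {}"
proof -
  have "L2_set (\<lambda>k. if k = 1 then 1 else 0) {1..N} = 1"
    using assms unfolding L2_set_def by (subst sum.remove[of _ 1]) auto
  then show ?thesis by blast
qed

lemma spec_norm_le:
  assumes "op_le {1..N} B t" "N \<ge> 1"
  shows "spec_norm N B \<le> t"
  unfolding spec_norm_eq using op_leD[OF assms(1)] L2_unit_vector_exists[OF assms(2)]
  by (intro cSUP_least) (auto, metis mult.right_neutral)

text \<open>A real supremum is known to be an upper bound only when the set is bounded above;
  \<open>op_le_const\<close> with the largest entry provides this.\<close>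

lemma op_le_spec_norm: "op_le {1..N} B (spec_norm N B)"
proof (rule op_le_unit)
  obtain c where c: "\<forall>i\<in>{1..N}. \<forall>j\<in>{1..N}. \<bar>B i j\<bar> \<le> c"
  proof
    show "\<forall>i\<in>{1..N}. \<forall>j\<in>{1..N}. \<bar>B i j\<bar> \<le> Max ((\<lambda>(i,j). \<bar>B i j\<bar>) ` ({1..N} \<times> {1..N}))"
      by (auto intro!: Max_ge)
  qed
  then have "op_le {1..N} B (real N * c)"
    using op_le_const[of "{1..N}" B c] by simp
  then have "bdd_above ((\<lambda>x. L2_set (mat_vec {1..N} B x) {1..N}) ` {x. L2_set x {1..N} = 1})"
    by (intro bdd_aboveI[of _ "real N * c"]) (auto, metis mult.right_neutral op_leD)
  then show "L2_set (mat_vec {1..N} B x) {1..N} \<le> spec_norm N B" if "L2_set x {1..N} = 1" for x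
    unfolding spec_norm_eq using that by (intro cSUP_upper) auto
qed simp

text \<open>The term \<open>symA x i i\<close> cancels, so the diagonal can be written with full row sums.\<close>

lemma lapl_eq:
  assumes "i \<in> {1..N}"
  shows "lapl N x i j = symA x i j + (if i = j then - (\<Sum>k=1..N. symA x i k) else 0)"
  using assms sum.remove[of "{1..N}" i "symA x i"] by (cases "i = j") (auto simp: lapl_def)

lemma spec_norm_lapl_le:
  assumes "op_le {1..N} (symA x) t" "N \<ge> 1" "\<And>i. i \<in> {1..N} \<Longrightarrow> \<bar>\<Sum>k=1..N. symA x i k\<bar> \<le> u"
  shows "spec_norm N (lapl N x) \<le> t + u"
proof (rule spec_norm_le)
  have u: "0 \<le> u" using assms(3)[of 1] assms(2) by auto
  have "op_le {1..N} (\<lambda>i j. symA x i j + (if i = j then - (\<Sum>k=1..N. symA x i k) else 0)) (t + u)"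
    using assms u by (intro op_le_add op_le_diag) auto
  then show "op_le {1..N} (lapl N x) (t + u)"
    by (subst op_le_cong[OF lapl_eq])
qed fact

text \<open>The i-th diagonal entry of the Laplacian is \<open>symA x i i\<close> minus the full row
  sum, and \<open>symA x i i\<close> itself is at most \<open>t\<close> in modulus.\<close>

lemma spec_norm_lapl_ge:
  assumes "op_le {1..N} (symA x) t" "i \<in> {1..N}"
  shows "\<bar>\<Sum>k=1..N. symA x i k\<bar> - t \<le> spec_norm N (lapl N x)"
proof -
  have "\<bar>lapl N x i i\<bar> \<le> spec_norm N (lapl N x)"
    by (rule abs_entry_le_of_op_le[OF op_le_spec_norm]) (use assms in auto)
  moreover have "\<bar>symA x i i\<bar> \<le> t"
    by (rule abs_entry_le_of_op_le[OF assms(1)]) (use assms in auto)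
  ultimately show ?thesis using lapl_eq[OF assms(2), of x i] by auto
qed

subsection \<open>Discretisation of the unit ball\<close>

text \<open>Rounding towards zero: unlike rounding to the nearest integer it never increases the
  modulus, so rounded vectors stay in the ball.\<close>

lemma integer_truncation:
  fixes r :: real
  obtains z :: int where "\<bar>of_int z :: real\<bar> \<le> \<bar>r\<bar>" "\<bar>r - of_int z\<bar> \<le> 1"
proof -
  have *: "\<bar>of_int z :: real\<bar> \<le> \<bar>s\<bar> \<and> \<bar>s - of_int z\<bar> \<le> 1"
    if "of_int z \<le> s" "s < of_int z + 1" "0 \<le> z" for s :: real and z :: int
    using that by auto
  show ?thesis
  proof (cases "r \<ge> 0")
    case True
    then show ?thesis using *[of "\<lfloor>r\<rfloor>" r] that[of "\<lfloor>r\<rfloor>"] by simp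
  next
    case False
    then have "\<bar>of_int (- \<lfloor>- r\<rfloor>) :: real\<bar> \<le> \<bar>r\<bar>" "\<bar>r - of_int (- \<lfloor>- r\<rfloor>)\<bar> \<le> 1"
      using *[of "\<lfloor>- r\<rfloor>" "- r"] abs_minus_cancel[of "- r - of_int \<lfloor>- r\<rfloor>"] by (auto simp del: abs_minus_cancel)
    then show ?thesis by (rule that)
  qed
qed

text \<open>With n = \<open>card V\<close>, coordinate errors of at most \<open>h\<close> add up to
  an L2 error of h sqrt(n) = 1/2, and dividing the unit ball by \<open>h\<close> gives the ball of
  squared radius 1 / h^2 = 4 n. The points \<open>h * k\<close> thus form a 1/2-net of explicit
  shape.\<close>

lemma lattice_rounding:
  fixes x :: "'i \<Rightarrow> real"
  assumes V: "finite V" "V \<noteq> {}" and x: "L2_set x V \<le> 1" and h: "h = 1 / (2 * sqrt (real (card V)))"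
  obtains k :: "'i \<Rightarrow> int" where "k \<in> extensional V" "(\<Sum>i\<in>V. (k i)\<^sup>2) \<le> 4 * int (card V)"
    "L2_set (\<lambda>i. x i - h * of_int (k i)) V \<le> 1 / 2"
proof -
  define n where "n = card V"
  have n: "real n > 0" using V by (simp add: n_def card_gt_0_iff)
  have h0: "h > 0" using n by (simp add: h n_def)
  have "\<exists>z::int. \<bar>of_int z :: real\<bar> \<le> \<bar>x i / h\<bar> \<and> \<bar>x i / h - of_int z\<bar> \<le> 1" for i
    using integer_truncation[of "x i / h"] by blast
  then obtain k0 where k0: "\<And>i. \<bar>of_int (k0 i :: int) :: real\<bar> \<le> \<bar>x i / h\<bar> \<and> \<bar>x i / h - of_int (k0 i)\<bar> \<le> 1"
    by metis
  define k where "k = restrict k0 V"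
  have le: "\<bar>of_int (k i) :: real\<bar> \<le> \<bar>x i / h\<bar> \<and> \<bar>x i / h - of_int (k i)\<bar> \<le> 1" if "i \<in> V" for i
    using k0[of i] that by (simp add: k_def)
  have hn: "(1/h)\<^sup>2 = 4 * real n" using n by (simp add: h n_def power_mult_distrib)
  show ?thesis
  proof (rule that)
    show "k \<in> extensional V" by (simp add: k_def)
    have "real_of_int (\<Sum>i\<in>V. (k i)\<^sup>2) = (\<Sum>i\<in>V. \<bar>of_int (k i)\<bar>\<^sup>2)" by simp
    also have "\<dots> \<le> (\<Sum>i\<in>V. \<bar>x i / h\<bar>\<^sup>2)"
      using le by (intro sum_mono power_mono) auto
    also have "\<dots> = (1/h)\<^sup>2 * (L2_set x V)\<^sup>2"
      by (simp add: L2_set_square power_divide sum_divide_distrib)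
    also have "\<dots> \<le> 4 * real n * 1"
      unfolding hn using x by (intro mult_left_mono) (auto simp: power_le_one)
    finally show "(\<Sum>i\<in>V. (k i)\<^sup>2) \<le> 4 * int (card V)" unfolding n_def by linarith
    have "(L2_set (\<lambda>i. x i - h * of_int (k i)) V)\<^sup>2 \<le> (\<Sum>i\<in>V. h\<^sup>2)"
      unfolding L2_set_square
    proof (rule sum_mono)
      fix i assume i: "i \<in> V"
      have "x i - h * of_int (k i) = h * (x i / h - of_int (k i))" using h0 by (simp add: field_simps)
      then have "\<bar>x i - h * of_int (k i)\<bar> \<le> h" using le[OF i] h0 by (simp add: abs_mult)
      then show "(x i - h * of_int (k i))\<^sup>2 \<le> h\<^sup>2" using h0 by (simp add: abs_le_square_iff[symmetric])
    qed
    also have "\<dots> = (1/2)\<^sup>2"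
      using n by (simp add: h n_def power_divide power_mult_distrib)
    finally show "L2_set (\<lambda>i. x i - h * of_int (k i)) V \<le> 1 / 2"
      by (rule power2_le_imp_le) simp
  qed
qed

text \<open>The net in units of the mesh, with integer coordinates so that it can be counted;
  extensionality keeps the set of functions finite.\<close>

definition lattice_ball :: "'i set \<Rightarrow> ('i \<Rightarrow> int) set" where
  "lattice_ball V = {k \<in> extensional V. (\<Sum>i\<in>V. (k i)\<^sup>2) \<le> 4 * int (card V)}"

lemma sum_half_powers: "(\<Sum>k\<in>{- int m..int m}. (1/2::real) ^ nat \<bar>k\<bar>) \<le> 3"
proof -
  have "(\<Sum>k\<in>{- int m..int m}. (1/2::real) ^ nat \<bar>k\<bar>) = 3 - 2 * (1/2) ^ m"
  proof (induction m)
    case (Suc m)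
    have "{- int (Suc m)..int (Suc m)} = insert (- int (Suc m)) (insert (int (Suc m)) {- int m..int m})"
      by auto
    then show ?case using Suc by (simp add: nat_add_distrib)
  qed simp
  then show ?thesis by simp
qed

text \<open>Since |j| is at most j^2 for integers, every point has l1 norm at most 4 n. Give each
  point the weight 2^(- l1 norm), which is at least 2^(- 4 n). The total weight over a box
  factorises over the coordinates, each factor being at most 1 + 2 (1/2 + 1/4 + ...) = 3. Hence
  there are at most 3^n * 16^n points.\<close>

lemma
  assumes V: "finite V"
  shows finite_lattice_ball: "finite (lattice_ball V)"
    and card_lattice_ball_le: "real (card (lattice_ball V)) \<le> 48 ^ card V"
proof -
  define n where "n = card V"
  let ?m = "4 * n"
  let ?P = "PiE V (\<lambda>_. {- int ?m..int ?m})"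
  have weight: "k \<in> ?P \<and> (\<Sum>i\<in>V. nat \<bar>k i\<bar>) \<le> 4 * n" if "k \<in> lattice_ball V" for k
  proof -
    have abs_le: "\<bar>j\<bar> \<le> j\<^sup>2" for j :: int
    proof (cases "j = 0")
      case False
      then have "\<bar>j\<bar> * 1 \<le> \<bar>j\<bar> * \<bar>j\<bar>" by (intro mult_left_mono) auto
      then show ?thesis by (simp add: power2_eq_square)
    qed simp
    have s: "(\<Sum>i\<in>V. \<bar>k i\<bar>) \<le> 4 * int n"
    proof -
      have "(\<Sum>i\<in>V. \<bar>k i\<bar>) \<le> (\<Sum>i\<in>V. (k i)\<^sup>2)" by (intro sum_mono abs_le)
      also have "\<dots> \<le> 4 * int n" using that by (simp add: lattice_ball_def n_def)
      finally show ?thesis .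
    qed
    have "k i \<in> {- int ?m..int ?m}" if "i \<in> V" for i
    proof -
      have "\<bar>k i\<bar> \<le> 4 * int n"
        using member_le_sum[of i V "\<lambda>i. \<bar>k i\<bar>"] that V s by simp
      then show ?thesis by (simp add: abs_le_iff)
    qed
    then have P: "k \<in> ?P" using \<open>k \<in> lattice_ball V\<close> by (auto simp only: lattice_ball_def PiE_iff mem_Collect_eq)
    have "int (\<Sum>i\<in>V. nat \<bar>k i\<bar>) \<le> int (4 * n)" using s by simp
    then have "(\<Sum>i\<in>V. nat \<bar>k i\<bar>) \<le> 4 * n" by (simp only: of_nat_le_iff)
    with P show ?thesis ..
  qed
  have finP: "finite ?P" using V by (intro finite_PiE) auto
  have sub: "lattice_ball V \<subseteq> ?P" using weight by blast
  show fin: "finite (lattice_ball V)" using finP sub by (rule rev_finite_subset)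
  have "real (card (lattice_ball V)) * (1/2) ^ (4 * n) = (\<Sum>k\<in>lattice_ball V. (1/2) ^ (4 * n))"
    by simp
  also have "\<dots> \<le> (\<Sum>k\<in>lattice_ball V. (1/2) ^ (\<Sum>i\<in>V. nat \<bar>k i\<bar>))"
  proof (rule sum_mono)
    fix k assume "k \<in> lattice_ball V"
    then have "(\<Sum>i\<in>V. nat \<bar>k i\<bar>) \<le> 4 * n" using weight by blast
    then show "(1/2::real) ^ (4 * n) \<le> (1/2) ^ (\<Sum>i\<in>V. nat \<bar>k i\<bar>)"
      by (simp only: power_decreasing)
  qed
  also have "\<dots> \<le> (\<Sum>k\<in>?P. (1/2) ^ (\<Sum>i\<in>V. nat \<bar>k i\<bar>))"
    using finP sub by (intro sum_mono2) auto
  also have "\<dots> = (\<Sum>k\<in>?P. \<Prod>i\<in>V. (1/2) ^ nat \<bar>k i\<bar>)"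
    by (simp add: power_sum)
  also have "\<dots> = (\<Prod>i\<in>V. \<Sum>k\<in>{- int ?m..int ?m}. (1/2) ^ nat \<bar>k\<bar>)"
    by (rule prod_sum_PiE[symmetric]) (use V in auto)
  also have "\<dots> \<le> (\<Prod>i\<in>V. 3)"
    by (intro prod_mono conjI sum_half_powers sum_nonneg) auto
  finally have "real (card (lattice_ball V)) * (1/2) ^ (4 * n) \<le> 3 ^ n" by (simp add: n_def)
  then have "real (card (lattice_ball V)) \<le> 3 ^ n * 2 ^ (4 * n)" by (simp add: field_simps)
  also have "\<dots> = 48 ^ n" by (simp add: power_mult flip: power_mult_distrib)
  finally show "real (card (lattice_ball V)) \<le> 48 ^ card V" by (simp add: n_def)
qed

text \<open>The factor \<open>4 * real N\<close> is 1 / h^2, so on the rescaled net the form is at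
  most \<open>t\<close>. Approximating the left vector, taken as the normalised image of the right
  one, loses half of the image's norm and gives \<open>2 * t\<close>; approximating the right vector
  loses half of the operator norm and doubles once more.\<close>

lemma op_le_of_lattice_bound:
  assumes "N \<ge> 1" and t: "\<And>k l. k \<in> lattice_ball {1..N} \<Longrightarrow> l \<in> lattice_ball {1..N} \<Longrightarrow>
      (\<Sum>i=1..N. \<Sum>j=1..N. of_int (k i) * B i j * of_int (l j)) \<le> 4 * real N * t"
  shows "op_le {1..N} B (4 * t)"
proof -
  let ?V = "{1..N}"
  define h where "h = 1 / (2 * sqrt (real (card ?V)))"
  have h: "h > 0" "h\<^sup>2 * (4 * real N) = 1" using assms(1) by (auto simp: h_def power_divide power_mult_distrib)
  have t': "(\<Sum>i\<in>?V. (h * of_int (k i)) * mat_vec ?V B (\<lambda>j. h * of_int (l j)) i) \<le> t"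
    if "k \<in> lattice_ball ?V" "l \<in> lattice_ball ?V" for k l
  proof -
    have "(\<Sum>i\<in>?V. (h * of_int (k i)) * mat_vec ?V B (\<lambda>j. h * of_int (l j)) i)
        = h\<^sup>2 * (\<Sum>i=1..N. \<Sum>j=1..N. of_int (k i) * B i j * of_int (l j))"
      by (simp add: mat_vec_def sum_distrib_left sum_distrib_right power2_eq_square mult_ac)
    also have "\<dots> \<le> h\<^sup>2 * (4 * real N * t)" using that by (intro mult_left_mono t) auto
    also have "\<dots> = t" using h(2) by (metis mult.assoc mult_1)
    finally show ?thesis .
  qed
  have lat: "\<exists>k\<in>lattice_ball ?V. L2_set (\<lambda>i. x i - h * of_int (k i)) ?V \<le> 1/2" if "L2_set x ?V \<le> 1" for x
    by (rule lattice_rounding[of ?V x h]) (use that assms(1) in \<open>auto simp: h_def lattice_ball_def\<close>)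
  have net: "L2_set (mat_vec ?V B (\<lambda>j. h * of_int (l j))) ?V \<le> 2 * t" if l: "l \<in> lattice_ball ?V" for l
  proof -
    let ?u = "mat_vec ?V B (\<lambda>j. h * of_int (l j))"
    define c where "c = L2_set ?u ?V"
    show ?thesis
    proof (cases "c = 0")
      case True
      \<comment> \<open>The hypothesis at the zero lattice point yields \<open>0 \<le> t\<close>,
        which is all that a vanishing image requires.\<close>
      have "(\<lambda>_\<in>?V. 0) \<in> lattice_ball ?V" by (simp add: lattice_ball_def)
      from t'[OF this l] have "0 \<le> t" by (simp add: sum.neutral)
      with True show ?thesis by (simp add: c_def)
    next
      case False
      then have c: "c > 0" by (simp add: c_def less_le)
      have y1: "L2_set (\<lambda>i. (1/c) * ?u i) ?V = 1"
        using c unfolding L2_set_scale c_def[symmetric] by simp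
      then obtain k where k: "k \<in> lattice_ball ?V" "L2_set (\<lambda>i. (1/c) * ?u i - h * of_int (k i)) ?V \<le> 1/2"
        using lat[of "\<lambda>i. (1/c) * ?u i"] by auto
      have "c = (1/c) * c\<^sup>2" using c by (simp add: power2_eq_square)
      also have "\<dots> = (\<Sum>i\<in>?V. (1/c) * ?u i * ?u i)"
        unfolding c_def L2_set_square by (simp add: sum_distrib_left power2_eq_square mult_ac)
      also have "\<dots> = (\<Sum>i\<in>?V. (h * of_int (k i)) * ?u i) + (\<Sum>i\<in>?V. ((1/c) * ?u i - h * of_int (k i)) * ?u i)"
        by (simp add: sum.distrib[symmetric] algebra_simps)
      also have "\<dots> \<le> t + L2_set (\<lambda>i. (1/c) * ?u i - h * of_int (k i)) ?V * c"
        using t'[OF k(1) l]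
          abs_le_D1[OF abs_sum_mult_le_L2[of "\<lambda>i. (1/c) * ?u i - h * of_int (k i)" ?u ?V], folded c_def]
        by (rule add_mono)
      also have "\<dots> \<le> t + 1/2 * c" using k(2) c by (intro add_left_mono mult_right_mono) auto
      finally show ?thesis by (simp add: c_def)
    qed
  qed
  define s where "s = spec_norm N B"
  have s: "op_le ?V B s" unfolding s_def by (rule op_le_spec_norm)
  have "s \<le> 2 * t + s / 2"
    unfolding s_def spec_norm_eq
  proof (rule cSUP_least)
    fix x assume "x \<in> {x. L2_set x ?V = 1}"
    then obtain l where l: "l \<in> lattice_ball ?V" "L2_set (\<lambda>i. x i - h * of_int (l i)) ?V \<le> 1/2"
      using lat[of x] by auto
    have s0: "0 \<le> s"
      using abs_entry_le_of_op_le[OF s, of 1 1] assms(1) by auto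
    have "mat_vec ?V B x = (\<lambda>i. mat_vec ?V B (\<lambda>j. h * of_int (l j)) i
        + mat_vec ?V B (\<lambda>j. x j - h * of_int (l j)) i)"
      by (auto simp: mat_vec_def sum.distrib[symmetric] algebra_simps)
    then have "L2_set (mat_vec ?V B x) ?V \<le> L2_set (mat_vec ?V B (\<lambda>j. h * of_int (l j))) ?V
        + L2_set (mat_vec ?V B (\<lambda>j. x j - h * of_int (l j))) ?V"
      by (simp add: L2_set_triangle_ineq)
    also have "\<dots> \<le> 2 * t + s * L2_set (\<lambda>i. x i - h * of_int (l i)) ?V"
      by (intro add_mono net l op_leD s)
    also have "\<dots> \<le> 2 * t + s * (1/2)" using l s0 by (intro add_left_mono mult_left_mono) auto
    finally show "L2_set (mat_vec ?V B x) ?V \<le> 2 * t + (SUP x \<in> {x. L2_set x ?V = 1}. L2_set (mat_vec ?V B x) ?V) / 2"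
      by (simp add: s_def spec_norm_eq)
  qed (use assms(1) L2_unit_vector_exists in blast)
  then show ?thesis using op_le_mono[OF s, of "4 * t"] by simp
qed

section \<open>Powers of symmetric matrices and closed walks\<close>

abbreviation uedge :: "nat \<Rightarrow> nat \<Rightarrow> nat \<times> nat" where
  "uedge i j \<equiv> (min i j, max i j)"

lemma uedge_commute: "uedge i j = uedge j i"
  by (simp add: min.commute max.commute)

text \<open>The operator norm is at most the Frobenius norm, by Cauchy-Schwarz in each row.\<close>

lemma L2_le_matrix_L2:
  assumes "\<And>i. i \<in> V \<Longrightarrow> u i = (\<Sum>j\<in>V. C i j * x j)"
  shows "(L2_set u V)\<^sup>2 \<le> (\<Sum>i\<in>V. \<Sum>j\<in>V. (C i j)\<^sup>2) * (L2_set x V)\<^sup>2"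
proof -
  have row: "(u i)\<^sup>2 \<le> (\<Sum>j\<in>V. (C i j)\<^sup>2) * (L2_set x V)\<^sup>2" if i: "i \<in> V" for i
  proof -
    have "(u i)\<^sup>2 = \<bar>\<Sum>j\<in>V. C i j * x j\<bar>\<^sup>2" using assms[OF i] by simp
    also have "\<dots> \<le> (L2_set (C i) V * L2_set x V)\<^sup>2"
      by (intro power_mono abs_sum_mult_le_L2) simp
    also have "\<dots> = (\<Sum>j\<in>V. (C i j)\<^sup>2) * (L2_set x V)\<^sup>2"
      by (simp add: power_mult_distrib L2_set_square)
    finally show ?thesis .
  qed
  show ?thesis
    unfolding L2_set_square[of u] by (subst sum_distrib_right) (rule sum_mono[OF row])
qed

context
  fixes V :: "nat set" and B :: "nat \<Rightarrow> nat \<Rightarrow> real"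
  assumes sym: "\<And>i j. B i j = B j i"
begin

lemma mat_vec_self_adjoint: "(\<Sum>i\<in>V. mat_vec V B x i * y i) = (\<Sum>i\<in>V. x i * mat_vec V B y i)"
proof -
  have "(\<Sum>i\<in>V. mat_vec V B x i * y i) = (\<Sum>i\<in>V. \<Sum>j\<in>V. B i j * x j * y i)"
    by (simp add: mat_vec_def sum_distrib_right)
  also have "\<dots> = (\<Sum>j\<in>V. \<Sum>i\<in>V. B i j * x j * y i)" by (rule sum.swap)
  also have "\<dots> = (\<Sum>j\<in>V. x j * mat_vec V B y j)"
    by (simp add: mat_vec_def sum_distrib_left sym mult_ac)
  finally show ?thesis .
qed

lemma mat_vec_pow_self_adjoint:
  "(\<Sum>i\<in>V. (mat_vec V B ^^ m) x i * (mat_vec V B ^^ n) y i) = (\<Sum>i\<in>V. x i * (mat_vec V B ^^ (m + n)) y i)"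
proof (induction m arbitrary: n)
  case (Suc m)
  have "(\<Sum>i\<in>V. (mat_vec V B ^^ Suc m) x i * (mat_vec V B ^^ n) y i)
      = (\<Sum>i\<in>V. (mat_vec V B ^^ m) x i * (mat_vec V B ^^ Suc n) y i)"
    by (simp add: mat_vec_self_adjoint)
  also have "\<dots> = (\<Sum>i\<in>V. x i * (mat_vec V B ^^ (m + Suc n)) y i)" by (rule Suc.IH)
  finally show ?case by (metis add_Suc add_Suc_right)
qed simp

lemma L2_pow_log_convex:
  "(L2_set ((mat_vec V B ^^ Suc n) x) V)\<^sup>2
    \<le> L2_set ((mat_vec V B ^^ n) x) V * L2_set ((mat_vec V B ^^ Suc (Suc n)) x) V"
proof -
  have "(L2_set ((mat_vec V B ^^ Suc n) x) V)\<^sup>2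
      = (\<Sum>i\<in>V. (mat_vec V B ^^ Suc n) x i * (mat_vec V B ^^ Suc n) x i)"
    unfolding L2_set_square by (simp add: power2_eq_square)
  also have "\<dots> = (\<Sum>i\<in>V. (mat_vec V B ^^ n) x i * (mat_vec V B ^^ Suc (Suc n)) x i)"
    unfolding mat_vec_pow_self_adjoint by (simp only: add_Suc add_Suc_right)
  also have "\<dots> \<le> L2_set ((mat_vec V B ^^ n) x) V * L2_set ((mat_vec V B ^^ Suc (Suc n)) x) V"
    by (rule abs_le_D1[OF abs_sum_mult_le_L2])
  finally show ?thesis .
qed

text \<open>Self-adjointness makes the norms of the iterates of \<open>x\<close> log-convex, so
  their successive ratios increase from the first one, which is the norm of
  \<open>mat_vec V B x\<close>. This replaces the spectral theorem in the comparison of the norm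
  with the trace of a high power.\<close>

lemma L2_pow_ge:
  assumes "L2_set x V = 1"
  shows "L2_set (mat_vec V B x) V ^ n \<le> L2_set ((mat_vec V B ^^ n) x) V"
proof -
  define a where "a n = L2_set ((mat_vec V B ^^ n) x) V" for n
  have a0: "a n \<ge> 0" for n by (simp add: a_def)
  have step: "a n * a 1 \<le> a (Suc n)" for n
  proof (induction n)
    case 0
    then show ?case using assms by (simp add: a_def)
  next
    case (Suc n)
    have lc: "(a (Suc n))\<^sup>2 \<le> a n * a (Suc (Suc n))" unfolding a_def by (rule L2_pow_log_convex)
    show ?case
    proof (cases "a (Suc n) = 0")
      case True
      then show ?thesis using a0 by simp
    next
      case False
      then have pos: "0 < (a (Suc n))\<^sup>2" by simp
      have "a n \<noteq> 0"
      proof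
        assume "a n = 0"
        with lc pos show False by simp
      qed
      then have an: "a n > 0" using a0[of n] by simp
      have "a n * (a (Suc n) * a 1) = a (Suc n) * (a n * a 1)" by simp
      also have "\<dots> \<le> a (Suc n) * a (Suc n)" using a0 Suc by (intro mult_left_mono) auto
      also have "\<dots> \<le> a n * a (Suc (Suc n))" using lc by (simp add: power2_eq_square)
      finally show ?thesis using an by simp
    qed
  qed
  have "a 1 ^ n \<le> a n"
  proof (induction n)
    case 0
    then show ?case using assms by (simp add: a_def)
  next
    case (Suc n)
    have "a 1 ^ Suc n \<le> a n * a 1" using mult_right_mono[OF Suc a0[of 1]] by (simp only: power_Suc2)
    with step[of n] show ?case by simp
  qed
  then show ?thesis by (simp add: a_def)
qed

end

section \<open>Walks and the entries of matrix powers\<close>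

fun steps :: "nat list \<Rightarrow> (nat \<times> nat) list" where
  "steps (i # j # w) = uedge i j # steps (j # w)"
| "steps w = []"

lemma steps_Cons: "w \<noteq> [] \<Longrightarrow> steps (i # w) = uedge i (hd w) # steps w"
  by (cases w) auto

lemma length_steps: "length (steps w) = length w - 1"
  by (induction w rule: steps.induct) auto

text \<open>\<open>n\<close> counts steps, so a walk lists one more vertex. Repeated consecutive
  vertices are allowed, because the matrix has a diagonal.\<close>

definition walks :: "nat set \<Rightarrow> nat \<Rightarrow> nat list set" where
  "walks V n = {w. set w \<subseteq> V \<and> length w = Suc n}"

lemma finite_walks: "finite V \<Longrightarrow> finite (walks V n)"
  unfolding walks_def by (rule finite_lists_length_eq)

lemma hd_walk: "w \<in> walks V n \<Longrightarrow> hd w \<in> V"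
  unfolding walks_def by (cases w) auto

lemma card_vertices_le_card_steps: "w \<noteq> [] \<Longrightarrow> card (set w) \<le> Suc (card (set (steps w)))"
proof (induction w rule: steps.induct)
  case (1 i j w)
  show ?case
  proof (cases "i \<in> set (j # w)")
    case True
    then have "set (i # j # w) = set (j # w)" by auto
    moreover have "card (set (steps (j # w))) \<le> card (set (steps (i # j # w)))"
      by (rule card_mono) auto
    ultimately show ?thesis using 1 by auto
  next
    case False
    have mem: "a \<in> set u \<and> b \<in> set u" if "(a, b) \<in> set (steps u)" for a b u
      using that by (induction u rule: steps.induct) (auto simp: min_def max_def split: if_splits)
    have "uedge i j \<notin> set (steps (j # w))"
      using False mem[of "min i j" "max i j" "j # w"] by (auto simp: min_def max_def split: if_splits)
    then show ?thesis using 1 False by simp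
  qed
qed auto

text \<open>The (i, j) entry of the n-th power of the symmetric matrix with entries
  \<open>z (uedge i j)\<close>.\<close>

definition walk_sum :: "nat set \<Rightarrow> (nat \<times> nat \<Rightarrow> real) \<Rightarrow> nat \<Rightarrow> nat \<Rightarrow> nat \<Rightarrow> real" where
  "walk_sum V z n i j = (\<Sum>w\<in>{w \<in> walks V n. hd w = i \<and> last w = j}. prod_list (map z (steps w)))"

lemma walk_sum_0:
  assumes "i \<in> V"
  shows "walk_sum V z 0 i j = (if i = j then 1 else 0)"
proof -
  have "{w \<in> walks V 0. hd w = i \<and> last w = j} = (if i = j then {[i]} else {})"
    using assms by (auto simp: walks_def length_Suc_conv)
  then show ?thesis by (simp add: walk_sum_def)
qed

lemma walk_sum_Suc:
  assumes "finite V" "i \<in> V"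
  shows "walk_sum V z (Suc n) i j = (\<Sum>l\<in>V. z (uedge i l) * walk_sum V z n l j)"
proof -
  have ne: "w \<noteq> []" if "w \<in> walks V n" for w using that by (auto simp: walks_def)
  have "{w \<in> walks V (Suc n). hd w = i \<and> last w = j} = (#) i ` {w \<in> walks V n. last w = j}"
    using assms(2) by (auto simp: walks_def length_Suc_conv image_iff)
  then have "walk_sum V z (Suc n) i j
      = (\<Sum>w\<in>{w \<in> walks V n. last w = j}. prod_list (map z (steps (i # w))))"
    unfolding walk_sum_def by (simp add: sum.reindex)
  also have "\<dots> = (\<Sum>w\<in>{w \<in> walks V n. last w = j}. z (uedge i (hd w)) * prod_list (map z (steps w)))"
    by (rule sum.cong) (auto simp: steps_Cons ne)
  also have "\<dots> = (\<Sum>l\<in>V. \<Sum>w\<in>{w \<in> {w \<in> walks V n. last w = j}. hd w = l}.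
      z (uedge i (hd w)) * prod_list (map z (steps w)))"
    by (rule sum.group[symmetric]) (use assms finite_walks hd_walk in auto)
  also have "\<dots> = (\<Sum>l\<in>V. z (uedge i l) * walk_sum V z n l j)"
    unfolding walk_sum_def sum_distrib_left by (intro sum.cong) auto
  finally show ?thesis .
qed

lemma mat_vec_pow_eq_walk_sum:
  assumes "finite V" "i \<in> V"
  shows "(mat_vec V (\<lambda>i j. z (uedge i j)) ^^ n) x i = (\<Sum>j\<in>V. walk_sum V z n i j * x j)"
  using assms(2)
proof (induction n arbitrary: i)
  case 0
  then show ?case using assms(1)
    by (simp add: walk_sum_0 if_distrib[of "\<lambda>y. y * _"] cong: if_cong)
next
  case (Suc n)
  have "(mat_vec V (\<lambda>i j. z (uedge i j)) ^^ Suc n) x i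
      = (\<Sum>l\<in>V. z (uedge i l) * (\<Sum>j\<in>V. walk_sum V z n l j * x j))"
    unfolding funpow.simps comp_def by (subst mat_vec_def) (intro sum.cong refl, simp only: Suc.IH)
  also have "\<dots> = (\<Sum>l\<in>V. \<Sum>j\<in>V. z (uedge i l) * walk_sum V z n l j * x j)"
    by (simp add: sum_distrib_left mult_ac)
  also have "\<dots> = (\<Sum>j\<in>V. \<Sum>l\<in>V. z (uedge i l) * walk_sum V z n l j * x j)" by (rule sum.swap)
  also have "\<dots> = (\<Sum>j\<in>V. walk_sum V z (Suc n) i j * x j)"
    by (simp add: walk_sum_Suc assms(1) Suc.prems sum_distrib_right)
  finally show ?case .
qed

definition closed_walks :: "nat set \<Rightarrow> nat \<Rightarrow> nat list set" where
  "closed_walks V n = {w \<in> walks V n. hd w = last w}"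

text \<open>Both sides are the trace of the power \<open>2 * k\<close>; the right side is the
  squared Frobenius norm of the k-th power. That form shows that the closed walk sum is nonnegative,
  as Markov's inequality will require.\<close>

lemma closed_walk_sum_eq:
  assumes V: "finite V"
  shows "(\<Sum>w\<in>closed_walks V (2 * k). prod_list (map z (steps w)))
    = (\<Sum>j\<in>V. \<Sum>i\<in>V. (walk_sum V z k i j)\<^sup>2)"
proof -
  let ?B = "\<lambda>i j. z (uedge i j)"
  have sym: "?B i j = ?B j i" for i j by (simp only: uedge_commute)
  note adj = mat_vec_pow_self_adjoint[of ?B, OF sym]
  have diag: "(\<Sum>i\<in>V. (walk_sum V z k i j)\<^sup>2) = walk_sum V z (2 * k) j j" if j: "j \<in> V" for j
  proof -
    define e where "e = (\<lambda>i. if i = j then 1 else 0 :: real)"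
    have pe: "(mat_vec V ?B ^^ n) e i = walk_sum V z n i j" if "i \<in> V" for n i
      unfolding mat_vec_pow_eq_walk_sum[OF V that] e_def using V j
      by (simp add: if_distrib[of "\<lambda>y. _ * y"] cong: if_cong)
    have "(\<Sum>i\<in>V. (walk_sum V z k i j)\<^sup>2) = (\<Sum>i\<in>V. (mat_vec V ?B ^^ k) e i * (mat_vec V ?B ^^ k) e i)"
      by (rule sum.cong) (simp_all add: pe power2_eq_square)
    also have "\<dots> = (\<Sum>i\<in>V. e i * (mat_vec V ?B ^^ (k + k)) e i)" by (rule adj)
    also have "\<dots> = (\<Sum>i\<in>V. e i * walk_sum V z (2 * k) i j)"
      by (rule sum.cong) (simp_all add: pe mult_2)
    also have "\<dots> = walk_sum V z (2 * k) j j"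
      unfolding e_def using V j by (simp add: if_distrib[of "\<lambda>y. y * _"] cong: if_cong)
    finally show ?thesis .
  qed
  have "(\<Sum>j\<in>V. walk_sum V z (2 * k) j j)
      = (\<Sum>j\<in>V. \<Sum>w\<in>{w \<in> closed_walks V (2 * k). hd w = j}. prod_list (map z (steps w)))"
    unfolding walk_sum_def closed_walks_def by (intro sum.cong) auto
  also have "\<dots> = (\<Sum>w\<in>closed_walks V (2 * k). prod_list (map z (steps w)))"
  proof (rule sum.group)
    show "finite (closed_walks V (2 * k))" using V finite_walks by (simp add: closed_walks_def)
    show "hd ` closed_walks V (2 * k) \<subseteq> V"
      unfolding closed_walks_def by (rule image_subsetI) (blast dest: hd_walk)
  qed fact
  finally show ?thesis by (simp add: diag)
qed

text \<open>For a unit vector, the 2k-th power of the norm of its image is at most the squared norm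
  of its k-th iterate, hence at most the squared Frobenius norm of the k-th power, which is the
  trace.\<close>

lemma op_le_of_closed_walk_sum:
  assumes V: "finite V" and t: "0 \<le> t" "k > 0"
    and le: "(\<Sum>w\<in>closed_walks V (2 * k). prod_list (map z (steps w))) \<le> t ^ (2 * k)"
  shows "op_le V (\<lambda>i j. z (uedge i j)) t"
proof (rule op_le_unit)
  let ?B = "\<lambda>i j. z (uedge i j)"
  have sym: "?B i j = ?B j i" for i j by (simp only: uedge_commute)
  fix x assume x: "L2_set x V = 1"
  have "L2_set (mat_vec V ?B x) V ^ (2 * k) = (L2_set (mat_vec V ?B x) V ^ k)\<^sup>2"
    by (rule power_even_eq)
  also have "\<dots> \<le> (L2_set ((mat_vec V ?B ^^ k) x) V)\<^sup>2"
    by (rule power_mono[OF L2_pow_ge[of ?B, OF sym x]]) simp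
  also have "\<dots> \<le> (\<Sum>i\<in>V. \<Sum>j\<in>V. (walk_sum V z k i j)\<^sup>2) * (L2_set x V)\<^sup>2"
    by (rule L2_le_matrix_L2) (simp add: mat_vec_pow_eq_walk_sum V)
  also have "\<dots> = (\<Sum>i\<in>V. \<Sum>j\<in>V. (walk_sum V z k i j)\<^sup>2)" using x by simp
  also have "\<dots> = (\<Sum>j\<in>V. \<Sum>i\<in>V. (walk_sum V z k i j)\<^sup>2)" by (rule sum.swap)
  also have "\<dots> \<le> t ^ (2 * k)" using le unfolding closed_walk_sum_eq[OF V] .
  finally show "L2_set (mat_vec V ?B x) V \<le> t"
    using power_mono_iff[of "L2_set (mat_vec V ?B x) V" t "2 * k"] t by simp
qed fact

text \<open>Choose the set of v visited vertices, in at most \<open>card V ^ v\<close> ways, and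
  then any sequence of 2 k + 1 of them. Forgetting the tree structure costs about k^(2 k), that is,
  a factor k in the norm. As \<open>real (card V) * \<rho>\<close> is at least 1, the case v = k + 1
  bounds all others; the exponent \<open>2 * k + 2\<close> accounts for the 2 k + 1 positions and
  for the sum over v.\<close>

lemma walk_count_bound:
  fixes \<rho> :: real
  assumes V: "finite V" "V \<noteq> {}" and \<rho>: "0 < \<rho>" "1 \<le> real (card V) * \<rho>"
  shows "(\<Sum>w\<in>{w \<in> walks V (2 * k). card (set w) \<le> Suc k}. \<rho> ^ (card (set w) - 1))
    \<le> real (Suc k) ^ (2 * k + 2) * real (card V) * (real (card V) * \<rho>) ^ k"
proof -
  let ?N = "card V" and ?W = "{w \<in> walks V (2 * k). card (set w) \<le> Suc k}"
  have N: "?N > 0" using V by (simp add: card_gt_0_iff)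
  have cnt: "real (card {w \<in> ?W. card (set w) = v}) \<le> real ?N ^ v * real v ^ (2 * k + 1)"
    if v: "v \<le> Suc k" for v
  proof -
    let ?Ts = "{T. T \<subseteq> V \<and> card T = v}"
    have finTs: "finite ?Ts" using V by simp
    have sub: "{w \<in> ?W. card (set w) = v} \<subseteq> (\<Union>T\<in>?Ts. {w. set w \<subseteq> T \<and> length w = Suc (2 * k)})"
      by (auto simp: walks_def)
    have fT: "finite T" if "T \<in> ?Ts" for T using that V finite_subset by auto
    have "card {w \<in> ?W. card (set w) = v} \<le> card (\<Union>T\<in>?Ts. {w. set w \<subseteq> T \<and> length w = Suc (2 * k)})"
      by (rule card_mono[OF _ sub]) (use finTs fT finite_lists_length_eq in blast)
    also have "\<dots> \<le> (\<Sum>T\<in>?Ts. card {w. set w \<subseteq> T \<and> length w = Suc (2 * k)})"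
      by (rule card_UN_le[OF finTs])
    also have "\<dots> = (\<Sum>T\<in>?Ts. v ^ Suc (2 * k))"
    proof (rule sum.cong)
      fix T assume "T \<in> ?Ts"
      then show "card {w. set w \<subseteq> T \<and> length w = Suc (2 * k)} = v ^ Suc (2 * k)"
        using card_lists_length_eq[OF fT, of T "Suc (2 * k)"] by simp
    qed simp
    also have "\<dots> = (?N choose v) * v ^ Suc (2 * k)"
      using n_subsets[OF V(1), of v] by simp
    also have "\<dots> \<le> ?N ^ v * v ^ Suc (2 * k)"
    proof (rule mult_right_mono)
      show "?N choose v \<le> ?N ^ v"
        by (cases "v \<le> ?N") (simp_all add: binomial_le_pow binomial_eq_0)
    qed simp
    finally have "card {w \<in> ?W. card (set w) = v} \<le> ?N ^ v * v ^ Suc (2 * k)" .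
    then have "real (card {w \<in> ?W. card (set w) = v}) \<le> real (?N ^ v * v ^ Suc (2 * k))"
      by (simp only: of_nat_le_iff)
    then show ?thesis by simp
  qed
  have finW: "finite ?W" using finite_walks[OF V(1)] by simp
  have pos: "card (set w) \<in> {1..Suc k}" if "w \<in> ?W" for w
  proof -
    have "w \<noteq> []" using that by (auto simp: walks_def)
    then have "card (set w) > 0" by (simp add: card_gt_0_iff)
    with that show ?thesis by simp
  qed
  have "(\<Sum>w\<in>?W. \<rho> ^ (card (set w) - 1))
      = (\<Sum>v\<in>{1..Suc k}. \<Sum>w\<in>{w \<in> ?W. card (set w) = v}. \<rho> ^ (card (set w) - 1))"
    by (rule sum.group[symmetric]) (use finW pos in auto)
  also have "\<dots> = (\<Sum>v\<in>{1..Suc k}. real (card {w \<in> ?W. card (set w) = v}) * \<rho> ^ (v - 1))"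
    by (rule sum.cong) auto
  also have "\<dots> \<le> (\<Sum>v\<in>{1..Suc k}. real (Suc k) ^ (2 * k + 1) * real ?N * (real ?N * \<rho>) ^ k)"
  proof (rule sum_mono)
    fix v assume v: "v \<in> {1..Suc k}"
    have "real (card {w \<in> ?W. card (set w) = v}) * \<rho> ^ (v - 1)
        \<le> real ?N ^ v * real v ^ (2 * k + 1) * \<rho> ^ (v - 1)"
      using v \<rho> by (intro mult_right_mono cnt) auto
    also have "real ?N ^ v = real ?N * real ?N ^ (v - 1)"
      using v by (cases v) auto
    also have "real ?N * real ?N ^ (v - 1) * real v ^ (2 * k + 1) * \<rho> ^ (v - 1)
        = real v ^ (2 * k + 1) * real ?N * (real ?N * \<rho>) ^ (v - 1)"
      by (simp add: power_mult_distrib mult_ac)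
    also have "\<dots> \<le> real (Suc k) ^ (2 * k + 1) * real ?N * (real ?N * \<rho>) ^ k"
      using v \<rho> by (intro mult_mono power_mono power_increasing) (auto intro!: mult_nonneg_nonneg)
    finally show "real (card {w \<in> ?W. card (set w) = v}) * \<rho> ^ (v - 1)
        \<le> real (Suc k) ^ (2 * k + 1) * real ?N * (real ?N * \<rho>) ^ k" .
  qed
  also have "\<dots> = real (Suc k) ^ (2 * k + 2) * real ?N * (real ?N * \<rho>) ^ k" by simp
  finally show ?thesis .
qed

section \<open>Bounded independent centred families\<close>

locale bounded_family = prob_space M for M :: "'a measure" +
  fixes I :: "'i set" and Z :: "'i \<Rightarrow> 'a \<Rightarrow> real" and a :: real
  assumes finite_index: "finite I"
    and indep: "indep_vars (\<lambda>_. borel) Z I"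
    and bounded: "\<And>e \<omega>. e \<in> I \<Longrightarrow> \<omega> \<in> space M \<Longrightarrow> \<bar>Z e \<omega>\<bar> \<le> a"
    and mean_zero: "\<And>e. e \<in> I \<Longrightarrow> expectation (Z e) = 0"
    and bound_pos: "0 < a"
begin

lemma measurable_Z: "e \<in> I \<Longrightarrow> Z e \<in> borel_measurable M"
  using indep by (auto simp: indep_vars_def)

lemma integrable_bounded_fun:
  fixes f :: "real \<Rightarrow> real"
  assumes "e \<in> I" "f \<in> borel_measurable borel" "\<And>x. \<bar>x\<bar> \<le> a \<Longrightarrow> \<bar>f x\<bar> \<le> c"
  shows "integrable M (\<lambda>\<omega>. f (Z e \<omega>))"
proof (rule integrable_const_bound)
  show "AE \<omega> in M. norm (f (Z e \<omega>)) \<le> c" using assms bounded by (intro AE_I2) auto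
  show "(\<lambda>\<omega>. f (Z e \<omega>)) \<in> borel_measurable M"
    using measurable_compose[OF measurable_Z assms(2)] assms(1) by simp
qed

lemma integrable_pow: "e \<in> I \<Longrightarrow> integrable M (\<lambda>\<omega>. Z e \<omega> ^ m)"
  by (rule integrable_bounded_fun[where f = "\<lambda>x. x ^ m" and c = "a ^ m"])
    (auto simp: power_abs intro: power_mono)

lemma bounded_family_subset:
  assumes "J \<subseteq> I"
  shows "bounded_family M J Z a"
  using assms finite_subset[OF assms finite_index] indep_vars_subset[OF indep assms] bounded mean_zero bound_pos
  by unfold_locales auto

lemma bounded_family_uminus: "bounded_family M I (\<lambda>e \<omega>. - Z e \<omega>) a"
  using finite_index indep_vars_compose2[OF indep, of "\<lambda>_ x. - x" "\<lambda>_. borel"] bounded mean_zero bound_pos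
  by unfold_locales auto

lemma expectation_prod_comp:
  fixes f :: "'i \<Rightarrow> real \<Rightarrow> real"
  assumes "J \<subseteq> I" "\<And>e. e \<in> J \<Longrightarrow> f e \<in> borel_measurable borel"
    "\<And>e. e \<in> J \<Longrightarrow> integrable M (\<lambda>\<omega>. f e (Z e \<omega>))"
  shows "expectation (\<lambda>\<omega>. \<Prod>e\<in>J. f e (Z e \<omega>)) = (\<Prod>e\<in>J. expectation (\<lambda>\<omega>. f e (Z e \<omega>)))"
    and "integrable M (\<lambda>\<omega>. \<Prod>e\<in>J. f e (Z e \<omega>))"
proof -
  have "indep_vars (\<lambda>_. borel) (\<lambda>e \<omega>. f e (Z e \<omega>)) J"
    using indep_vars_compose2[OF indep_vars_subset[OF indep assms(1)], of f "\<lambda>_. borel"] assms(2) by simp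
  moreover have "finite J" using finite_index assms(1) finite_subset by blast
  ultimately show "expectation (\<lambda>\<omega>. \<Prod>e\<in>J. f e (Z e \<omega>)) = (\<Prod>e\<in>J. expectation (\<lambda>\<omega>. f e (Z e \<omega>)))"
    and "integrable M (\<lambda>\<omega>. \<Prod>e\<in>J. f e (Z e \<omega>))"
    using indep_vars_lebesgue_integral indep_vars_integrable assms(3) by blast+
qed

text \<open>All factors beyond the second are bounded by \<open>a\<close>. The bound is written with
  the ratio \<open>b / a\<^sup>2\<close> so that a product over edges becomes a power of
  \<open>a\<close> given by the length of the walk and a power of the ratio given by the number of
  distinct edges.\<close>

lemma abs_moment_le:
  assumes e: "e \<in> I" and b: "expectation (\<lambda>\<omega>. (Z e \<omega>)\<^sup>2) \<le> b" and m: "m \<ge> 2"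
  shows "\<bar>expectation (\<lambda>\<omega>. Z e \<omega> ^ m)\<bar> \<le> a ^ m * (b / a\<^sup>2)"
proof -
  have "\<bar>expectation (\<lambda>\<omega>. Z e \<omega> ^ m)\<bar> \<le> expectation (\<lambda>\<omega>. \<bar>Z e \<omega> ^ m\<bar>)"
    by (rule integral_abs_bound)
  also have "\<dots> \<le> expectation (\<lambda>\<omega>. a ^ (m - 2) * (Z e \<omega>)\<^sup>2)"
  proof (rule integral_mono)
    show "integrable M (\<lambda>\<omega>. \<bar>Z e \<omega> ^ m\<bar>)" using integrable_pow[OF e] by (rule integrable_abs)
    show "integrable M (\<lambda>\<omega>. a ^ (m - 2) * (Z e \<omega>)\<^sup>2)" using integrable_pow[OF e] by simp
    fix \<omega> assume \<omega>: "\<omega> \<in> space M"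
    have "\<bar>Z e \<omega> ^ m\<bar> = \<bar>Z e \<omega>\<bar> ^ (m - 2) * (Z e \<omega>)\<^sup>2"
    proof -
      have "\<bar>Z e \<omega> ^ m\<bar> = \<bar>Z e \<omega>\<bar> ^ (m - 2 + 2)" by (simp only: power_abs le_add_diff_inverse2[OF m])
      then show ?thesis unfolding power_add power2_abs .
    qed
    also have "\<dots> \<le> a ^ (m - 2) * (Z e \<omega>)\<^sup>2"
      using bounded[OF e \<omega>] by (intro mult_right_mono power_mono) auto
    finally show "\<bar>Z e \<omega> ^ m\<bar> \<le> a ^ (m - 2) * (Z e \<omega>)\<^sup>2" .
  qed
  also have "\<dots> \<le> a ^ (m - 2) * b"
    using b bound_pos by simp
  also have "\<dots> = a ^ m * (b / a\<^sup>2)"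
    using m bound_pos by (simp add: power_diff)
  finally show ?thesis .
qed

text \<open>An edge occurring exactly once contributes its mean, which is zero. Otherwise every edge
  occurs at least twice, which forces \<open>2 * card (set es) \<le> length es\<close>, and
  \<open>abs_moment_le\<close> gives one factor \<open>b / a\<^sup>2\<close> per distinct
  edge.\<close>

lemma abs_expectation_prod_list_le:
  assumes es: "set es \<subseteq> I" and b: "\<And>e. e \<in> I \<Longrightarrow> expectation (\<lambda>\<omega>. (Z e \<omega>)\<^sup>2) \<le> b" "b > 0"
  shows "\<bar>expectation (\<lambda>\<omega>. \<Prod>e\<leftarrow>es. Z e \<omega>)\<bar>
    \<le> (if 2 * card (set es) \<le> length es then a ^ length es * (b / a\<^sup>2) ^ card (set es) else 0)"
    and integrable_prod_list: "integrable M (\<lambda>\<omega>. \<Prod>e\<leftarrow>es. Z e \<omega>)"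
proof -
  let ?f = "\<lambda>e x. x ^ count_list es e"
  have eq: "(\<Prod>e\<leftarrow>es. Z e \<omega>) = (\<Prod>e\<in>set es. ?f e (Z e \<omega>))" for \<omega>
  proof -
    have "prod_list (map g es) = (\<Prod>e\<in>set es. g e ^ count_list es e)" for g :: "'i \<Rightarrow> real"
    proof (induction es)
      case (Cons x es)
      show ?case
      proof (cases "x \<in> set es")
        case True
        have "(\<Prod>e\<in>set es. g e ^ count_list (x # es) e)
            = g x ^ Suc (count_list es x) * (\<Prod>e\<in>set es - {x}. g e ^ count_list (x # es) e)"
          using True by (simp add: prod.remove[of "set es" x])
        also have "(\<Prod>e\<in>set es - {x}. g e ^ count_list (x # es) e) = (\<Prod>e\<in>set es - {x}. g e ^ count_list es e)"
          by (rule prod.cong) auto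
        also have "g x ^ Suc (count_list es x) * \<dots> = g x * (\<Prod>e\<in>set es. g e ^ count_list es e)"
          using True by (simp add: prod.remove[of "set es" x])
        finally show ?thesis using Cons True by (simp add: insert_absorb)
      next
        case False
        have "(\<Prod>e\<in>set es. g e ^ count_list (x # es) e) = (\<Prod>e\<in>set es. g e ^ count_list es e)"
          by (rule prod.cong) (use False in auto)
        then show ?thesis using Cons False by simp
      qed
    qed simp
    then show ?thesis .
  qed
  have ip: "integrable M (\<lambda>\<omega>. ?f e (Z e \<omega>))" if "e \<in> set es" for e
    using that es integrable_pow by auto
  show "integrable M (\<lambda>\<omega>. \<Prod>e\<leftarrow>es. Z e \<omega>)"
    unfolding eq by (rule expectation_prod_comp) (use es ip in auto)
  have E: "expectation (\<lambda>\<omega>. \<Prod>e\<leftarrow>es. Z e \<omega>) = (\<Prod>e\<in>set es. expectation (\<lambda>\<omega>. ?f e (Z e \<omega>)))"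
    unfolding eq by (rule expectation_prod_comp) (use es ip in auto)
  show "\<bar>expectation (\<lambda>\<omega>. \<Prod>e\<leftarrow>es. Z e \<omega>)\<bar>
    \<le> (if 2 * card (set es) \<le> length es then a ^ length es * (b / a\<^sup>2) ^ card (set es) else 0)"
  proof (cases "\<exists>e\<in>set es. count_list es e = 1")
    case True
    then obtain e where "e \<in> set es" "count_list es e = 1" by blast
    then have "expectation (\<lambda>\<omega>. ?f e (Z e \<omega>)) = 0" using es mean_zero[of e] by auto
    then have "expectation (\<lambda>\<omega>. \<Prod>e\<leftarrow>es. Z e \<omega>) = 0"
      unfolding E using \<open>e \<in> set es\<close> by (intro prod_zero) auto
    then show ?thesis using b bound_pos by simp
  next
    case False
    have ge2: "count_list es e \<ge> 2" if "e \<in> set es" for e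
    proof -
      have "count_list es e \<noteq> 0" "count_list es e \<noteq> 1" using that False by (auto simp: count_list_0_iff)
      then show ?thesis by linarith
    qed
    have len: "length es = (\<Sum>e\<in>set es. count_list es e)"
      using sum_count_set[of es "set es"] by simp
    have "(\<Sum>e\<in>set es. 2) \<le> (\<Sum>e\<in>set es. count_list es e)" by (rule sum_mono) (rule ge2)
    then have le: "2 * card (set es) \<le> length es" using len by simp
    have "\<bar>expectation (\<lambda>\<omega>. \<Prod>e\<leftarrow>es. Z e \<omega>)\<bar> = (\<Prod>e\<in>set es. \<bar>expectation (\<lambda>\<omega>. ?f e (Z e \<omega>))\<bar>)"
      unfolding E by (rule abs_prod)
    also have "\<dots> \<le> (\<Prod>e\<in>set es. a ^ count_list es e * (b / a\<^sup>2))"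
      by (intro prod_mono conjI abs_ge_zero abs_moment_le b) (use es ge2 in auto)
    also have "\<dots> = a ^ length es * (b / a\<^sup>2) ^ card (set es)"
      unfolding len power_sum by (subst prod.distrib) simp
    finally show ?thesis using le by simp
  qed
qed

lemma hoeffding_linear_form:
  assumes t: "0 < t" and c: "(\<Sum>e\<in>I. (c e)\<^sup>2) \<le> C" "0 < C"
  shows "prob {\<omega> \<in> space M. (\<Sum>e\<in>I. c e * Z e \<omega>) \<ge> t} \<le> exp (- (t\<^sup>2 / (2 * a\<^sup>2 * C)))"
proof (cases "(\<Sum>e\<in>I. (c e)\<^sup>2) = 0")
  \<comment> \<open>Hoeffding's inequality needs a positive sum of squared ranges; if all
    coefficients vanish, the event is empty because \<open>t\<close> is positive.\<close>
  case True
  then have "c e = 0" if "e \<in> I" for e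
    using that finite_index by (simp add: sum_nonneg_eq_0_iff)
  then have "{\<omega> \<in> space M. (\<Sum>e\<in>I. c e * Z e \<omega>) \<ge> t} = {}" using t by auto
  then show ?thesis by (simp only: measure_empty exp_ge_zero)
next
  case False
  let ?S = "\<Sum>e\<in>I. (c e)\<^sup>2"
  have S: "?S > 0" using False by (simp add: sum_nonneg less_le)
  interpret H: Hoeffding_ineq M I "\<lambda>e \<omega>. c e * Z e \<omega>" "\<lambda>e. - (\<bar>c e\<bar> * a)" "\<lambda>e. \<bar>c e\<bar> * a"
    "\<Sum>e\<in>I. expectation (\<lambda>\<omega>. c e * Z e \<omega>)"
  proof unfold_locales
    show "indep_vars (\<lambda>_. borel) (\<lambda>e \<omega>. c e * Z e \<omega>) I"
      using indep_vars_compose2[OF indep, of "\<lambda>e x. c e * x" "\<lambda>_. borel"] by simp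
    fix e assume e: "e \<in> I"
    have "\<bar>c e * Z e \<omega>\<bar> \<le> \<bar>c e\<bar> * a" if "\<omega> \<in> space M" for \<omega>
      unfolding abs_mult using bounded[OF e that] by (intro mult_left_mono) auto
    then show "AE \<omega> in M. c e * Z e \<omega> \<in> {- (\<bar>c e\<bar> * a)..\<bar>c e\<bar> * a}"
      by (intro AE_I2) (force simp: abs_le_iff)
  qed (fact finite_index)
  have sq: "(\<Sum>e\<in>I. (\<bar>c e\<bar> * a - - (\<bar>c e\<bar> * a))\<^sup>2) = 4 * a\<^sup>2 * ?S"
    by (simp add: sum_distrib_left power_mult_distrib mult_ac)
  have \<mu>: "(\<Sum>e\<in>I. expectation (\<lambda>\<omega>. c e * Z e \<omega>)) = 0"
    by (simp add: mean_zero)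
  have "prob {\<omega> \<in> space M. (\<Sum>e\<in>I. c e * Z e \<omega>) \<ge> t} \<le> exp (- 2 * t\<^sup>2 / (4 * a\<^sup>2 * ?S))"
    using H.Hoeffding_ineq_ge[of t] t S bound_pos unfolding sq \<mu> by simp
  also have "- 2 * t\<^sup>2 / (4 * a\<^sup>2 * ?S) = - (t\<^sup>2 / (2 * a\<^sup>2 * ?S))" by simp
  also have "\<dots> \<le> - (t\<^sup>2 / (2 * a\<^sup>2 * C))"
    unfolding neg_le_iff_le using c S bound_pos by (intro divide_left_mono mult_left_mono) auto
  finally show ?thesis by simp
qed

end

definition upairs :: "nat \<Rightarrow> (nat \<times> nat) set" where
  "upairs N = {(i, j). 1 \<le> i \<and> i \<le> j \<and> j \<le> N}"

lemma finite_upairs: "finite (upairs N)"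
  by (rule finite_subset[of _ "{1..N} \<times> {1..N}"]) (auto simp: upairs_def)

lemma uedge_in_upairs: "i \<in> {1..N} \<Longrightarrow> j \<in> {1..N} \<Longrightarrow> uedge i j \<in> upairs N"
  by (auto simp: upairs_def)

lemma steps_in_upairs: "set w \<subseteq> {1..N} \<Longrightarrow> set (steps w) \<subseteq> upairs N"
proof (induction w rule: steps.induct)
  case (1 i j w)
  then show ?case using uedge_in_upairs[of i N j] by simp
qed auto

text \<open>The entries at (i, j) and (j, i) are the same variable, so their coefficients must be
  collected before independence can be used. At most two ordered pairs give the same edge, whence
  the factor 2.\<close>

lemma bilinear_form_upairs:
  fixes x y :: "nat \<Rightarrow> real" and N :: nat
  defines "c \<equiv> \<lambda>e. \<Sum>p\<in>{p \<in> {1..N} \<times> {1..N}. uedge (fst p) (snd p) = e}. x (fst p) * y (snd p)"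
  shows "(\<Sum>i=1..N. \<Sum>j=1..N. x i * z (uedge i j) * y j) = (\<Sum>e\<in>upairs N. c e * z e)"
    and "(\<Sum>e\<in>upairs N. (c e)\<^sup>2) \<le> 2 * (\<Sum>i=1..N. (x i)\<^sup>2) * (\<Sum>i=1..N. (y i)\<^sup>2)"
proof -
  let ?V = "{1..N}" and ?u = "\<lambda>p. uedge (fst p) (snd p)"
  let ?F = "\<lambda>e. {p \<in> ?V \<times> ?V. ?u p = e}"
  have im: "?u ` (?V \<times> ?V) \<subseteq> upairs N" using uedge_in_upairs by auto
  have "(\<Sum>i=1..N. \<Sum>j=1..N. x i * z (uedge i j) * y j)
      = (\<Sum>p\<in>?V \<times> ?V. x (fst p) * y (snd p) * z (?u p))"
    by (simp add: sum.cartesian_product case_prod_beta mult_ac)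
  also have "\<dots> = (\<Sum>e\<in>upairs N. \<Sum>p\<in>?F e. x (fst p) * y (snd p) * z (?u p))"
    by (rule sum.group[symmetric]) (use im finite_upairs in auto)
  also have "\<dots> = (\<Sum>e\<in>upairs N. c e * z e)"
    unfolding c_def sum_distrib_right by (intro sum.cong) auto
  finally show "(\<Sum>i=1..N. \<Sum>j=1..N. x i * z (uedge i j) * y j) = (\<Sum>e\<in>upairs N. c e * z e)" .
  have card2: "card (?F e) \<le> 2" for e
  proof -
    have "?F e \<subseteq> {e, (snd e, fst e)}" by (auto simp: min_def max_def split: if_splits)
    then have "card (?F e) \<le> card {e, (snd e, fst e)}" by (intro card_mono) auto
    also have "\<dots> \<le> 2" by (simp add: card_insert_if)
    finally show ?thesis .
  qed
  have "(\<Sum>e\<in>upairs N. (c e)\<^sup>2) \<le> (\<Sum>e\<in>upairs N. 2 * (\<Sum>p\<in>?F e. (x (fst p) * y (snd p))\<^sup>2))"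
  proof (rule sum_mono)
    fix e
    have "(c e)\<^sup>2 \<le> (\<Sum>p\<in>?F e. (x (fst p) * y (snd p))\<^sup>2) * real (card (?F e))"
      unfolding c_def by (rule sum_squared_le_sum_of_squares)
    also have "\<dots> \<le> (\<Sum>p\<in>?F e. (x (fst p) * y (snd p))\<^sup>2) * 2"
      using card2[of e] by (intro mult_left_mono sum_nonneg) auto
    finally show "(c e)\<^sup>2 \<le> 2 * (\<Sum>p\<in>?F e. (x (fst p) * y (snd p))\<^sup>2)" by simp
  qed
  also have "\<dots> = 2 * (\<Sum>e\<in>upairs N. \<Sum>p\<in>?F e. (x (fst p) * y (snd p))\<^sup>2)"
    by (simp add: sum_distrib_left)
  also have "(\<Sum>e\<in>upairs N. \<Sum>p\<in>?F e. (x (fst p) * y (snd p))\<^sup>2) = (\<Sum>p\<in>?V \<times> ?V. (x (fst p) * y (snd p))\<^sup>2)"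
    by (rule sum.group) (use im finite_upairs in auto)
  also have "\<dots> = (\<Sum>i=1..N. (x i)\<^sup>2) * (\<Sum>i=1..N. (y i)\<^sup>2)"
    by (simp add: sum_product sum.cartesian_product case_prod_beta power_mult_distrib)
  finally show "(\<Sum>e\<in>upairs N. (c e)\<^sup>2) \<le> 2 * (\<Sum>i=1..N. (x i)\<^sup>2) * (\<Sum>i=1..N. (y i)\<^sup>2)" by simp
qed

section \<open>Norm bounds for random symmetric matrices\<close>

locale bounded_array = bounded_family M "upairs N" Z a
  for M :: "'a measure" and N :: nat and Z :: "nat \<times> nat \<Rightarrow> 'a \<Rightarrow> real" and a :: real
begin

lemma op_norm_net_bound:
  assumes N: "N \<ge> 1"
  shows "\<exists>E\<in>events. prob E \<le> exp (- real N) \<and>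
    (\<forall>\<omega>\<in>space M - E. op_le {1..N} (\<lambda>i j. Z (uedge i j) \<omega>) (32 * a * sqrt (real N)))"
proof -
  \<comment> \<open>This makes Hoeffding's exponent for one pair of lattice points equal to 16 N,
    against at most 48^(2 N) \<le> exp (12 N) pairs.\<close>
  define t where "t = 8 * a * sqrt (real N)"
  have t: "t > 0" using N bound_pos by (simp add: t_def)
  let ?L = "lattice_ball {1..N}"
  define q where "q k l \<omega> = (\<Sum>i=1..N. \<Sum>j=1..N. of_int (k i) * Z (uedge i j) \<omega> * of_int (l j))"
    for k l :: "nat \<Rightarrow> int" and \<omega>
  define F where "F p = {\<omega> \<in> space M. q (fst p) (snd p) \<omega> \<ge> 4 * real N * t}" for p
  have meas [measurable]: "q k l \<in> borel_measurable M" for k l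
    unfolding q_def using measurable_Z[OF uedge_in_upairs]
    by (intro borel_measurable_sum borel_measurable_times borel_measurable_const) auto
  have F: "F p \<in> events" for p unfolding F_def by measurable
  have lat: "(\<Sum>i=1..N. (real_of_int (k i))\<^sup>2) \<le> 4 * real N" if "k \<in> ?L" for k
  proof -
    have "real_of_int (\<Sum>i\<in>{1..N}. (k i)\<^sup>2) \<le> real_of_int (4 * int N)"
      using that unfolding of_int_le_iff by (simp add: lattice_ball_def)
    then show ?thesis by simp
  qed
  have single: "prob (F (k, l)) \<le> exp (- 16 * real N)" if kl: "k \<in> ?L" "l \<in> ?L" for k l
  proof -
    define c where "c = (\<lambda>e. \<Sum>p\<in>{p \<in> {1..N} \<times> {1..N}. uedge (fst p) (snd p) = e}.
        real_of_int (k (fst p)) * real_of_int (l (snd p)))"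
    have "(\<Sum>e\<in>upairs N. (c e)\<^sup>2) \<le> 2 * (\<Sum>i=1..N. (real_of_int (k i))\<^sup>2) * (\<Sum>i=1..N. (real_of_int (l i))\<^sup>2)"
      unfolding c_def by (rule bilinear_form_upairs)
    also have "\<dots> \<le> 2 * (4 * real N) * (4 * real N)"
      using lat kl by (intro mult_mono) (auto intro!: sum_nonneg)
    finally have c2: "(\<Sum>e\<in>upairs N. (c e)\<^sup>2) \<le> 32 * (real N)\<^sup>2" by (simp add: power2_eq_square)
    have qc: "q k l \<omega> = (\<Sum>e\<in>upairs N. c e * Z e \<omega>)" for \<omega>
      unfolding q_def c_def by (rule bilinear_form_upairs)
    have "prob (F (k, l)) \<le> exp (- ((4 * real N * t)\<^sup>2 / (2 * a\<^sup>2 * (32 * (real N)\<^sup>2))))"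
      unfolding F_def fst_conv snd_conv qc by (rule hoeffding_linear_form) (use N t c2 in auto)
    also have "(4 * real N * t)\<^sup>2 / (2 * a\<^sup>2 * (32 * (real N)\<^sup>2)) = 16 * real N"
      using N bound_pos by (simp add: t_def power_mult_distrib field_simps)
    finally show ?thesis by simp
  qed
  let ?E = "\<Union>p\<in>?L \<times> ?L. F p"
  have finL: "finite ?L" by (rule finite_lattice_ball) simp
  have "prob ?E \<le> (\<Sum>p\<in>?L \<times> ?L. prob (F p))"
    using finL F by (intro finite_measure_subadditive_finite) auto
  also have "\<dots> \<le> (\<Sum>p\<in>?L \<times> ?L. exp (- 16 * real N))"
    by (rule sum_mono) (use single in auto)
  also have "\<dots> = real (card ?L) * real (card ?L) * exp (- 16 * real N)" by (simp add: card_cartesian_product)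
  also have "\<dots> \<le> 48 ^ N * 48 ^ N * exp (- 16 * real N)"
    using card_lattice_ball_le[of "{1..N}"] by (intro mult_right_mono mult_mono) auto
  also have "(48::real) ^ N * 48 ^ N = 2304 ^ N" by (simp flip: power_mult_distrib)
  also have "(2304::real) ^ N \<le> (2 ^ 12) ^ N" by (intro power_mono) auto
  also have "\<dots> \<le> (exp 1 ^ 12) ^ N"
    using exp_ge_add_one_self[of 1] by (intro power_mono) auto
  also have "(exp (1::real) ^ 12) ^ N = exp (12 * real N)"
    unfolding power_mult[symmetric] exp_of_nat_mult[symmetric] by simp
  also have "exp (12 * real N) * exp (- 16 * real N) = exp (- 4 * real N)" by (simp flip: exp_add)
  also have "\<dots> \<le> exp (- real N)" by simp
  finally have pE: "prob ?E \<le> exp (- real N)" by (simp add: mult_right_mono)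
  have "op_le {1..N} (\<lambda>i j. Z (uedge i j) \<omega>) (4 * t)" if \<omega>: "\<omega> \<in> space M - ?E" for \<omega>
  proof (rule op_le_of_lattice_bound[OF N])
    fix k l assume kl: "k \<in> ?L" "l \<in> ?L"
    then have "\<omega> \<notin> F (k, l)" using \<omega> by blast
    then show "(\<Sum>i=1..N. \<Sum>j=1..N. of_int (k i) * Z (uedge i j) \<omega> * of_int (l j)) \<le> 4 * real N * t"
      using \<omega> by (simp add: F_def q_def)
  qed
  moreover have "4 * t = 32 * a * sqrt (real N)" by (simp add: t_def)
  moreover have "?E \<in> events" using finL F by (intro sets.finite_UN) auto
  ultimately show ?thesis using pE by (intro bexI[of _ ?E]) auto
qed

text \<open>Markov's inequality for the trace of the power \<open>2 * k\<close>. Only walks using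
  each of their edges at least twice contribute, so they have at most k distinct edges and k + 1
  vertices. The hypothesis \<open>b \<le> a\<^sup>2\<close> allows the number of edges to be
  replaced by the number of vertices minus one in the power of \<open>\<rho>\<close>;
  \<open>a\<^sup>2 \<le> real N * b\<close> is the condition of
  \<open>walk_count_bound\<close>.\<close>

lemma op_norm_moment_bound:
  assumes N: "N \<ge> 1" and b: "\<And>e. e \<in> upairs N \<Longrightarrow> expectation (\<lambda>\<omega>. (Z e \<omega>)\<^sup>2) \<le> b" "b > 0"
    "b \<le> a\<^sup>2" "a\<^sup>2 \<le> real N * b" and t: "t > 0" and k: "k > 0"
  shows "\<exists>E\<in>events. prob E \<le> real (Suc k) ^ (2 * k + 2) * real N * (real N * b) ^ k / t ^ (2 * k) \<and>
    (\<forall>\<omega>\<in>space M - E. op_le {1..N} (\<lambda>i j. Z (uedge i j) \<omega>) t)"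
proof -
  let ?V = "{1..N}"
  let ?C = "closed_walks ?V (2 * k)"
  define \<rho> where "\<rho> = b / a\<^sup>2"
  have \<rho>: "0 < \<rho>" "\<rho> \<le> 1" "1 \<le> real (card ?V) * \<rho>"
    using b bound_pos by (auto simp: \<rho>_def field_simps)
  define T where "T \<omega> = (\<Sum>w\<in>?C. \<Prod>e\<leftarrow>steps w. Z e \<omega>)" for \<omega>
  have CV: "set (steps w) \<subseteq> upairs N" "length (steps w) = 2 * k" "w \<noteq> []" if "w \<in> walks ?V (2 * k)" for w
    using that steps_in_upairs[of w N] by (auto simp: walks_def length_steps)
  have CW: "?C \<subseteq> walks ?V (2 * k)" by (auto simp: closed_walks_def)
  have finC: "finite ?C" using finite_subset[OF CW finite_walks] by simp
  have int: "integrable M (\<lambda>\<omega>. \<Prod>e\<leftarrow>steps w. Z e \<omega>)" if "w \<in> ?C" for w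
    by (rule integrable_prod_list[OF CV(1) b(1,2)]) (use CW that in blast)+
  have intT: "integrable M T" unfolding T_def using int by (rule Bochner_Integration.integrable_sum)
  let ?g = "\<lambda>w. a ^ (2 * k) * \<rho> ^ (card (set w) - 1)"
  have each: "expectation (\<lambda>\<omega>. \<Prod>e\<leftarrow>steps w. Z e \<omega>)
      \<le> (if card (set w) \<le> Suc k then ?g w else 0)" if "w \<in> ?C" for w
  proof -
    have w: "w \<in> walks ?V (2 * k)" using that CW by auto
    note cv = CV[OF w]
    have v: "card (set w) \<le> Suc (card (set (steps w)))" by (rule card_vertices_le_card_steps[OF cv(3)])
    have "expectation (\<lambda>\<omega>. \<Prod>e\<leftarrow>steps w. Z e \<omega>)
        \<le> (if 2 * card (set (steps w)) \<le> length (steps w)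
           then a ^ length (steps w) * (b / a\<^sup>2) ^ card (set (steps w)) else 0)"
      by (rule abs_le_D1[OF abs_expectation_prod_list_le(1)]) (use cv b in auto)
    also have "\<dots> \<le> (if card (set w) \<le> Suc k then ?g w else 0)"
    proof (cases "2 * card (set (steps w)) \<le> length (steps w)")
      case True
      then have "card (set w) \<le> Suc k" using cv v by simp
      moreover have "a ^ (2 * k) * \<rho> ^ card (set (steps w)) \<le> ?g w"
        using v \<rho> bound_pos by (intro mult_left_mono power_decreasing) auto
      ultimately show ?thesis using True cv by (simp add: \<rho>_def)
    next
      case False
      then show ?thesis using \<rho> bound_pos by auto
    qed
    finally show ?thesis .
  qed
  have "expectation T = (\<Sum>w\<in>?C. expectation (\<lambda>\<omega>. \<Prod>e\<leftarrow>steps w. Z e \<omega>))"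
    unfolding T_def using int by (rule Bochner_Integration.integral_sum)
  also have "\<dots> \<le> (\<Sum>w\<in>?C. if card (set w) \<le> Suc k then ?g w else 0)"
    by (rule sum_mono) (rule each)
  also have "\<dots> \<le> (\<Sum>w\<in>walks ?V (2 * k). if card (set w) \<le> Suc k then ?g w else 0)"
    using \<rho> bound_pos finite_walks CW by (intro sum_mono2) auto
  also have "\<dots> = (\<Sum>w\<in>{w \<in> walks ?V (2 * k). card (set w) \<le> Suc k}. ?g w)"
    by (rule sum.inter_filter[symmetric]) (simp add: finite_walks)
  also have "\<dots> = a ^ (2 * k) * (\<Sum>w\<in>{w \<in> walks ?V (2 * k). card (set w) \<le> Suc k}. \<rho> ^ (card (set w) - 1))"
    by (simp add: sum_distrib_left)
  also have "\<dots> \<le> a ^ (2 * k) * (real (Suc k) ^ (2 * k + 2) * real (card ?V) * (real (card ?V) * \<rho>) ^ k)"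
    by (intro mult_left_mono walk_count_bound) (use \<rho> N bound_pos in auto)
  also have "\<dots> = real (Suc k) ^ (2 * k + 2) * real N * (a\<^sup>2 * (real N * \<rho>)) ^ k"
    unfolding power_mult_distrib[of "a\<^sup>2"] power_mult[of a] card_atLeastAtMost diff_Suc_1 by (simp only: mult_ac)
  also have "a\<^sup>2 * (real N * \<rho>) = real N * b" using bound_pos by (simp add: \<rho>_def)
  finally have ET: "expectation T \<le> real (Suc k) ^ (2 * k + 2) * real N * (real N * b) ^ k" .
  have T0: "T \<omega> \<ge> 0" for \<omega>
    unfolding T_def by (subst closed_walk_sum_eq) (auto intro!: sum_nonneg)
  let ?E = "{\<omega> \<in> space M. t ^ (2 * k) \<le> T \<omega>}"
  have E: "?E \<in> events" using borel_measurable_integrable[OF intT] by measurable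
  have "prob ?E \<le> expectation T / t ^ (2 * k)"
    by (rule integral_Markov_inequality_measure[OF intT sets.empty_sets]) (use t T0 in auto)
  also have "\<dots> \<le> real (Suc k) ^ (2 * k + 2) * real N * (real N * b) ^ k / t ^ (2 * k)"
    using ET t by (intro divide_right_mono) auto
  finally have pE: "prob ?E \<le> real (Suc k) ^ (2 * k + 2) * real N * (real N * b) ^ k / t ^ (2 * k)" .
  have "op_le ?V (\<lambda>i j. Z (uedge i j) \<omega>) t" if "\<omega> \<in> space M - ?E" for \<omega>
    by (rule op_le_of_closed_walk_sum[where k = k and z = "\<lambda>e. Z e \<omega>"]) (use that t k in \<open>auto simp: T_def\<close>)
  then show ?thesis using pE E by blast
qed

end

section \<open>Moderate deviations for sums\<close>

text \<open>Taylor expansion to second order: the remainder is at most exp |y| * |y| * y^2 / 2, and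
  the 3 in \<open>\<eta> / 3\<close> cancels exp |y| \<le> exp 1 \<le> 3.\<close>

lemma exp_quadratic_bounds:
  fixes y \<eta> :: real
  assumes "\<bar>y\<bar> \<le> \<eta> / 3" "\<eta> \<le> 1"
  shows "exp y \<le> 1 + y + (1 + \<eta>) * y\<^sup>2 / 2" and "1 + y + (1 - \<eta>) * y\<^sup>2 / 2 \<le> exp y"
proof -
  have "\<bar>exp y - (\<Sum>i\<le>2. y ^ i / fact i)\<bar> \<le> exp \<bar>y\<bar> * (\<bar>y\<bar> ^ Suc 2 / fact 2)"
    using Taylor_exp_field[of y 2] by simp
  also have "exp \<bar>y\<bar> * (\<bar>y\<bar> ^ Suc 2 / fact 2) = (exp \<bar>y\<bar> * \<bar>y\<bar>) * y\<^sup>2 / 2"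
    by (simp add: eval_nat_numeral)
  also have "\<dots> \<le> (3 * (\<eta> / 3)) * y\<^sup>2 / 2"
  proof (intro divide_right_mono mult_right_mono mult_mono)
    have "exp \<bar>y\<bar> \<le> exp 1" using assms by simp
    then show "exp \<bar>y\<bar> \<le> 3" using exp_le by linarith
  qed (use assms in auto)
  finally have "\<bar>exp y - (\<Sum>i\<le>2. y ^ i / fact i)\<bar> \<le> \<eta> * y\<^sup>2 / 2" by simp
  moreover have "(\<Sum>i\<le>2. y ^ i / fact i) = 1 + y + y\<^sup>2 / 2" by (simp add: eval_nat_numeral)
  ultimately have "\<bar>exp y - (1 + y + y\<^sup>2 / 2)\<bar> \<le> \<eta> * y\<^sup>2 / 2" by simp
  then show "exp y \<le> 1 + y + (1 + \<eta>) * y\<^sup>2 / 2" and "1 + y + (1 - \<eta>) * y\<^sup>2 / 2 \<le> exp y"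
    unfolding distrib_right left_diff_distrib add_divide_distrib diff_divide_distrib by linarith+
qed

context bounded_family
begin

section \<open>Exponential moments and tail bounds\<close>

definition total_var :: real where
  "total_var = (\<Sum>e\<in>I. expectation (\<lambda>\<omega>. (Z e \<omega>)\<^sup>2))"

definition total_sum :: "'a \<Rightarrow> real" where
  "total_sum \<omega> = (\<Sum>e\<in>I. Z e \<omega>)"

lemma measurable_total_sum [measurable]: "total_sum \<in> borel_measurable M"
  unfolding total_sum_def using measurable_Z by (rule borel_measurable_sum)

lemma integrable_exp: "e \<in> I \<Longrightarrow> integrable M (\<lambda>\<omega>. exp (l * Z e \<omega>))"
proof (rule integrable_bounded_fun[where f = "\<lambda>x. exp (l * x)" and c = "exp (\<bar>l\<bar> * a)"])
  fix x :: real assume "\<bar>x\<bar> \<le> a"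
  then have "\<bar>l * x\<bar> \<le> \<bar>l\<bar> * a" unfolding abs_mult by (intro mult_left_mono) auto
  then show "\<bar>exp (l * x)\<bar> \<le> exp (\<bar>l\<bar> * a)" by simp
qed auto

lemma exp_moment_bounds:
  assumes e: "e \<in> I" and l: "\<bar>l\<bar> * a \<le> \<eta> / 3" "\<eta> \<le> 1"
  defines "v \<equiv> expectation (\<lambda>\<omega>. (Z e \<omega>)\<^sup>2)"
  shows "expectation (\<lambda>\<omega>. exp (l * Z e \<omega>)) \<le> exp (l\<^sup>2 * v * (1 + \<eta>) / 2)"
    and "exp (l\<^sup>2 * v * (1 - 2 * \<eta>) / 2) \<le> expectation (\<lambda>\<omega>. exp (l * Z e \<omega>))"
proof -
  have \<eta>0: "\<eta> \<ge> 0" using l(1) bound_pos by (metis abs_ge_zero less_imp_le mult_nonneg_nonneg order_trans zero_le_divide_iff zero_le_numeral not_numeral_le_zero)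
  have y: "\<bar>l * Z e \<omega>\<bar> \<le> \<eta> / 3" if "\<omega> \<in> space M" for \<omega>
    using mult_left_mono[OF bounded[OF e that], of "\<bar>l\<bar>"] l by (simp add: abs_mult)
  have int2: "integrable M (\<lambda>\<omega>. (Z e \<omega>)\<^sup>2)" "integrable M (Z e)"
    using integrable_pow[OF e, of 2] integrable_pow[OF e, of 1] by simp_all
  have quad: "expectation (\<lambda>\<omega>. 1 + l * Z e \<omega> + c * (l * Z e \<omega>)\<^sup>2 / 2) = 1 + c * l\<^sup>2 * v / 2" for c
    using int2 by (simp add: power_mult_distrib v_def mean_zero[OF e] prob_space mult_ac)
  have intq: "integrable M (\<lambda>\<omega>. 1 + l * Z e \<omega> + c * (l * Z e \<omega>)\<^sup>2 / 2)" for c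
    using int2 by (simp add: power_mult_distrib)
  have "expectation (\<lambda>\<omega>. exp (l * Z e \<omega>)) \<le> expectation (\<lambda>\<omega>. 1 + l * Z e \<omega> + (1 + \<eta>) * (l * Z e \<omega>)\<^sup>2 / 2)"
    by (rule integral_mono[OF integrable_exp[OF e] intq]) (rule exp_quadratic_bounds[OF y l(2)])
  also have "\<dots> = 1 + l\<^sup>2 * v * (1 + \<eta>) / 2" unfolding quad by simp
  also have "\<dots> \<le> exp (l\<^sup>2 * v * (1 + \<eta>) / 2)" by (rule exp_ge_add_one_self)
  finally show "expectation (\<lambda>\<omega>. exp (l * Z e \<omega>)) \<le> exp (l\<^sup>2 * v * (1 + \<eta>) / 2)" .
  \<comment> \<open>The Taylor bound gives 1 + u, and ln (1 + u) is at least u - u^2. As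
    \<open>u \<le> \<eta>\<close>, the quadratic term costs at most a further
    \<open>\<eta> * u\<close>; hence \<open>1 - 2 * \<eta>\<close> in the lower bound against
    \<open>1 + \<eta>\<close> in the upper one.\<close>
  define u where "u = (1 - \<eta>) * l\<^sup>2 * v / 2"
  have v0: "0 \<le> v" by (simp add: v_def)
  have "v \<le> a\<^sup>2"
  proof -
    have "v \<le> expectation (\<lambda>\<omega>. a\<^sup>2)"
      unfolding v_def using int2 bounded[OF e] bound_pos
      by (intro integral_mono) (auto simp: abs_le_square_iff[symmetric])
    then show ?thesis by (simp add: prob_space)
  qed
  then have "l\<^sup>2 * v \<le> l\<^sup>2 * a\<^sup>2" by (intro mult_left_mono) auto
  also have "\<dots> = (\<bar>l\<bar> * a)\<^sup>2" by (simp add: power_mult_distrib)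
  also have "\<dots> \<le> (\<eta> / 3)\<^sup>2" using l bound_pos by (intro power_mono) auto
  also have "\<dots> \<le> \<eta>" using l \<eta>0 mult_left_le[of \<eta> \<eta>] by (simp add: power2_eq_square)
  finally have lv: "l\<^sup>2 * v \<le> \<eta>" .
  have u: "0 \<le> u" "u \<le> \<eta>"
  proof -
    show "0 \<le> u" using l v0 by (simp add: u_def)
    have "(1 - \<eta>) * (l\<^sup>2 * v) \<le> 1 * \<eta>" using lv l \<eta>0 v0 by (intro mult_mono) auto
    then show "u \<le> \<eta>" using \<eta>0 by (simp add: u_def mult.assoc)
  qed
  have "l\<^sup>2 * v * (1 - 2 * \<eta>) / 2 \<le> u - \<eta> * u"
  proof -
    have "u - \<eta> * u = (1 - 2 * \<eta> + \<eta>\<^sup>2) * (l\<^sup>2 * v) / 2"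
      by (simp add: u_def field_simps power2_eq_square)
    also have "\<dots> \<ge> (1 - 2 * \<eta>) * (l\<^sup>2 * v) / 2"
      using v0 by (intro divide_right_mono mult_right_mono) auto
    finally show ?thesis by (simp add: mult_ac)
  qed
  also have "\<dots> \<le> u - u\<^sup>2" using u by (simp add: power2_eq_square mult_right_mono)
  also have "\<dots> \<le> ln (1 + u)" using u l by (intro ln_one_plus_pos_lower_bound) auto
  finally have "exp (l\<^sup>2 * v * (1 - 2 * \<eta>) / 2) \<le> exp (ln (1 + u))" by simp
  also have "\<dots> = 1 + u" using u by simp
  also have "\<dots> = expectation (\<lambda>\<omega>. 1 + l * Z e \<omega> + (1 - \<eta>) * (l * Z e \<omega>)\<^sup>2 / 2)" unfolding quad u_def by simp
  also have "\<dots> \<le> expectation (\<lambda>\<omega>. exp (l * Z e \<omega>))"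
    by (rule integral_mono[OF intq integrable_exp[OF e]]) (rule exp_quadratic_bounds[OF y l(2)])
  finally show "exp (l\<^sup>2 * v * (1 - 2 * \<eta>) / 2) \<le> expectation (\<lambda>\<omega>. exp (l * Z e \<omega>))" .
qed

lemma exp_total_eq: "exp (l * total_sum \<omega>) = (\<Prod>e\<in>I. exp (l * Z e \<omega>))"
  by (simp add: total_sum_def sum_distrib_left exp_sum finite_index)

lemma integrable_exp_total: "integrable M (\<lambda>\<omega>. exp (l * total_sum \<omega>))"
  unfolding exp_total_eq by (rule expectation_prod_comp(2)[of I "\<lambda>_ x. exp (l * x)"]) (auto intro: integrable_exp)

lemma exp_total_bounds:
  assumes l: "\<bar>l\<bar> * a \<le> \<eta> / 3" "\<eta> \<le> 1"
  shows "expectation (\<lambda>\<omega>. exp (l * total_sum \<omega>)) \<le> exp (l\<^sup>2 * total_var * (1 + \<eta>) / 2)"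
    and "exp (l\<^sup>2 * total_var * (1 - 2 * \<eta>) / 2) \<le> expectation (\<lambda>\<omega>. exp (l * total_sum \<omega>))"
proof -
  have E: "expectation (\<lambda>\<omega>. exp (l * total_sum \<omega>)) = (\<Prod>e\<in>I. expectation (\<lambda>\<omega>. exp (l * Z e \<omega>)))"
    unfolding exp_total_eq
    by (rule expectation_prod_comp(1)[of I "\<lambda>_ x. exp (l * x)"]) (auto intro: integrable_exp)
  have P: "exp (l\<^sup>2 * total_var * c / 2) = (\<Prod>e\<in>I. exp (l\<^sup>2 * expectation (\<lambda>\<omega>. (Z e \<omega>)\<^sup>2) * c / 2))" for c
    by (simp add: total_var_def exp_sum[symmetric] finite_index sum_distrib_left sum_distrib_right sum_divide_distrib)
  show "expectation (\<lambda>\<omega>. exp (l * total_sum \<omega>)) \<le> exp (l\<^sup>2 * total_var * (1 + \<eta>) / 2)"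
    unfolding E P by (intro prod_mono conjI exp_moment_bounds l) auto
  show "exp (l\<^sup>2 * total_var * (1 - 2 * \<eta>) / 2) \<le> expectation (\<lambda>\<omega>. exp (l * total_sum \<omega>))"
    unfolding E P by (intro prod_mono conjI exp_moment_bounds l) auto
qed

lemma upper_tail:
  assumes V: "total_var \<le> V" "0 < V" and t: "0 < t" "t * a / V \<le> \<eta> / 3" "\<eta> \<le> 1"
  shows "prob {\<omega> \<in> space M. total_sum \<omega> \<ge> t} \<le> exp (- (t\<^sup>2 * (1 - \<eta>) / (2 * V)))"
proof -
  \<comment> \<open>The minimiser of the Gaussian exponent l^2 V / 2 - l t; at this point the
    correction \<open>1 + \<eta>\<close> turns into the factor \<open>1 - \<eta>\<close> of the
    result.\<close>
  define l where "l = t / V"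
  have l: "l > 0" "\<bar>l\<bar> * a \<le> \<eta> / 3" using V t by (auto simp: l_def)
  have \<eta>0: "\<eta> \<ge> 0" using t V bound_pos by (metis divide_nonneg_pos less_imp_le mult_nonneg_nonneg order_trans zero_le_divide_iff not_numeral_le_zero)
  have "{\<omega> \<in> space M. total_sum \<omega> \<ge> t} = {\<omega> \<in> space M. exp (l * total_sum \<omega>) \<ge> exp (l * t)}"
    using l by auto
  also have "prob \<dots> \<le> expectation (\<lambda>\<omega>. exp (l * total_sum \<omega>)) / exp (l * t)"
    by (rule integral_Markov_inequality_measure[OF integrable_exp_total sets.empty_sets]) auto
  also have "\<dots> \<le> exp (l\<^sup>2 * total_var * (1 + \<eta>) / 2) / exp (l * t)"
    by (intro divide_right_mono exp_total_bounds l t) auto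
  also have "\<dots> \<le> exp (l\<^sup>2 * V * (1 + \<eta>) / 2) / exp (l * t)"
    using V \<eta>0 by (intro divide_right_mono) (auto intro!: mult_right_mono mult_left_mono)
  also have "\<dots> = exp (- (t\<^sup>2 * (1 - \<eta>) / (2 * V)))"
    using V by (simp add: l_def exp_diff[symmetric] field_simps power2_eq_square)
  finally show ?thesis .
qed

text \<open>The exponentially tilted mass of \<open>S\<close> concentrates near \<open>l V\<close>: the contributions of
  \<open>S > (1 + \<delta>) l V\<close> and \<open>S < (1 - \<delta>) l V\<close> to the exponential moment at \<open>l\<close> are bounded
  by the exponential moments at \<open>(1 \<plusminus> \<delta>) l\<close>, which are of smaller exponential order.\<close>

lemma lower_tail:
  assumes \<delta>: "0 < \<delta>" "\<delta> \<le> 1" and l: "0 < l" "2 * l * a \<le> \<delta>\<^sup>2 / 36" and V: "6 / \<delta>\<^sup>2 \<le> l\<^sup>2 * total_var"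
  shows "exp (- (l\<^sup>2 * total_var * (1 + 3 * \<delta>) / 2)) / 2 \<le> prob {\<omega> \<in> space M. total_sum \<omega> \<ge> (1 - \<delta>) * l * total_var}"
proof -
  \<comment> \<open>Relative to L / 2, the tilted tails gain \<open>\<delta>\<^sup>2\<close> in the
    exponent, while the approximations cost \<open>4 * \<eta>\<close> in the tails and
    \<open>2 * \<eta>\<close> in the lower bound for \<open>E0\<close>. Half of the gain survives;
    with \<open>6 / \<delta>\<^sup>2 \<le> L\<close> it amounts to at least 3/2, enough for the
    factor 1/4.\<close>
  define \<eta> where "\<eta> = \<delta>\<^sup>2 / 12"
  have \<eta>: "0 < \<eta>" "\<eta> \<le> 1" using \<delta> power_le_one[of \<delta> 2] by (auto simp: \<eta>_def)
  let ?V = total_var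
  define L where "L = l\<^sup>2 * ?V"
  have la: "\<bar>s * l\<bar> * a \<le> \<eta> / 3" if "0 \<le> s" "s \<le> 2" for s
  proof -
    have "\<bar>s * l\<bar> * a = s * (l * a)" using that l by simp
    also have "\<dots> \<le> 2 * (l * a)" using that l bound_pos by (intro mult_right_mono) auto
    finally show ?thesis using l by (simp add: \<eta>_def)
  qed
  have L: "6 / \<delta>\<^sup>2 \<le> L" using V by (simp add: L_def)
  have L0: "0 < L" by (rule less_le_trans[OF _ L]) (use \<delta> in auto)
  define E0 where "E0 = expectation (\<lambda>\<omega>. exp (l * total_sum \<omega>))"
  have E0: "exp (L * (1 - 2 * \<eta>) / 2) \<le> E0"
    unfolding E0_def L_def using exp_total_bounds(2)[OF la[of 1]] \<eta> by simp
  have quarter: "exp (L / 2 * (1 - \<delta>\<^sup>2 + 4 * \<eta>)) \<le> E0 / 4"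
  proof -
    have "6 \<le> \<delta>\<^sup>2 * L" using L \<delta> by (simp add: field_simps)
    then have "L / 2 * (1 - \<delta>\<^sup>2 + 4 * \<eta>) \<le> L * (1 - 2 * \<eta>) / 2 - 3 / 2"
      by (simp add: \<eta>_def algebra_simps)
    then have "exp (L / 2 * (1 - \<delta>\<^sup>2 + 4 * \<eta>)) \<le> exp (L * (1 - 2 * \<eta>) / 2 - 3 / 2)" by simp
    also have "\<dots> = exp (L * (1 - 2 * \<eta>) / 2) * exp (- (3 / 2))" by (simp add: exp_add[symmetric])
    also have "\<dots> \<le> E0 * (1 / 4)"
    proof (rule mult_mono[OF E0])
      \<comment> \<open>The quadratic Taylor polynomial at 3/2 is only 3.625, so exp (3/2) is
        bounded through the square of exp (3/4).\<close>
      have "(4::real) \<le> (1 + 3/4 + (3/4)\<^sup>2 / 2)\<^sup>2" by (simp add: power2_eq_square)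
      also have "\<dots> \<le> (exp (3/4))\<^sup>2"
        by (intro power_mono exp_lower_Taylor_quadratic) auto
      also have "\<dots> = exp (3/2)" by (simp add: exp_double[symmetric])
      finally show "exp (- (3 / 2)) \<le> (1 / 4 :: real)" by (simp add: exp_minus field_simps)
    qed (auto simp: E0_def)
    finally show ?thesis by simp
  qed
  \<comment> \<open>Both tails at once, with s = \<delta> or s = - \<delta>: on \<open>A\<close> the
    factor exp (s l (S - (1 + s) l V)) is at least 1, and inserting it moves the tilting parameter
    from l to (1 + s) l.\<close>
  have tilt: "expectation (\<lambda>\<omega>. exp (l * total_sum \<omega>) * indicator A \<omega>) \<le> E0 / 4"
    if A: "A \<in> events" and s: "\<bar>s\<bar> = \<delta>"
      and le: "\<And>\<omega>. \<omega> \<in> A \<Longrightarrow> 0 \<le> s * l * (total_sum \<omega> - (1 + s) * l * ?V)" for A s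
  proof -
    have s1: "0 \<le> 1 + s" "1 + s \<le> 2" using s \<delta> by (auto simp: abs_if split: if_splits)
    have "expectation (\<lambda>\<omega>. exp (l * total_sum \<omega>) * indicator A \<omega>)
        \<le> expectation (\<lambda>\<omega>. exp (- (s * l * ((1 + s) * l * ?V))) * exp ((1 + s) * l * total_sum \<omega>))"
    proof (rule integral_mono)
      show "integrable M (\<lambda>\<omega>. exp (l * total_sum \<omega>) * indicator A \<omega>)"
        using A by (intro integrable_real_mult_indicator integrable_exp_total)
      show "integrable M (\<lambda>\<omega>. exp (- (s * l * ((1 + s) * l * ?V))) * exp ((1 + s) * l * total_sum \<omega>))"
        by (intro integrable_mult_right integrable_exp_total)
      fix \<omega>
      show "exp (l * total_sum \<omega>) * indicator A \<omega> \<le> exp (- (s * l * ((1 + s) * l * ?V))) * exp ((1 + s) * l * total_sum \<omega>)"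
      proof (cases "\<omega> \<in> A")
        case True
        have "l * total_sum \<omega> \<le> - (s * l * ((1 + s) * l * ?V)) + (1 + s) * l * total_sum \<omega>"
          using le[OF True] by (simp add: algebra_simps)
        then show ?thesis using True by (simp add: exp_add[symmetric])
      qed simp
    qed
    also have "\<dots> = exp (- (s * l * ((1 + s) * l * ?V))) * expectation (\<lambda>\<omega>. exp ((1 + s) * l * total_sum \<omega>))"
      by simp
    also have "\<dots> \<le> exp (- (s * l * ((1 + s) * l * ?V))) * exp (((1 + s) * l)\<^sup>2 * ?V * (1 + \<eta>) / 2)"
      by (intro mult_left_mono exp_total_bounds la s1 \<eta>) auto
    also have "\<dots> = exp (L / 2 * (1 - s\<^sup>2 + \<eta> * (1 + s)\<^sup>2))"
      by (simp add: exp_add[symmetric] L_def power2_eq_square field_simps)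
    also have "\<dots> \<le> exp (L / 2 * (1 - \<delta>\<^sup>2 + 4 * \<eta>))"
    proof -
      have "s\<^sup>2 = \<delta>\<^sup>2" using s by (metis power2_abs)
      moreover have "\<eta> * (1 + s)\<^sup>2 \<le> \<eta> * 2\<^sup>2"
        using s1 \<eta> by (intro mult_left_mono power_mono) auto
      ultimately show ?thesis using L0 by simp
    qed
    also have "\<dots> \<le> E0 / 4" by (rule quarter)
    finally show ?thesis .
  qed
  define A B C where "A = {\<omega> \<in> space M. total_sum \<omega> > (1 + \<delta>) * l * ?V}"
    and "B = {\<omega> \<in> space M. total_sum \<omega> < (1 - \<delta>) * l * ?V}"
    and "C = {\<omega> \<in> space M. total_sum \<omega> \<ge> (1 - \<delta>) * l * ?V}"
  have ev: "A \<in> events" "B \<in> events" "C \<in> events" unfolding A_def B_def C_def by measurable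
  let ?X = "\<lambda>\<omega>. exp (l * total_sum \<omega>)"
  have EA: "expectation (\<lambda>\<omega>. ?X \<omega> * indicator A \<omega>) \<le> E0 / 4"
    by (rule tilt[OF ev(1), of \<delta>]) (use \<delta> l in \<open>auto simp: A_def\<close>)
  have EB: "expectation (\<lambda>\<omega>. ?X \<omega> * indicator B \<omega>) \<le> E0 / 4"
    by (rule tilt[OF ev(2), of "- \<delta>"]) (use \<delta> l in \<open>auto simp: B_def mult_nonneg_nonpos\<close>)
  have ints: "integrable M (\<lambda>\<omega>. ?X \<omega> * indicator A \<omega>)" "integrable M (\<lambda>\<omega>. ?X \<omega> * indicator B \<omega>)"
    by (rule integrable_real_mult_indicator[OF ev(1) integrable_exp_total])
      (rule integrable_real_mult_indicator[OF ev(2) integrable_exp_total])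
  \<comment> \<open>The largest value of exp (l S) away from both tails. At least half of
    \<open>E0\<close> comes from there, so dividing by \<open>c\<close> removes the tilt and leaves
    a plain probability.\<close>
  define c where "c = exp ((1 + \<delta>) * L)"
  have "E0 \<le> expectation (\<lambda>\<omega>. ?X \<omega> * indicator A \<omega> + ?X \<omega> * indicator B \<omega> + c * indicator C \<omega>)"
    unfolding E0_def
  proof (rule integral_mono[OF integrable_exp_total])
    show "integrable M (\<lambda>\<omega>. ?X \<omega> * indicator A \<omega> + ?X \<omega> * indicator B \<omega> + c * indicator C \<omega>)"
      using ints ev by (intro Bochner_Integration.integrable_add integrable_mult_right) (auto simp: integrable_indicator_iff emeasure_eq_measure)
    fix \<omega> assume \<omega>: "\<omega> \<in> space M"
    show "?X \<omega> \<le> ?X \<omega> * indicator A \<omega> + ?X \<omega> * indicator B \<omega> + c * indicator C \<omega>"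
    proof (cases "\<omega> \<in> A \<or> \<omega> \<in> B")
      case True
      then show ?thesis by (auto simp: c_def indicator_def)
    next
      case False
      then have "total_sum \<omega> \<le> (1 + \<delta>) * l * ?V" "\<omega> \<in> C" using \<omega> by (auto simp: A_def B_def C_def)
      then have "l * total_sum \<omega> \<le> l * ((1 + \<delta>) * l * ?V)" using l by (intro mult_left_mono) auto
      then have "?X \<omega> \<le> c" by (simp add: c_def L_def power2_eq_square mult_ac)
      with False \<open>\<omega> \<in> C\<close> show ?thesis by simp
    qed
  qed
  also have "\<dots> = expectation (\<lambda>\<omega>. ?X \<omega> * indicator A \<omega>) + expectation (\<lambda>\<omega>. ?X \<omega> * indicator B \<omega>) + c * prob C"
    using ints ev by (simp add: integrable_indicator_iff emeasure_eq_measure)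
  also have "\<dots> \<le> E0 / 4 + E0 / 4 + c * prob C" by (intro add_mono EA EB) simp
  finally have "E0 / 2 \<le> c * prob C" by simp
  with E0 have "exp (L * (1 - 2 * \<eta>) / 2) / 2 \<le> c * prob C" by linarith
  then have "exp (L * (1 - 2 * \<eta>) / 2) / c / 2 \<le> prob C" by (simp add: c_def field_simps)
  moreover
  have "exp (- (L * (1 + 3 * \<delta>) / 2)) \<le> exp (L * (1 - 2 * \<eta>) / 2) / c"
  proof -
    have "2 * \<eta> \<le> \<delta>" using \<delta> mult_left_le[of \<delta> \<delta>] by (simp add: \<eta>_def power2_eq_square)
    then have "L * (1 + 2 * \<delta> + 2 * \<eta>) \<le> L * (1 + 3 * \<delta>)" using L0 by simp
    then have "- (L * (1 + 3 * \<delta>) / 2) \<le> L * (1 - 2 * \<eta>) / 2 - (1 + \<delta>) * L"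
      by (simp add: algebra_simps)
    then show ?thesis by (simp add: c_def exp_diff[symmetric])
  qed
  then have "exp (- (L * (1 + 3 * \<delta>) / 2)) / 2 \<le> exp (L * (1 - 2 * \<eta>) / 2) / c / 2"
    by (rule divide_right_mono) simp
  ultimately have "exp (- (L * (1 + 3 * \<delta>) / 2)) / 2 \<le> prob C" by (rule order_trans[rotated])
  then show ?thesis unfolding L_def C_def .
qed

end

context bounded_family
begin

lemma two_sided_tail:
  assumes V: "total_var \<le> V" "0 < V" and t: "0 < t" "t * a / V \<le> \<eta> / 3" "\<eta> \<le> 1"
  shows "prob {\<omega> \<in> space M. \<bar>total_sum \<omega>\<bar> \<ge> t} \<le> 2 * exp (- (t\<^sup>2 * (1 - \<eta>) / (2 * V)))"
proof -
  interpret neg: bounded_family M I "\<lambda>e \<omega>. - Z e \<omega>" a by (rule bounded_family_uminus)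
  have neg: "neg.total_sum \<omega> = - total_sum \<omega>" "neg.total_var = total_var" for \<omega>
    by (simp_all add: neg.total_sum_def total_sum_def neg.total_var_def total_var_def sum_negf)
  have "{\<omega> \<in> space M. \<bar>total_sum \<omega>\<bar> \<ge> t}
      = {\<omega> \<in> space M. total_sum \<omega> \<ge> t} \<union> {\<omega> \<in> space M. neg.total_sum \<omega> \<ge> t}"
    unfolding neg by auto
  also have "prob \<dots> \<le> prob {\<omega> \<in> space M. total_sum \<omega> \<ge> t} + prob {\<omega> \<in> space M. neg.total_sum \<omega> \<ge> t}"
    by (rule measure_Un_le) measurable
  also have "\<dots> \<le> exp (- (t\<^sup>2 * (1 - \<eta>) / (2 * V))) + exp (- (t\<^sup>2 * (1 - \<eta>) / (2 * V)))"
    using neg(2) V by (intro add_mono upper_tail neg.upper_tail t) auto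
  finally show ?thesis by simp
qed

text \<open>The tilted bound at a prescribed threshold: \<open>l\<close> solves (1 - \<delta>) l V =
  t. Row variances are known only approximately, so the conditions and the exponent are stated with
  uniform bounds \<open>V0\<close> and \<open>V1\<close>; \<open>\<delta> \<le> 1 / 2\<close> gives
  \<open>l \<le> 2 * t / V0\<close> and hence the factor 4.\<close>

lemma lower_tail_at:
  assumes \<delta>: "0 < \<delta>" "\<delta> \<le> 1 / 2" and V: "0 < V0" "V0 \<le> total_var" "total_var \<le> V1"
    and t: "0 < t" "4 * t * a / V0 \<le> \<delta>\<^sup>2 / 36" "6 / \<delta>\<^sup>2 \<le> t\<^sup>2 / V1"
  shows "exp (- (t\<^sup>2 * (1 + 3 * \<delta>) / (2 * (1 - \<delta>)\<^sup>2 * V0))) / 2 \<le> prob {\<omega> \<in> space M. total_sum \<omega> \<ge> t}"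
proof -
  define l where "l = t / ((1 - \<delta>) * total_var)"
  have V': "0 < total_var" using V by simp
  have l0: "0 < l" using V' t \<delta> by (simp add: l_def)
  have lt: "(1 - \<delta>) * l * total_var = t" using V' \<delta> by (simp add: l_def)
  have l2: "l\<^sup>2 * total_var = t\<^sup>2 / ((1 - \<delta>)\<^sup>2 * total_var)"
    using V' by (simp add: l_def power_divide power_mult_distrib power2_eq_square)
  have la: "2 * l * a \<le> \<delta>\<^sup>2 / 36"
  proof -
    have "1 / 2 * V0 \<le> (1 - \<delta>) * total_var" using V \<delta> by (intro mult_mono) auto
    then have "l \<le> t / (1 / 2 * V0)" unfolding l_def using t V by (intro divide_left_mono mult_pos_pos) (use V' \<delta> in auto)
    then have "2 * l * a \<le> 2 * (t / (1 / 2 * V0)) * a" using bound_pos by (intro mult_right_mono) auto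
    also have "\<dots> = 4 * t * a / V0" by simp
    finally show ?thesis using t(2) by simp
  qed
  have lV: "6 / \<delta>\<^sup>2 \<le> l\<^sup>2 * total_var"
  proof -
    have "(1 - \<delta>)\<^sup>2 * total_var \<le> 1 * V1" using V \<delta> V' by (intro mult_mono) (auto intro: power_le_one)
    then have "t\<^sup>2 / V1 \<le> l\<^sup>2 * total_var"
      unfolding l2 using V' V \<delta> by (intro divide_left_mono mult_pos_pos) auto
    with t(3) show ?thesis by simp
  qed
  have "exp (- (l\<^sup>2 * total_var * (1 + 3 * \<delta>) / 2)) / 2 \<le> prob {\<omega> \<in> space M. total_sum \<omega> \<ge> t}"
    using lower_tail[OF \<delta>(1) _ l0 la lV] \<delta> unfolding lt by simp
  moreover have "l\<^sup>2 * total_var * (1 + 3 * \<delta>) / 2 \<le> t\<^sup>2 * (1 + 3 * \<delta>) / (2 * (1 - \<delta>)\<^sup>2 * V0)"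
  proof -
    have "t\<^sup>2 / ((1 - \<delta>)\<^sup>2 * total_var) \<le> t\<^sup>2 / ((1 - \<delta>)\<^sup>2 * V0)"
      using V V' \<delta> by (intro divide_left_mono mult_left_mono mult_pos_pos) auto
    then have "l\<^sup>2 * total_var * ((1 + 3 * \<delta>) / 2) \<le> t\<^sup>2 / ((1 - \<delta>)\<^sup>2 * V0) * ((1 + 3 * \<delta>) / 2)"
      unfolding l2 using \<delta> by (intro mult_right_mono) auto
    then show ?thesis by (simp add: mult_ac)
  qed
  ultimately show ?thesis by (smt (verit) divide_right_mono exp_le_cancel_iff)
qed

end

section \<open>Row sums of random symmetric matrices\<close>

lemma inj_on_uedge: "inj_on (uedge i) S"
  by (rule inj_onI) (auto simp: min_def max_def split: if_splits)

context bounded_array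
begin

lemma uedge_image_subset: "i \<in> {1..N} \<Longrightarrow> S \<subseteq> {1..N} \<Longrightarrow> uedge i ` S \<subseteq> upairs N"
  using uedge_in_upairs by blast

definition part_row :: "nat set \<Rightarrow> nat \<Rightarrow> 'a \<Rightarrow> real" where
  "part_row S i \<omega> = (\<Sum>k\<in>S. Z (uedge i k) \<omega>)"

definition part_var :: "nat set \<Rightarrow> nat \<Rightarrow> real" where
  "part_var S i = (\<Sum>k\<in>S. expectation (\<lambda>\<omega>. (Z (uedge i k) \<omega>)\<^sup>2))"

lemma part_row_eq:
  assumes "i \<in> {1..N}" "S \<subseteq> {1..N}"
  shows "bounded_family.total_sum (uedge i ` S) Z = part_row S i"
    and "bounded_family.total_var M (uedge i ` S) Z = part_var S i"
proof -
  interpret J: bounded_family M "uedge i ` S" Z a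
    using assms by (intro bounded_family_subset uedge_image_subset)
  show "J.total_sum = part_row S i" "J.total_var = part_var S i"
    by (auto simp: J.total_sum_def J.total_var_def part_row_def part_var_def sum.reindex[OF inj_on_uedge])
qed

lemma part_rows_bounded:
  assumes R: "R \<subseteq> {1..N}" and S: "S \<subseteq> {1..N}"
    and V: "\<And>i. i \<in> R \<Longrightarrow> part_var S i \<le> V" "0 < V"
    and t: "0 < t" "t * a / V \<le> \<eta> / 3" "\<eta> \<le> 1"
  shows "\<exists>E\<in>events. prob E \<le> real (card R) * (2 * exp (- (t\<^sup>2 * (1 - \<eta>) / (2 * V)))) \<and>
    (\<forall>\<omega>\<in>space M - E. \<forall>i\<in>R. \<bar>part_row S i \<omega>\<bar> < t)"
proof -
  let ?F = "\<lambda>i. {\<omega> \<in> space M. \<bar>part_row S i \<omega>\<bar> \<ge> t}"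
  have finR: "finite R" using R finite_subset by blast
  have F: "?F i \<in> events \<and> prob (?F i) \<le> 2 * exp (- (t\<^sup>2 * (1 - \<eta>) / (2 * V)))" if i: "i \<in> R" for i
  proof -
    have i': "i \<in> {1..N}" using i R by blast
    interpret J: bounded_family M "uedge i ` S" Z a
      using i' S by (intro bounded_family_subset uedge_image_subset)
    note eq = part_row_eq[OF i' S]
    have "?F i \<in> events" unfolding eq(1)[symmetric] by measurable
    moreover have "prob (?F i) \<le> 2 * exp (- (t\<^sup>2 * (1 - \<eta>) / (2 * V)))"
      unfolding eq(1)[symmetric] by (rule J.two_sided_tail) (use V(1)[OF i] V(2) t eq(2) in auto)
    ultimately show ?thesis ..
  qed
  have "prob (\<Union>i\<in>R. ?F i) \<le> (\<Sum>i\<in>R. prob (?F i))"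
    using finR F by (intro finite_measure_subadditive_finite) auto
  also have "\<dots> \<le> (\<Sum>i\<in>R. 2 * exp (- (t\<^sup>2 * (1 - \<eta>) / (2 * V))))"
    by (rule sum_mono) (use F in blast)
  finally have "prob (\<Union>i\<in>R. ?F i) \<le> real (card R) * (2 * exp (- (t\<^sup>2 * (1 - \<eta>) / (2 * V))))" by simp
  moreover have "(\<Union>i\<in>R. ?F i) \<in> events" using finR F by (intro sets.finite_UN) auto
  moreover have "\<forall>\<omega>\<in>space M - (\<Union>i\<in>R. ?F i). \<forall>i\<in>R. \<bar>part_row S i \<omega>\<bar> < t" by (auto simp: not_le)
  ultimately show ?thesis by blast
qed

text \<open>The truncated rows \<open>{m<..N}\<close> of the first \<open>m\<close> vertices use pairwise distinct edges.\<close>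

lemma indep_part_rows:
  assumes "m \<le> N"
  shows "indep_vars (\<lambda>_. borel) (part_row {m<..N}) {1..m}"
proof -
  let ?K = "\<lambda>i. uedge i ` {m<..N}"
  have K: "?K i \<subseteq> upairs N" if "i \<in> {1..m}" for i
    using that assms by (intro uedge_image_subset) auto
  have "indep_vars (\<lambda>i. PiM (?K i) (\<lambda>_. borel)) (\<lambda>i \<omega>. restrict (\<lambda>e. Z e \<omega>) (?K i)) {1..m}"
    by (rule indep_vars_restrict[OF indep K]) (auto simp: disjoint_family_on_def min_def max_def split: if_splits)
  then have "indep_vars (\<lambda>_. borel) (\<lambda>i \<omega>. \<Sum>e\<in>?K i. restrict (\<lambda>e. Z e \<omega>) (?K i) e) {1..m}"
    by (rule indep_vars_compose2) measurable
  also have "indep_vars (\<lambda>_. borel) (\<lambda>i \<omega>. \<Sum>e\<in>?K i. restrict (\<lambda>e. Z e \<omega>) (?K i) e) {1..m}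
      \<longleftrightarrow> indep_vars (\<lambda>_. borel) (part_row {m<..N}) {1..m}"
  proof (rule indep_vars_cong)
    fix i
    have "(\<Sum>e\<in>?K i. restrict (\<lambda>e. Z e \<omega>) (?K i) e) = part_row {m<..N} i \<omega>" for \<omega>
      unfolding part_row_def by (subst sum.reindex[OF inj_on_uedge]) (auto intro!: sum.cong)
    then show "(\<lambda>\<omega>. \<Sum>e\<in>?K i. restrict (\<lambda>e. Z e \<omega>) (?K i) e) = part_row {m<..N} i" by blast
  qed auto
  finally show ?thesis .
qed

text \<open>By independence, the probability that all these rows stay below \<open>s\<close> is a
  product of factors, each at most 1 - q \<le> exp (- q).\<close>

lemma some_part_row_large:
  assumes m: "1 \<le> m" "m \<le> N" and q: "\<And>i. i \<in> {1..m} \<Longrightarrow> q \<le> prob {\<omega> \<in> space M. part_row {m<..N} i \<omega> \<ge> s}"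
  shows "\<exists>E\<in>events. prob E \<le> exp (- (real m * q)) \<and>
    (\<forall>\<omega>\<in>space M - E. \<exists>i\<in>{1..m}. s \<le> part_row {m<..N} i \<omega>)"
proof -
  let ?T = "part_row {m<..N}"
  note ind = indep_part_rows[OF m(2)]
  have meas: "?T i \<in> borel_measurable M" if "i \<in> {1..m}" for i
    using ind that by (auto simp: indep_vars_def)
  let ?E = "\<Inter>i\<in>{1..m}. ?T i -` {..<s} \<inter> space M"
  have ev: "?T i -` {..<s} \<inter> space M \<in> events" if "i \<in> {1..m}" for i
    using measurable_sets[OF meas[OF that], of "{..<s}"] by simp
  have small: "prob (?T i -` {..<s} \<inter> space M) \<le> exp (- q)" if i: "i \<in> {1..m}" for i
  proof -
    have "?T i -` {..<s} \<inter> space M = space M - {\<omega> \<in> space M. ?T i \<omega> \<ge> s}" by auto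
    also have "prob \<dots> = 1 - prob {\<omega> \<in> space M. ?T i \<omega> \<ge> s}"
      using meas[OF i] by (intro prob_compl) measurable
    also have "\<dots> \<le> 1 + (- q)" using q[OF i] by simp
    also have "\<dots> \<le> exp (- q)" by (rule exp_ge_add_one_self)
    finally show ?thesis .
  qed
  have "prob ?E = (\<Prod>i\<in>{1..m}. prob (?T i -` {..<s} \<inter> space M))"
    by (rule indep_varsD_finite[OF ind]) (use m in auto)
  also have "\<dots> \<le> (\<Prod>i\<in>{1..m}. exp (- q))" by (intro prod_mono conjI small) auto
  also have "\<dots> = exp (- (real m * q))" by (simp add: exp_of_nat_mult[symmetric])
  finally have "prob ?E \<le> exp (- (real m * q))" .
  moreover have "?E \<in> events" using m ev by (intro sets.finite_INT) auto
  moreover have "\<forall>\<omega>\<in>space M - ?E. \<exists>i\<in>{1..m}. s \<le> ?T i \<omega>" by (auto simp: not_less)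
  ultimately show ?thesis by blast
qed

end

section \<open>Truncation\<close>

context prob_space
begin

text \<open>On the tail, |y|^j = |y|^p * |y|^(j - p), and the last factor is at most B^(j - p) as j
  \<le> p. The cases j = 0, 1, 2 control the probability of large entries, the mean lost by
  truncation, and the variance.\<close>

lemma tail_moment_le:
  fixes x :: "'a \<Rightarrow> real" and p K B :: real and j :: nat
  assumes [measurable]: "x \<in> borel_measurable M" and p: "real j \<le> p" "0 < p" and B: "0 < B" and K: "0 \<le> K"
    and mom: "(\<integral>\<^sup>+\<omega>. ennreal (\<bar>x \<omega>\<bar> powr p) \<partial>M) \<le> ennreal K"
  shows "integrable M (\<lambda>\<omega>. \<bar>x \<omega>\<bar> ^ j * indicator {y. \<bar>y\<bar> > B} (x \<omega>))" (is ?int)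
    and "expectation (\<lambda>\<omega>. \<bar>x \<omega>\<bar> ^ j * indicator {y. \<bar>y\<bar> > B} (x \<omega>)) \<le> K * B powr (real j - p)" (is ?le)
proof -
  have int: "integrable M (\<lambda>\<omega>. \<bar>x \<omega>\<bar> powr p)"
    using mom by (intro integrableI_nonneg) (auto simp: ennreal_less_top intro: le_less_trans)
  have "ennreal (expectation (\<lambda>\<omega>. \<bar>x \<omega>\<bar> powr p)) = (\<integral>\<^sup>+\<omega>. ennreal (\<bar>x \<omega>\<bar> powr p) \<partial>M)"
    by (rule nn_integral_eq_integral[symmetric, OF int]) simp
  with mom have E: "expectation (\<lambda>\<omega>. \<bar>x \<omega>\<bar> powr p) \<le> K" using K by (metis ennreal_le_iff)
  have pt: "\<bar>y\<bar> ^ j * indicator {y. \<bar>y\<bar> > B} y \<le> \<bar>y\<bar> powr p * B powr (real j - p)" for y :: real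
  proof (cases "\<bar>y\<bar> > B")
    case True
    have "\<bar>y\<bar> ^ j = \<bar>y\<bar> powr p * \<bar>y\<bar> powr (real j - p)"
      using True B by (simp add: powr_add[symmetric] powr_realpow[symmetric])
    also have "\<dots> \<le> \<bar>y\<bar> powr p * B powr (real j - p)"
      using True B p by (intro mult_left_mono powr_mono2') auto
    finally show ?thesis using True by simp
  qed simp
  show ?int
    by (rule Bochner_Integration.integrable_bound[OF integrable_mult_left[OF int, of "B powr (real j - p)"]])
      (use pt in \<open>auto simp: abs_mult\<close>)
  then have "expectation (\<lambda>\<omega>. \<bar>x \<omega>\<bar> ^ j * indicator {y. \<bar>y\<bar> > B} (x \<omega>))
      \<le> expectation (\<lambda>\<omega>. \<bar>x \<omega>\<bar> powr p * B powr (real j - p))"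
    by (rule integral_mono) (use int pt in auto)
  also have "\<dots> = expectation (\<lambda>\<omega>. \<bar>x \<omega>\<bar> powr p) * B powr (real j - p)" by simp
  also have "\<dots> \<le> K * B powr (real j - p)" using E by (intro mult_right_mono) auto
  finally show ?le .
qed

definition center :: "('a \<Rightarrow> real) \<Rightarrow> 'a \<Rightarrow> real" where
  "center x = (\<lambda>\<omega>. x \<omega> - expectation x)"

lemma center_bounded_family:
  assumes I: "finite I" and ind: "indep_vars (\<lambda>_. borel) X I" and f: "f \<in> borel_measurable borel"
    and le: "\<And>y. \<bar>f y\<bar> \<le> c" and c: "0 < c"
  shows "bounded_family M I (\<lambda>e. center (\<lambda>\<omega>. f (X e \<omega>))) (2 * c)"
proof unfold_locales
  show "indep_vars (\<lambda>_. borel) (\<lambda>e. center (\<lambda>\<omega>. f (X e \<omega>))) I"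
    unfolding center_def using f
    by (intro indep_vars_compose2[OF ind, of "\<lambda>e y. f y - expectation (\<lambda>\<omega>. f (X e \<omega>))" "\<lambda>_. borel"]) auto
  fix e assume e: "e \<in> I"
  have meas: "(\<lambda>\<omega>. f (X e \<omega>)) \<in> borel_measurable M"
    using ind e f by (auto simp: indep_vars_def intro: measurable_compose)
  have int: "integrable M (\<lambda>\<omega>. f (X e \<omega>))"
    by (rule integrable_const_bound[of _ c]) (use le meas in auto)
  show "expectation (center (\<lambda>\<omega>. f (X e \<omega>))) = 0"
    using int by (simp add: center_def prob_space)
  have "\<bar>expectation (\<lambda>\<omega>. f (X e \<omega>))\<bar> \<le> expectation (\<lambda>\<omega>. c)"
    by (rule order_trans[OF integral_abs_bound integral_mono[OF integrable_abs[OF int] integrable_const le]])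
  then have E: "\<bar>expectation (\<lambda>\<omega>. f (X e \<omega>))\<bar> \<le> c" by (simp add: prob_space)
  fix \<omega>
  show "\<bar>center (\<lambda>\<omega>. f (X e \<omega>)) \<omega>\<bar> \<le> 2 * c"
    unfolding center_def using le[of "X e \<omega>"] E by linarith
qed (use I c in auto)

lemma expectation_center_square:
  assumes "x \<in> borel_measurable M" "integrable M (\<lambda>\<omega>. (x \<omega>)\<^sup>2)"
  shows "expectation (\<lambda>\<omega>. (center x \<omega>)\<^sup>2) = expectation (\<lambda>\<omega>. (x \<omega>)\<^sup>2) - (expectation x)\<^sup>2"
proof -
  have "integrable M x" using square_integrable_imp_integrable[OF assms] .
  then show ?thesis unfolding center_def by (rule variance_eq) (rule assms(2))
qed

end

text \<open>One function for all truncations: with \<open>b = - 1\<close> the lower condition is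
  vacuous. The interval is open below and closed above, so adjacent bands are disjoint and
  \<open>clip_add\<close> is exact.\<close>

definition clip :: "real \<Rightarrow> real \<Rightarrow> real \<Rightarrow> real" where
  "clip b c y = (if b < \<bar>y\<bar> \<and> \<bar>y\<bar> \<le> c then y else 0)"

lemma measurable_clip [measurable]: "clip b c \<in> borel_measurable borel"
  unfolding clip_def by measurable

lemma abs_clip_le: "0 \<le> c \<Longrightarrow> \<bar>clip b c y\<bar> \<le> c"
  by (simp add: clip_def)

lemma clip_add: "- 1 \<le> b \<Longrightarrow> b \<le> c \<Longrightarrow> clip (- 1) b y + clip b c y = clip (- 1) c y"
  by (auto simp: clip_def)

lemma clip_square_le: "(clip b c y)\<^sup>2 \<le> y\<^sup>2"
  by (simp add: clip_def)

locale centred_array = prob_space M for M :: "'a measure" +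
  fixes N :: nat and X :: "nat \<times> nat \<Rightarrow> 'a \<Rightarrow> real" and p K :: real
  assumes indepX: "indep_vars (\<lambda>_. borel) X (upairs N)"
    and meanX: "\<And>e. e \<in> upairs N \<Longrightarrow> expectation (X e) = 0"
    and momentX: "\<And>e. e \<in> upairs N \<Longrightarrow> (\<integral>\<^sup>+\<omega>. ennreal (\<bar>X e \<omega>\<bar> powr p) \<partial>M) \<le> ennreal K"
    and p_ge: "6 \<le> p" and K_nonneg: "0 \<le> K"
begin

lemma measurableX: "e \<in> upairs N \<Longrightarrow> X e \<in> borel_measurable M"
  using indepX by (auto simp: indep_vars_def)

lemmas tailX = tail_moment_le[OF measurableX _ _ _ K_nonneg momentX]

lemma
  assumes e: "e \<in> upairs N" and c: "0 < c" and j: "j \<le> 2"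
  shows integrable_tailX: "integrable M (\<lambda>\<omega>. \<bar>X e \<omega>\<bar> ^ j * indicator {y. \<bar>y\<bar> > c} (X e \<omega>))"
    and tailX_le: "expectation (\<lambda>\<omega>. \<bar>X e \<omega>\<bar> ^ j * indicator {y. \<bar>y\<bar> > c} (X e \<omega>)) \<le> K * c powr (real j - p)"
  by (rule tailX[OF e _ _ c e]; use j p_ge in simp)+

lemma integrable_clipX:
  assumes "e \<in> upairs N" "0 \<le> c"
  shows "integrable M (\<lambda>\<omega>. clip b c (X e \<omega>))" and "integrable M (\<lambda>\<omega>. (clip b c (X e \<omega>))\<^sup>2)"
proof -
  note [measurable] = measurableX[OF assms(1)]
  show "integrable M (\<lambda>\<omega>. clip b c (X e \<omega>))"
    by (rule integrable_const_bound[of _ c]) (use abs_clip_le[OF assms(2)] in auto)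
  show "integrable M (\<lambda>\<omega>. (clip b c (X e \<omega>))\<^sup>2)"
    by (rule integrable_const_bound[of _ "c\<^sup>2"])
      (use abs_clip_le[OF assms(2)] assms(2) in \<open>auto simp: abs_le_square_iff[symmetric]\<close>)
qed

lemma square_split: "y\<^sup>2 = (clip (- 1) c y)\<^sup>2 + \<bar>y\<bar> ^ 2 * indicator {y. \<bar>y\<bar> > c} y" for c y :: real
  by (auto simp: clip_def indicator_def)

lemma value_split: "y = clip (- 1) c y + y * indicator {y. \<bar>y\<bar> > c} y" for c y :: real
  by (auto simp: clip_def indicator_def)

lemma integrableX_square: "e \<in> upairs N \<Longrightarrow> integrable M (\<lambda>\<omega>. (X e \<omega>)\<^sup>2)"
  by (subst square_split[where c = 1]) (intro Bochner_Integration.integrable_add integrable_clipX integrable_tailX; simp)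

lemma integrableX: "e \<in> upairs N \<Longrightarrow> integrable M (X e)"
  by (rule square_integrable_imp_integrable[OF measurableX integrableX_square])

definition drift :: "real \<Rightarrow> nat \<times> nat \<Rightarrow> real" where
  "drift c e = expectation (\<lambda>\<omega>. clip (- 1) c (X e \<omega>))"

text \<open>As \<open>X e\<close> is centred, the mean of its truncation is minus the mean of the
  removed tail.\<close>

lemma abs_drift_le:
  assumes e: "e \<in> upairs N" and c: "0 < c"
  shows "\<bar>drift c e\<bar> \<le> K * c powr (1 - p)"
proof -
  let ?h = "\<lambda>\<omega>. X e \<omega> * indicator {y. \<bar>y\<bar> > c} (X e \<omega>)"
  have "?h = (\<lambda>\<omega>. X e \<omega> - clip (- 1) c (X e \<omega>))"
  proof
    fix \<omega>
    show "?h \<omega> = X e \<omega> - clip (- 1) c (X e \<omega>)" using value_split[of "X e \<omega>" c] by linarith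
  qed
  then have inth: "integrable M ?h" using integrableX[OF e] integrable_clipX(1)[OF e] c by simp
  have "expectation (X e) = expectation (\<lambda>\<omega>. clip (- 1) c (X e \<omega>) + ?h \<omega>)"
    using value_split[of _ c] by simp
  also have "\<dots> = drift c e + expectation ?h"
    unfolding drift_def by (rule Bochner_Integration.integral_add) (use integrable_clipX(1)[OF e] c inth in auto)
  finally have "\<bar>drift c e\<bar> = \<bar>expectation ?h\<bar>" using meanX[OF e] by linarith
  also have "\<dots> \<le> expectation (\<lambda>\<omega>. \<bar>?h \<omega>\<bar>)" by (rule integral_abs_bound)
  also have "\<dots> = expectation (\<lambda>\<omega>. \<bar>X e \<omega>\<bar> ^ 1 * indicator {y. \<bar>y\<bar> > c} (X e \<omega>))" by (simp add: abs_mult)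
  also have "\<dots> \<le> K * c powr (real 1 - p)" by (rule tailX_le[OF e c]) simp
  finally show ?thesis by simp
qed

definition part :: "real \<Rightarrow> real \<Rightarrow> nat \<times> nat \<Rightarrow> 'a \<Rightarrow> real" where
  "part b c e = center (\<lambda>\<omega>. clip b c (X e \<omega>))"

lemma bounded_array_part:
  assumes "0 < c"
  shows "bounded_array M N (part b c) (2 * c)"
  unfolding bounded_array_def part_def
  by (rule center_bounded_family[OF finite_upairs indepX]) (use assms abs_clip_le in auto)

lemma part_variance:
  assumes "e \<in> upairs N" "0 < c"
  shows "expectation (\<lambda>\<omega>. (part b c e \<omega>)\<^sup>2)
    = expectation (\<lambda>\<omega>. (clip b c (X e \<omega>))\<^sup>2) - (expectation (\<lambda>\<omega>. clip b c (X e \<omega>)))\<^sup>2"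
proof -
  note [measurable] = measurableX[OF assms(1)]
  show ?thesis unfolding part_def
    by (rule expectation_center_square) (use integrable_clipX(2)[OF assms(1)] assms(2) in auto)
qed

lemma part_variance_le:
  assumes "e \<in> upairs N" "0 < c"
  shows "expectation (\<lambda>\<omega>. (part b c e \<omega>)\<^sup>2) \<le> expectation (\<lambda>\<omega>. (X e \<omega>)\<^sup>2)"
proof -
  have "expectation (\<lambda>\<omega>. (clip b c (X e \<omega>))\<^sup>2) \<le> expectation (\<lambda>\<omega>. (X e \<omega>)\<^sup>2)"
    by (rule integral_mono) (use integrable_clipX integrableX_square clip_square_le assms in auto)
  then show ?thesis unfolding part_variance[OF assms]
    using zero_le_power2[of "expectation (\<lambda>\<omega>. clip b c (X e \<omega>))"] by linarith
qed

text \<open>The clipped variable is supported on |X| > b, so its second moment is a tail moment. For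
  p > 6 this decays faster than b^(-4), which pays for the crude walk count.\<close>

lemma part_variance_tail:
  assumes "e \<in> upairs N" "0 < b" "0 < c"
  shows "expectation (\<lambda>\<omega>. (part b c e \<omega>)\<^sup>2) \<le> K * b powr (2 - p)"
proof -
  have "expectation (\<lambda>\<omega>. (clip b c (X e \<omega>))\<^sup>2) \<le> expectation (\<lambda>\<omega>. \<bar>X e \<omega>\<bar> ^ 2 * indicator {y. \<bar>y\<bar> > b} (X e \<omega>))"
  proof (rule integral_mono)
    show "integrable M (\<lambda>\<omega>. (clip b c (X e \<omega>))\<^sup>2)" using integrable_clipX(2) assms by simp
    show "integrable M (\<lambda>\<omega>. \<bar>X e \<omega>\<bar> ^ 2 * indicator {y. \<bar>y\<bar> > b} (X e \<omega>))"
      by (rule integrable_tailX) (use assms in auto)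
  qed (auto simp: clip_def indicator_def)
  also have "\<dots> \<le> K * b powr (real 2 - p)" by (rule tailX_le) (use assms in auto)
  finally show ?thesis unfolding part_variance[OF assms(1,3)] of_nat_numeral
    using zero_le_power2[of "expectation (\<lambda>\<omega>. clip b c (X e \<omega>))"] by linarith
qed

text \<open>Truncation removes the second moment of the tail, and centring subtracts the square of
  the small \<open>drift\<close>. This keeps the row variances near r N in the lower bound.\<close>

lemma part_variance_ge:
  assumes "e \<in> upairs N" "0 < c"
  shows "expectation (\<lambda>\<omega>. (X e \<omega>)\<^sup>2) - K * c powr (2 - p) - (K * c powr (1 - p))\<^sup>2
    \<le> expectation (\<lambda>\<omega>. (part (- 1) c e \<omega>)\<^sup>2)"
proof -
  have "expectation (\<lambda>\<omega>. (X e \<omega>)\<^sup>2)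
      = expectation (\<lambda>\<omega>. (clip (- 1) c (X e \<omega>))\<^sup>2 + \<bar>X e \<omega>\<bar> ^ 2 * indicator {y. \<bar>y\<bar> > c} (X e \<omega>))"
    by (subst square_split[of _ c]) simp
  also have "\<dots> = expectation (\<lambda>\<omega>. (clip (- 1) c (X e \<omega>))\<^sup>2)
      + expectation (\<lambda>\<omega>. \<bar>X e \<omega>\<bar> ^ 2 * indicator {y. \<bar>y\<bar> > c} (X e \<omega>))"
    by (rule Bochner_Integration.integral_add)
      (use assms integrable_clipX(2) in simp, rule integrable_tailX, use assms in auto)
  finally have "expectation (\<lambda>\<omega>. (X e \<omega>)\<^sup>2) = expectation (\<lambda>\<omega>. (clip (- 1) c (X e \<omega>))\<^sup>2)
      + expectation (\<lambda>\<omega>. \<bar>X e \<omega>\<bar> ^ 2 * indicator {y. \<bar>y\<bar> > c} (X e \<omega>))" .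
  moreover have "expectation (\<lambda>\<omega>. \<bar>X e \<omega>\<bar> ^ 2 * indicator {y. \<bar>y\<bar> > c} (X e \<omega>)) \<le> K * c powr (real 2 - p)"
    by (rule tailX_le) (use assms in auto)
  moreover have "(drift c e)\<^sup>2 \<le> (K * c powr (1 - p))\<^sup>2"
    using power_mono[OF abs_drift_le[OF assms], of 2] by simp
  ultimately show ?thesis unfolding part_variance[OF assms] drift_def by simp
qed

lemma entries_bounded:
  assumes c: "0 < c"
  shows "\<exists>E\<in>events. prob E \<le> (real N)\<^sup>2 * (K * c powr (- p)) \<and>
    (\<forall>\<omega>\<in>space M - E. \<forall>e\<in>upairs N. \<bar>X e \<omega>\<bar> \<le> c)"
proof -
  let ?F = "\<lambda>e. {\<omega> \<in> space M. \<bar>X e \<omega>\<bar> > c}"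
  have F: "?F e \<in> events \<and> prob (?F e) \<le> K * c powr (- p)" if e: "e \<in> upairs N" for e
  proof -
    note [measurable] = measurableX[OF e]
    have ev: "?F e \<in> events" by measurable
    have "prob (?F e) = expectation (indicator (?F e))" using ev by simp
    also have "\<dots> = expectation (\<lambda>\<omega>. \<bar>X e \<omega>\<bar> ^ 0 * indicator {y. \<bar>y\<bar> > c} (X e \<omega>))"
      by (rule Bochner_Integration.integral_cong) (auto simp: indicator_def)
    also have "\<dots> \<le> K * c powr (real 0 - p)" by (rule tailX_le[OF e c]) simp
    finally show ?thesis using ev by simp
  qed
  have "card (upairs N) \<le> card ({1..N} \<times> {1..N})"
    by (rule card_mono) (auto simp: upairs_def)
  then have "real (card (upairs N)) \<le> real (N * N)" by (subst of_nat_le_iff) (simp add: card_cartesian_product)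
  then have card: "real (card (upairs N)) \<le> (real N)\<^sup>2" by (simp add: power2_eq_square)
  have "prob (\<Union>e\<in>upairs N. ?F e) \<le> (\<Sum>e\<in>upairs N. prob (?F e))"
    using finite_upairs F by (intro finite_measure_subadditive_finite) auto
  also have "\<dots> \<le> (\<Sum>e\<in>upairs N. K * c powr (- p))"
    by (rule sum_mono) (use F in blast)
  also have "\<dots> = real (card (upairs N)) * (K * c powr (- p))" by simp
  also have "\<dots> \<le> (real N)\<^sup>2 * (K * c powr (- p))"
    using card K_nonneg by (intro mult_right_mono) auto
  finally have "prob (\<Union>e\<in>upairs N. ?F e) \<le> (real N)\<^sup>2 * (K * c powr (- p))" .
  moreover have "(\<Union>e\<in>upairs N. ?F e) \<in> events" using finite_upairs F by (intro sets.finite_UN) auto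
  moreover have "\<forall>\<omega>\<in>space M - (\<Union>e\<in>upairs N. ?F e). \<forall>e\<in>upairs N. \<bar>X e \<omega>\<bar> \<le> c" by (auto simp: not_less)
  ultimately show ?thesis by blast
qed

text \<open>For an entry within the cut, truncation is the identity and only the centring constant
  remains. Splitting at \<open>b\<close> is exact because the means of the two bands add up as the
  bands do.\<close>

lemma decomposition:
  assumes e: "e \<in> upairs N" and c: "0 < c" and le: "\<bar>X e \<omega>\<bar> \<le> c"
  shows "X e \<omega> = part (- 1) c e \<omega> + drift c e"
    and "0 < b \<Longrightarrow> b \<le> c \<Longrightarrow> part (- 1) c e \<omega> = part (- 1) b e \<omega> + part b c e \<omega>"
proof -
  show "X e \<omega> = part (- 1) c e \<omega> + drift c e"
    using le by (simp add: part_def center_def drift_def) (simp add: clip_def)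
  assume b: "0 < b" "b \<le> c"
  have "expectation (\<lambda>\<omega>. clip (- 1) b (X e \<omega>)) + expectation (\<lambda>\<omega>. clip b c (X e \<omega>))
      = expectation (\<lambda>\<omega>. clip (- 1) b (X e \<omega>) + clip b c (X e \<omega>))"
    by (rule Bochner_Integration.integral_add[symmetric]) (use integrable_clipX(1)[OF e] b in auto)
  also have "\<dots> = expectation (\<lambda>\<omega>. clip (- 1) c (X e \<omega>))" using b by (simp add: clip_add)
  finally show "part (- 1) c e \<omega> = part (- 1) b e \<omega> + part b c e \<omega>"
    using clip_add[of b c "X e \<omega>"] b by (simp add: part_def center_def)
qed

end

section \<open>Events of asymptotic probability one\<close>

text \<open>Formulated through measurable exceptional sets, so that statements about operator norms
  can be combined without discussing the measurability of the statements themselves.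
  \<open>P\<close> is required for large N only.\<close>

definition whp :: "(nat \<Rightarrow> 'a measure) \<Rightarrow> (nat \<Rightarrow> 'a \<Rightarrow> bool) \<Rightarrow> bool" where
  "whp M P \<longleftrightarrow> (\<exists>E. (\<forall>N. E N \<in> sets (M N)) \<and> (\<lambda>N. measure (M N) (E N)) \<longlonglongrightarrow> 0 \<and>
     (\<forall>\<^sub>F N in sequentially. \<forall>\<omega>\<in>space (M N) - E N. P N \<omega>))"

lemma whpI:
  assumes ev: "\<forall>\<^sub>F N in sequentially. \<exists>E\<in>sets (M N). measure (M N) E \<le> f N \<and> (\<forall>\<omega>\<in>space (M N) - E. P N \<omega>)"
    and f: "f \<longlonglongrightarrow> 0"
  shows "whp M P"
proof -
  let ?Q = "\<lambda>N E. E \<in> sets (M N) \<and> measure (M N) E \<le> f N \<and> (\<forall>\<omega>\<in>space (M N) - E. P N \<omega>)"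
  \<comment> \<open>The empty set serves for the initial N about which nothing is assumed, as
    \<open>whp\<close> asks for measurable sets at every N.\<close>
  define E where "E N = (if \<exists>E. ?Q N E then SOME E. ?Q N E else {})" for N
  have E: "?Q N (E N)" if "\<exists>E. ?Q N E" for N using someI_ex[OF that] that by (simp add: E_def)
  have "E N \<in> sets (M N)" for N using E[of N] by (cases "\<exists>E. ?Q N E") (auto simp: E_def)
  moreover have ev': "\<forall>\<^sub>F N in sequentially. ?Q N (E N)"
    using ev by eventually_elim (rule E, blast)
  moreover have "(\<lambda>N. measure (M N) (E N)) \<longlonglongrightarrow> 0"
    by (rule tendsto_sandwich[OF _ _ tendsto_const f]) (use ev' in \<open>auto elim: eventually_mono\<close>)
  ultimately show ?thesis unfolding whp_def by (auto intro!: exI[of _ E] elim: eventually_mono)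
qed

lemma whp_mono:
  assumes "whp M P" "\<forall>\<^sub>F N in sequentially. \<forall>\<omega>\<in>space (M N). P N \<omega> \<longrightarrow> Q N \<omega>"
  shows "whp M Q"
proof -
  obtain E where E: "\<forall>N. E N \<in> sets (M N)" "(\<lambda>N. measure (M N) (E N)) \<longlonglongrightarrow> 0"
    "\<forall>\<^sub>F N in sequentially. \<forall>\<omega>\<in>space (M N) - E N. P N \<omega>"
    using assms(1) unfolding whp_def by blast
  have "\<forall>\<^sub>F N in sequentially. \<forall>\<omega>\<in>space (M N) - E N. Q N \<omega>"
    using E(3) assms(2) by eventually_elim blast
  then show ?thesis using E unfolding whp_def by blast
qed

lemma whp_conj:
  assumes "whp M P" "whp M Q"
  shows "whp M (\<lambda>N \<omega>. P N \<omega> \<and> Q N \<omega>)"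
proof -
  obtain E where E: "\<forall>N. E N \<in> sets (M N)" "(\<lambda>N. measure (M N) (E N)) \<longlonglongrightarrow> 0"
    "\<forall>\<^sub>F N in sequentially. \<forall>\<omega>\<in>space (M N) - E N. P N \<omega>"
    using assms(1) unfolding whp_def by blast
  obtain F where F: "\<forall>N. F N \<in> sets (M N)" "(\<lambda>N. measure (M N) (F N)) \<longlonglongrightarrow> 0"
    "\<forall>\<^sub>F N in sequentially. \<forall>\<omega>\<in>space (M N) - F N. Q N \<omega>"
    using assms(2) unfolding whp_def by blast
  have "(\<lambda>N. measure (M N) (E N \<union> F N)) \<longlonglongrightarrow> 0"
  proof (rule tendsto_sandwich[OF _ _ tendsto_const])
    show "(\<lambda>N. measure (M N) (E N) + measure (M N) (F N)) \<longlonglongrightarrow> 0"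
      using tendsto_add[OF E(2) F(2)] by simp
    show "\<forall>\<^sub>F N in sequentially. measure (M N) (E N \<union> F N) \<le> measure (M N) (E N) + measure (M N) (F N)"
      using E(1) F(1) by (intro always_eventually allI measure_Un_le) auto
  qed auto
  moreover have "\<forall>\<^sub>F N in sequentially. \<forall>\<omega>\<in>space (M N) - (E N \<union> F N). P N \<omega> \<and> Q N \<omega>"
    using E(3) F(3) by eventually_elim blast
  ultimately show ?thesis using E(1) F(1) unfolding whp_def
    by (intro exI[of _ "\<lambda>N. E N \<union> F N"]) auto
qed

text \<open>Monotonicity needs only the larger set, the exceptional one, to be measurable; a set
  that is not measurable has \<open>measure\<close> 0 by convention.\<close>

lemma measure_tendsto_0_of_whp:
  assumes prob: "\<And>N. prob_space (M N)" and whp: "whp M (\<lambda>N \<omega>. \<not> P N \<omega>)"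
  shows "(\<lambda>N. measure (M N) {\<omega> \<in> space (M N). P N \<omega>}) \<longlonglongrightarrow> 0"
proof -
  obtain E where E: "\<forall>N. E N \<in> sets (M N)" "(\<lambda>N. measure (M N) (E N)) \<longlonglongrightarrow> 0"
    "\<forall>\<^sub>F N in sequentially. \<forall>\<omega>\<in>space (M N) - E N. \<not> P N \<omega>"
    using whp unfolding whp_def by blast
  have "\<forall>\<^sub>F N in sequentially. measure (M N) {\<omega> \<in> space (M N). P N \<omega>} \<le> measure (M N) (E N)"
    using E(3)
  proof eventually_elim
    case (elim N)
    interpret prob_space "M N" by (rule prob)
    show ?case using elim E(1) by (intro finite_measure_mono) auto
  qed
  then show ?thesis
    by (intro tendsto_sandwich[OF _ _ tendsto_const E(2)]) auto
qed

section \<open>Asymptotics\<close>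

lemma sum_split_initial:
  fixes f :: "nat \<Rightarrow> real"
  assumes "m \<le> N"
  shows "(\<Sum>k=1..N. f k) = (\<Sum>k=1..m. f k) + (\<Sum>k\<in>{m<..N}. f k)"
proof -
  have "{1..N} = {1..m} \<union> {m<..N}" using assms by auto
  then show ?thesis by (simp only:) (rule sum.union_disjoint; auto)
qed

locale array_sequence =
  fixes M :: "nat \<Rightarrow> 'a measure" and X :: "nat \<Rightarrow> nat \<times> nat \<Rightarrow> 'a \<Rightarrow> real" and p K r :: real
  assumes array: "\<And>N. centred_array (M N) N (X N) p K"
    and var_le_1: "\<And>N e. e \<in> upairs N \<Longrightarrow> prob_space.expectation (M N) (\<lambda>\<omega>. (X N e \<omega>)\<^sup>2) \<le> 1"
    and r: "0 < r" "r \<le> 1" and p: "6 < p" and K: "1 \<le> K"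
    and row_var: "\<And>\<nu>. 0 < \<nu> \<Longrightarrow> \<forall>\<^sub>F N in sequentially. \<forall>i\<in>{1..N}.
      \<bar>(\<Sum>k=1..N. prob_space.expectation (M N) (\<lambda>\<omega>. (X N (uedge i k) \<omega>)\<^sup>2)) - r * real N\<bar> \<le> \<nu> * real N"
begin

definition scale :: "nat \<Rightarrow> real" where
  "scale N = sqrt (2 * real N * ln (real N))"

definition cut :: "nat \<Rightarrow> real" where
  "cut N = real N powr (1/3)"

definition lev :: "nat \<Rightarrow> real" where
  "lev N = ln (real N) powr (2/5)"

abbreviation "small N \<equiv> centred_array.part (M N) (X N) (- 1) (lev N)"
abbreviation "large N \<equiv> centred_array.part (M N) (X N) (lev N) (cut N)"
abbreviation "trunc N \<equiv> centred_array.part (M N) (X N) (- 1) (cut N)"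
abbreviation "mean N \<equiv> centred_array.drift (M N) (X N) (cut N)"

lemma ev_lev_cut: "\<forall>\<^sub>F N in sequentially. 2 \<le> N \<and> 1 \<le> lev N \<and> lev N \<le> cut N"
proof -
  have "\<forall>\<^sub>F N in sequentially. 1 \<le> ln (real N) powr (2/5)"
    "\<forall>\<^sub>F N in sequentially. ln (real N) powr (2/5) \<le> real N powr (1/3)" by real_asymp+
  with eventually_ge_at_top[of 2] show ?thesis
    by eventually_elim (simp add: lev_def cut_def)
qed

lemma scale_square: "1 \<le> N \<Longrightarrow> (scale N)\<^sup>2 = 2 * real N * ln (real N)"
  by (simp add: scale_def)

lemma scale_pos: "2 \<le> N \<Longrightarrow> 0 < scale N"
  by (simp add: scale_def)

section \<open>The norm of the random matrix\<close>

lemma whp_entries_le_cut: "whp M (\<lambda>N \<omega>. \<forall>e\<in>upairs N. \<bar>X N e \<omega>\<bar> \<le> cut N)"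
proof (rule whpI)
  show "(\<lambda>N. (real N)\<^sup>2 * (K * (real N powr (1/3)) powr (- p))) \<longlonglongrightarrow> 0"
    using p K by real_asymp
  show "\<forall>\<^sub>F N in sequentially. \<exists>E\<in>sets (M N). measure (M N) E \<le> (real N)\<^sup>2 * (K * (real N powr (1/3)) powr (- p)) \<and>
      (\<forall>\<omega>\<in>space (M N) - E. \<forall>e\<in>upairs N. \<bar>X N e \<omega>\<bar> \<le> cut N)"
    using ev_lev_cut
  proof eventually_elim
    case (elim N)
    interpret centred_array "M N" N "X N" p K by (rule array)
    show ?case using entries_bounded[of "cut N"] elim by (simp add: cut_def)
  qed
qed

lemma whp_small_norm:
  assumes \<theta>: "0 < \<theta>"
  shows "whp M (\<lambda>N \<omega>. op_le {1..N} (\<lambda>i j. small N (uedge i j) \<omega>) (\<theta> * scale N))"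
proof (rule whpI)
  show "(\<lambda>N. exp (- real N)) \<longlonglongrightarrow> 0" by real_asymp
  \<comment> \<open>The constant is 32 from the net bound times 2, since centring at most doubles
    the level \<open>lev N\<close>. The inequality holds because 2/5 is less than 1/2.\<close>
  have "\<forall>\<^sub>F N in sequentially. 64 * ln (real N) powr (2/5) * sqrt (real N) \<le> \<theta> * sqrt (2 * real N * ln (real N))"
    using \<theta> by real_asymp
  with ev_lev_cut
  show "\<forall>\<^sub>F N in sequentially. \<exists>E\<in>sets (M N). measure (M N) E \<le> exp (- real N) \<and>
      (\<forall>\<omega>\<in>space (M N) - E. op_le {1..N} (\<lambda>i j. small N (uedge i j) \<omega>) (\<theta> * scale N))"
  proof eventually_elim
    case (elim N)
    interpret C: centred_array "M N" N "X N" p K by (rule array)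
    interpret bounded_array "M N" N "small N" "2 * lev N"
      using elim by (intro C.bounded_array_part) auto
    have "32 * (2 * lev N) * sqrt (real N) \<le> \<theta> * scale N"
      using elim by (simp add: lev_def scale_def)
    then show ?case using op_norm_net_bound elim by (meson op_le_mono one_le_numeral order_trans)
  qed
qed

lemma whp_large_norm:
  assumes \<theta>: "0 < \<theta>"
  shows "whp M (\<lambda>N \<omega>. op_le {1..N} (\<lambda>i j. large N (uedge i j) \<omega>) (\<theta> * scale N))"
proof (rule whpI)
  let ?f = "\<lambda>N. (ln (real N) + 2)\<^sup>2 * real N * exp (- 3 * ln (real N))"
  let ?b = "\<lambda>N. K * (ln (real N) powr (2/5)) powr (- 4)"
  show "?f \<longlonglongrightarrow> 0" by real_asymp
  \<comment> \<open>This bounds the base of the k-th power in \<open>op_norm_moment_bound\<close>.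
    Its order is (log N)^(2 - 8/5 - 1) = (log N)^(- 3/5), so any positive threshold is met
    eventually.\<close>
  have "\<forall>\<^sub>F N in sequentially. (ln (real N) + 2)\<^sup>2 * (real N * ?b N) / (\<theta> * sqrt (2 * real N * ln (real N)))\<^sup>2 \<le> exp (- 3)"
    using \<theta> K by real_asymp
  moreover have "\<forall>\<^sub>F N in sequentially. ?b N \<le> (2 * real N powr (1/3))\<^sup>2" using K by real_asymp
  moreover have "\<forall>\<^sub>F N in sequentially. (2 * real N powr (1/3))\<^sup>2 \<le> real N * ?b N" using K by real_asymp
  ultimately
  show "\<forall>\<^sub>F N in sequentially. \<exists>E\<in>sets (M N). measure (M N) E \<le> ?f N \<and>
      (\<forall>\<omega>\<in>space (M N) - E. op_le {1..N} (\<lambda>i j. large N (uedge i j) \<omega>) (\<theta> * scale N))"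
    using ev_lev_cut
  proof eventually_elim
    case (elim N)
    interpret C: centred_array "M N" N "X N" p K by (rule array)
    interpret bounded_array "M N" N "large N" "2 * cut N"
      using elim by (intro C.bounded_array_part) auto
    define b where "b = ?b N"
    define t where "t = \<theta> * scale N"
    \<comment> \<open>With k at least ln N, \<open>exp (- 3) ^ k\<close> is at most N^(-3), which
      absorbs the factor N of the trace and the logarithms.\<close>
    define k where "k = nat \<lceil>ln (real N)\<rceil>"
    have lnN: "0 < ln (real N)" using elim by simp
    have k: "ln (real N) \<le> real k" "real (Suc k) \<le> ln (real N) + 2" "0 < k"
      using lnN unfolding k_def by linarith+
    have t: "0 < t" using \<theta> elim scale_pos by (simp add: t_def)
    have b: "0 < b" using K lnN by (simp add: b_def)
    have var: "C.expectation (\<lambda>\<omega>. (large N e \<omega>)\<^sup>2) \<le> b" if "e \<in> upairs N" for e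
    proof -
      have "C.expectation (\<lambda>\<omega>. (large N e \<omega>)\<^sup>2) \<le> K * lev N powr (2 - p)"
        using elim that by (intro C.part_variance_tail) auto
      also have "\<dots> \<le> K * lev N powr (- 4)"
        using elim p K by (intro mult_left_mono powr_mono) auto
      finally show ?thesis by (simp add: b_def lev_def)
    qed
    have "\<exists>E\<in>C.events. C.prob E \<le> real (Suc k) ^ (2 * k + 2) * real N * (real N * b) ^ k / t ^ (2 * k) \<and>
        (\<forall>\<omega>\<in>space (M N) - E. op_le {1..N} (\<lambda>i j. large N (uedge i j) \<omega>) t)"
      by (rule op_norm_moment_bound) (use elim t b k var in \<open>auto simp: b_def cut_def\<close>)
    moreover have "real (Suc k) ^ (2 * k + 2) * real N * (real N * b) ^ k / t ^ (2 * k) \<le> ?f N"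
    proof -
      have "real (Suc k) ^ (2 * k + 2) * real N * (real N * b) ^ k / t ^ (2 * k)
          = (real (Suc k))\<^sup>2 * real N * ((real (Suc k))\<^sup>2 * (real N * b) / t\<^sup>2) ^ k"
        by (simp only: power_add power_mult power_divide power_mult_distrib) (simp only: mult_ac times_divide_eq_right times_divide_eq_left)
      also have "\<dots> \<le> (ln (real N) + 2)\<^sup>2 * real N * (exp (- 3)) ^ k"
      proof (intro mult_mono power_mono)
        have "(real (Suc k))\<^sup>2 * (real N * b) / t\<^sup>2 \<le> (ln (real N) + 2)\<^sup>2 * (real N * b) / t\<^sup>2"
          using k b by (intro divide_right_mono mult_right_mono power_mono) auto
        also have "\<dots> \<le> exp (- 3)" using elim by (simp add: b_def t_def scale_def)
        finally show "(real (Suc k))\<^sup>2 * (real N * b) / t\<^sup>2 \<le> exp (- 3)" .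
      qed (use k b lnN in auto)
      also have "(exp (- 3)) ^ k = exp (- 3 * real k)" by (simp add: exp_of_nat_mult[symmetric] mult.commute)
      also have "(ln (real N) + 2)\<^sup>2 * real N * exp (- 3 * real k) \<le> ?f N"
        using k by (intro mult_left_mono) auto
      finally show ?thesis .
    qed
    ultimately show ?case unfolding t_def by (meson order_trans)
  qed
qed

lemma ev_mean_small:
  assumes \<theta>: "0 < \<theta>"
  shows "\<forall>\<^sub>F N in sequentially. real N * (K * cut N powr (1 - p)) \<le> \<theta> * scale N"
proof -
  \<comment> \<open>As p > 6, the exponent \<open>1 - p\<close> may be raised to - 5; the left side
    is then of order N^(1 - 5/3) and even tends to zero.\<close>
  have "\<forall>\<^sub>F N in sequentially. real N * (K * (real N powr (1/3)) powr (- 5)) \<le> \<theta> * sqrt (2 * real N * ln (real N))"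
    using \<theta> K by real_asymp
  with ev_lev_cut show ?thesis
  proof eventually_elim
    case (elim N)
    have "real N * (K * cut N powr (1 - p)) \<le> real N * (K * cut N powr (- 5))"
      using elim p K by (intro mult_left_mono powr_mono) auto
    also have "\<dots> \<le> \<theta> * scale N" using elim unfolding cut_def scale_def by blast
    finally show ?case .
  qed
qed

lemma whp_norm:
  assumes \<theta>: "0 < \<theta>"
  shows "whp M (\<lambda>N \<omega>. op_le {1..N} (\<lambda>i j. X N (uedge i j) \<omega>) (3 * \<theta> * scale N))"
proof (rule whp_mono[OF whp_conj[OF whp_entries_le_cut whp_conj[OF whp_small_norm[OF \<theta>] whp_large_norm[OF \<theta>]]]])
  show "\<forall>\<^sub>F N in sequentially. \<forall>\<omega>\<in>space (M N). (\<forall>e\<in>upairs N. \<bar>X N e \<omega>\<bar> \<le> cut N) \<and>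
      op_le {1..N} (\<lambda>i j. small N (uedge i j) \<omega>) (\<theta> * scale N) \<and>
      op_le {1..N} (\<lambda>i j. large N (uedge i j) \<omega>) (\<theta> * scale N) \<longrightarrow>
      op_le {1..N} (\<lambda>i j. X N (uedge i j) \<omega>) (3 * \<theta> * scale N)"
    using ev_lev_cut ev_mean_small[OF \<theta>]
  proof (eventually_elim, intro ballI impI)
    fix N \<omega>
    assume N: "2 \<le> N \<and> 1 \<le> lev N \<and> lev N \<le> cut N" "real N * (K * cut N powr (1 - p)) \<le> \<theta> * scale N"
      and *: "(\<forall>e\<in>upairs N. \<bar>X N e \<omega>\<bar> \<le> cut N) \<and>
      op_le {1..N} (\<lambda>i j. small N (uedge i j) \<omega>) (\<theta> * scale N) \<and>
      op_le {1..N} (\<lambda>i j. large N (uedge i j) \<omega>) (\<theta> * scale N)"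
    interpret C: centred_array "M N" N "X N" p K by (rule array)
    have "op_le {1..N} (\<lambda>i j. mean N (uedge i j)) (real (card {1..N}) * (K * cut N powr (1 - p)))"
      using N by (intro op_le_const C.abs_drift_le uedge_in_upairs) auto
    then have "op_le {1..N} (\<lambda>i j. mean N (uedge i j)) (\<theta> * scale N)"
      by (rule op_le_mono) (simp only: card_atLeastAtMost diff_Suc_1 N(2))
    then have "op_le {1..N} (\<lambda>i j. small N (uedge i j) \<omega> + large N (uedge i j) \<omega> + mean N (uedge i j))
        (\<theta> * scale N + \<theta> * scale N + \<theta> * scale N)"
      using * by (intro op_le_add) auto
    moreover have "X N (uedge i j) \<omega> = small N (uedge i j) \<omega> + large N (uedge i j) \<omega> + mean N (uedge i j)"
      if "i \<in> {1..N}" "j \<in> {1..N}" for i j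
    proof -
      note e = uedge_in_upairs[OF that]
      have "0 < cut N" "0 < lev N" "lev N \<le> cut N" "\<bar>X N (uedge i j) \<omega>\<bar> \<le> cut N" using N(1) * e by auto
      then show ?thesis using C.decomposition[OF e, of "cut N" \<omega>] by simp
    qed
    ultimately show "op_le {1..N} (\<lambda>i j. X N (uedge i j) \<omega>) (3 * \<theta> * scale N)"
      by (subst op_le_cong) (auto simp: algebra_simps)
  qed
qed

section \<open>The largest row sum, from above and from below\<close>

lemma array_trunc:
  assumes "0 < cut N"
  shows "bounded_array (M N) N (trunc N) (2 * cut N)"
  using centred_array.bounded_array_part[OF array assms] .

abbreviation "trow N \<equiv> bounded_array.part_row (trunc N)"
abbreviation "tvar N \<equiv> bounded_array.part_var (M N) (trunc N)"

lemma whp_rows_upper: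
  assumes \<theta>: "0 < \<theta>"
  shows "whp M (\<lambda>N \<omega>. \<forall>i\<in>{1..N}. \<bar>trow N {1..N} i \<omega>\<bar> < (1 + \<theta>) * sqrt r * scale N)"
proof (rule whpI)
  let ?f = "\<lambda>N. 2 * exp (- (\<theta> / 2 * ln (real N)))"
  \<comment> \<open>The squared threshold contains (1 + \<theta>)^2. One factor pays for the error
    allowed in the row variances through \<open>V\<close>, and this \<open>\<eta>\<close> reduces
    the other to 1 + \<theta> / 2, so the union over N rows still leaves N^(- \<theta> / 2).\<close>
  define \<eta> where "\<eta> = \<theta> / (2 * (1 + \<theta>))"
  have \<eta>: "0 < \<eta>" "\<eta> \<le> 1" "(1 + \<theta>) * (1 - \<eta>) = 1 + \<theta> / 2"
    using \<theta> by (auto simp: \<eta>_def field_simps)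
  show "?f \<longlonglongrightarrow> 0" using \<theta> by real_asymp
  have "\<forall>\<^sub>F N in sequentially. (1 + \<theta>) * sqrt r * sqrt (2 * real N * ln (real N)) * (2 * real N powr (1/3)) / ((1 + \<theta>) * r * real N) \<le> \<eta> / 3"
    using \<theta> r \<eta> by real_asymp
  moreover have "\<forall>\<^sub>F N in sequentially. \<forall>i\<in>{1..N}.
      \<bar>(\<Sum>k=1..N. prob_space.expectation (M N) (\<lambda>\<omega>. (X N (uedge i k) \<omega>)\<^sup>2)) - r * real N\<bar> \<le> \<theta> * r * real N"
    using \<theta> r by (intro row_var) auto
  ultimately
  show "\<forall>\<^sub>F N in sequentially. \<exists>E\<in>sets (M N). measure (M N) E \<le> ?f N \<and>
      (\<forall>\<omega>\<in>space (M N) - E. \<forall>i\<in>{1..N}. \<bar>trow N {1..N} i \<omega>\<bar> < (1 + \<theta>) * sqrt r * scale N)"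
    using ev_lev_cut
  proof eventually_elim
    case (elim N)
    interpret C: centred_array "M N" N "X N" p K by (rule array)
    interpret Z: bounded_array "M N" N "trunc N" "2 * cut N"
      using elim by (intro array_trunc) auto
    define V where "V = (1 + \<theta>) * r * real N"
    define t where "t = (1 + \<theta>) * sqrt r * scale N"
    have V: "0 < V" using \<theta> r elim by (simp add: V_def)
    have t: "0 < t" using \<theta> r elim scale_pos by (simp add: t_def)
    have var: "tvar N {1..N} i \<le> V" if i: "i \<in> {1..N}" for i
    proof -
      have "tvar N {1..N} i \<le> (\<Sum>k=1..N. C.expectation (\<lambda>\<omega>. (X N (uedge i k) \<omega>)\<^sup>2))"
        unfolding Z.part_var_def using elim by (intro sum_mono C.part_variance_le uedge_in_upairs i) auto
      also have "\<dots> \<le> V" using elim i by (force simp: V_def algebra_simps abs_le_iff)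
      finally show ?thesis .
    qed
    have "\<exists>E\<in>C.events. C.prob E \<le> real (card {1..N}) * (2 * exp (- (t\<^sup>2 * (1 - \<eta>) / (2 * V)))) \<and>
        (\<forall>\<omega>\<in>space (M N) - E. \<forall>i\<in>{1..N}. \<bar>trow N {1..N} i \<omega>\<bar> < t)"
      by (rule Z.part_rows_bounded) (use var V t \<eta> elim in \<open>auto simp: t_def V_def scale_def cut_def\<close>)
    moreover have "t\<^sup>2 * (1 - \<eta>) / (2 * V) = (1 + \<theta>) * (1 - \<eta>) * ln (real N)"
    proof -
      have "t\<^sup>2 = (1 + \<theta>)\<^sup>2 * r * (2 * real N * ln (real N))"
        using elim r by (simp add: t_def power_mult_distrib scale_square)
      also have "\<dots> = (1 + \<theta>) * ln (real N) * (2 * V)"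
        by (simp add: V_def power2_eq_square mult_ac)
      finally show ?thesis using V by simp
    qed
    moreover have "real (card {1..N}) * (2 * exp (- ((1 + \<theta> / 2) * ln (real N)))) = ?f N"
    proof -
      have "real N = exp (ln (real N))" using elim by simp
      then have "real N * exp (- ((1 + \<theta> / 2) * ln (real N))) = exp (ln (real N) + - ((1 + \<theta> / 2) * ln (real N)))"
        by (metis exp_add)
      then show ?thesis by (simp add: algebra_simps)
    qed
    ultimately show ?case unfolding \<eta>(3) t_def by metis
  qed
qed

definition floor_part :: "real \<Rightarrow> nat \<Rightarrow> nat" where
  "floor_part \<kappa> N = nat \<lfloor>\<kappa> * real N\<rfloor>"

lemma floor_part_bounds:
  assumes "0 < \<kappa>" "\<kappa> \<le> 1"
  shows "\<forall>\<^sub>F N in sequentially. 1 \<le> floor_part \<kappa> N \<and> floor_part \<kappa> N \<le> N \<and>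
    \<kappa> / 2 * real N \<le> real (floor_part \<kappa> N) \<and> real (floor_part \<kappa> N) \<le> \<kappa> * real N"
proof -
  have "\<forall>\<^sub>F N in sequentially. 2 \<le> \<kappa> * real N" using assms by real_asymp
  then show ?thesis
  proof eventually_elim
    case (elim N)
    have f: "real (nat \<lfloor>\<kappa> * real N\<rfloor>) = of_int \<lfloor>\<kappa> * real N\<rfloor>" using elim by simp
    have "\<kappa> * real N \<le> 1 * real N" using assms by (intro mult_right_mono) auto
    then have "real (nat \<lfloor>\<kappa> * real N\<rfloor>) \<le> real N" unfolding f by linarith
    then have "nat \<lfloor>\<kappa> * real N\<rfloor> \<le> N" by simp
    moreover have "1 \<le> nat \<lfloor>\<kappa> * real N\<rfloor>" using elim by (simp add: le_nat_iff le_floor_iff)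
    moreover have "\<kappa> / 2 * real N \<le> of_int \<lfloor>\<kappa> * real N\<rfloor>" "of_int \<lfloor>\<kappa> * real N\<rfloor> \<le> \<kappa> * real N"
      using elim by linarith+
    ultimately show ?case unfolding floor_part_def f by blast
  qed
qed

lemma whp_some_part_row_large:
  assumes \<theta>: "0 < \<theta>" "\<theta> \<le> 1/2" and \<kappa>: "0 < \<kappa>" "\<kappa> \<le> r * \<theta> / 2"
  defines "m \<equiv> floor_part \<kappa>"
  shows "whp M (\<lambda>N \<omega>. \<exists>i\<in>{1..m N}. (1 - \<theta>) * sqrt r * scale N \<le> trow N {m N<..N} i \<omega>)"
proof (rule whpI)
  \<comment> \<open>The lower tail multiplies the exponent by (1 + 3 \<delta>) / (1 - \<delta>)^2,
    which for this choice is at most 1 + \<theta>. The threshold and the variance together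
    contribute 1 - \<theta>, and the product stays below 1.\<close>
  define \<delta> where "\<delta> = \<theta> / 8"
  \<comment> \<open>The losses of variance add up to r \<theta> N: a quarter of it from the
    tolerance in \<open>row_var\<close>, half from the missing first m columns, a quarter from
    truncation. What remains is \<open>V0\<close>.\<close>
  define \<nu> where "\<nu> = r * \<theta> / 4"
  have \<delta>: "0 < \<delta>" "\<delta> \<le> 1/2" using \<theta> by (auto simp: \<delta>_def)
  have \<nu>: "0 < \<nu>" using \<theta> r by (auto simp: \<nu>_def)
  have \<delta>\<theta>: "(1 - \<theta>) * (1 + 3 * \<delta>) / (1 - \<delta>)\<^sup>2 \<le> 1 - \<theta>\<^sup>2"
  proof -
    have "1 + 3 * \<delta> \<le> (1 + \<theta>) * (1 - \<delta>)\<^sup>2"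
    proof -
      have "0 \<le> \<delta> * (3 - 16 * \<delta>)" using \<delta> \<theta> by (intro mult_nonneg_nonneg) (auto simp: \<delta>_def)
      then have "1 + 3 * \<delta> \<le> (1 + \<theta>) * (1 - 2 * \<delta>)" by (simp add: \<delta>_def field_simps)
      also have "\<dots> \<le> (1 + \<theta>) * (1 - \<delta>)\<^sup>2" using \<theta> by (intro mult_left_mono) (auto simp: power2_eq_square algebra_simps)
      finally show ?thesis .
    qed
    then have "(1 + 3 * \<delta>) / (1 - \<delta>)\<^sup>2 \<le> 1 + \<theta>" using \<delta> by (simp add: divide_le_eq)
    then have "(1 - \<theta>) * ((1 + 3 * \<delta>) / (1 - \<delta>)\<^sup>2) \<le> (1 - \<theta>) * (1 + \<theta>)"
      using \<theta> by (intro mult_left_mono) auto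
    then show ?thesis by (simp add: power2_eq_square algebra_simps)
  qed
  \<comment> \<open>Each row succeeds with probability at least
    \<open>q = real N powr (\<theta>\<^sup>2 - 1) / 2\<close>, and there are at least
    \<open>\<kappa> / 2 * real N\<close> rows; the product of the two is the exponent here.\<close>
  let ?f = "\<lambda>N. exp (- (\<kappa> / 4 * (real N powr (\<theta>\<^sup>2))))"
  have "0 < \<theta>\<^sup>2" using \<theta> by simp
  then show "?f \<longlonglongrightarrow> 0" using \<kappa> by real_asymp
  have \<kappa>1: "\<kappa> \<le> 1" using \<kappa> r \<theta> mult_mono[of r 1 \<theta> 1] by auto
  have "\<forall>\<^sub>F N in sequentially. 4 * ((1 - \<theta>) * sqrt r * sqrt (2 * real N * ln (real N))) * (2 * real N powr (1/3)) / ((1 - \<theta>) * r * real N) \<le> \<delta>\<^sup>2 / 36"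
    using \<theta> r \<delta> by real_asymp
  moreover have "\<forall>\<^sub>F N in sequentially. 6 / \<delta>\<^sup>2 \<le> (1 - \<theta>)\<^sup>2 * r * (2 * ln (real N))"
  proof -
    have "0 < (1 - \<theta>)\<^sup>2" using \<theta> by simp
    then show ?thesis using r by real_asymp
  qed
  moreover have "\<forall>\<^sub>F N in sequentially. K * (real N powr (1/3)) powr (- 4) + (K * (real N powr (1/3)) powr (- 5))\<^sup>2 \<le> \<nu>"
    using \<nu> K by real_asymp
  ultimately
  show "\<forall>\<^sub>F N in sequentially. \<exists>E\<in>sets (M N). measure (M N) E \<le> ?f N \<and>
      (\<forall>\<omega>\<in>space (M N) - E. \<exists>i\<in>{1..m N}. (1 - \<theta>) * sqrt r * scale N \<le> trow N {m N<..N} i \<omega>)"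
    using ev_lev_cut row_var[OF \<nu>] floor_part_bounds[OF \<kappa>(1) \<kappa>1, folded m_def]
  proof eventually_elim
    case (elim N)
    interpret C: centred_array "M N" N "X N" p K by (rule array)
    interpret Z: bounded_array "M N" N "trunc N" "2 * cut N"
      using elim by (intro array_trunc) auto
    define V0 where "V0 = (1 - \<theta>) * r * real N"
    define t where "t = (1 - \<theta>) * sqrt r * scale N"
    define q where "q = exp (- ((1 - \<theta>\<^sup>2) * ln (real N))) / 2"
    let ?v = "\<lambda>i k. C.expectation (\<lambda>\<omega>. (X N (uedge i k) \<omega>)\<^sup>2)"
    have N: "2 \<le> N" "real N > 0" using elim by auto
    have mN: "1 \<le> m N" "m N \<le> N" using elim by auto
    have V0: "0 < V0" using \<theta> r N by (simp add: V0_def)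
    have t: "0 < t" using \<theta> r N scale_pos by (simp add: t_def)
    have t2: "t\<^sup>2 = (1 - \<theta>)\<^sup>2 * r * (2 * real N * ln (real N))"
      using N r by (simp add: t_def power_mult_distrib scale_square)
    have v1: "?v i k \<le> 1" if "i \<in> {1..N}" "k \<in> {1..N}" for i k
      by (rule var_le_1[OF uedge_in_upairs[OF that]])
    have var_up: "tvar N {m N<..N} i \<le> real N" if i: "i \<in> {1..N}" for i
    proof -
      have "tvar N {m N<..N} i \<le> (\<Sum>k\<in>{m N<..N}. ?v i k)"
        unfolding Z.part_var_def using elim by (intro sum_mono C.part_variance_le uedge_in_upairs i) auto
      also have "\<dots> \<le> (\<Sum>k\<in>{m N<..N}. 1)" using i by (intro sum_mono v1) auto
      finally show ?thesis by simp
    qed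
    have var_low: "V0 \<le> tvar N {m N<..N} i" if i: "i \<in> {1..N}" for i
    proof -
      have split: "(\<Sum>k=1..N. ?v i k) = (\<Sum>k=1..m N. ?v i k) + (\<Sum>k\<in>{m N<..N}. ?v i k)"
        by (rule sum_split_initial[OF mN(2)])
      have "(\<Sum>k=1..m N. ?v i k) \<le> (\<Sum>k=1..m N. 1)" using i mN by (intro sum_mono v1) auto
      also have "\<dots> \<le> \<kappa> * real N" using elim by simp
      also have "\<dots> \<le> r * \<theta> / 2 * real N" using \<kappa> by (intro mult_right_mono) auto
      finally have first: "(\<Sum>k=1..m N. ?v i k) \<le> r * \<theta> / 2 * real N" .
      have err: "K * cut N powr (2 - p) + (K * cut N powr (1 - p))\<^sup>2 \<le> \<nu>"
      proof -
        have "K * cut N powr (2 - p) + (K * cut N powr (1 - p))\<^sup>2 \<le> K * cut N powr (- 4) + (K * cut N powr (- 5))\<^sup>2"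
          using elim p K by (intro add_mono power_mono mult_left_mono powr_mono) auto
        then show ?thesis using elim by (simp add: cut_def)
      qed
      have "(\<Sum>k\<in>{m N<..N}. ?v i k) - \<nu> * real N \<le> (\<Sum>k\<in>{m N<..N}. ?v i k) - (\<Sum>k\<in>{m N<..N}. \<nu>)"
        using \<nu> by (simp add: mult_right_mono mult.commute)
      also have "\<dots> = (\<Sum>k\<in>{m N<..N}. ?v i k - \<nu>)" by (simp only: sum_subtractf)
      also have "\<dots> \<le> tvar N {m N<..N} i"
        unfolding Z.part_var_def
      proof (rule sum_mono)
        fix k assume "k \<in> {m N<..N}"
        then have "uedge i k \<in> upairs N" using i by (intro uedge_in_upairs) auto
        then show "?v i k - \<nu> \<le> C.expectation (\<lambda>\<omega>. (trunc N (uedge i k) \<omega>)\<^sup>2)"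
          using C.part_variance_ge[of "uedge i k" "cut N"] err elim by auto
      qed
      finally have "(\<Sum>k\<in>{m N<..N}. ?v i k) - \<nu> * real N \<le> tvar N {m N<..N} i" .
      moreover have "(r - \<nu>) * real N \<le> (\<Sum>k=1..N. ?v i k)" using elim i by (force simp: algebra_simps abs_le_iff)
      ultimately have "(r - \<nu>) * real N - r * \<theta> / 2 * real N - \<nu> * real N \<le> tvar N {m N<..N} i"
        using split first by linarith
      then show ?thesis by (simp add: V0_def \<nu>_def algebra_simps)
    qed
    have q: "q \<le> C.prob {\<omega> \<in> space (M N). trow N {m N<..N} i \<omega> \<ge> t}" if i: "i \<in> {1..m N}" for i
    proof -
      have i': "i \<in> {1..N}" "{m N<..N} \<subseteq> {1..N}" using i mN by auto
      interpret J: bounded_family "M N" "uedge i ` {m N<..N}" "trunc N" "2 * cut N"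
        using i' by (intro Z.bounded_family_subset Z.uedge_image_subset)
      note eq = Z.part_row_eq[OF i']
      have "exp (- (t\<^sup>2 * (1 + 3 * \<delta>) / (2 * (1 - \<delta>)\<^sup>2 * V0))) / 2 \<le> C.prob {\<omega> \<in> space (M N). J.total_sum \<omega> \<ge> t}"
      proof (rule J.lower_tail_at[OF \<delta> V0])
        show "V0 \<le> J.total_var" "J.total_var \<le> real N" unfolding eq using var_low var_up i' by auto
        show "4 * t * (2 * cut N) / V0 \<le> \<delta>\<^sup>2 / 36" using elim by (simp add: t_def V0_def cut_def scale_def)
        show "6 / \<delta>\<^sup>2 \<le> t\<^sup>2 / real N" unfolding t2 using elim N by (simp add: mult_ac)
      qed fact
      moreover have "t\<^sup>2 * (1 + 3 * \<delta>) / (2 * (1 - \<delta>)\<^sup>2 * V0) = (1 - \<theta>) * (1 + 3 * \<delta>) / (1 - \<delta>)\<^sup>2 * ln (real N)"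
        unfolding t2 V0_def using N r \<theta> \<delta> by (simp add: power2_eq_square divide_simps)
      moreover have "\<dots> \<le> (1 - \<theta>\<^sup>2) * ln (real N)" using \<delta>\<theta> N by (intro mult_right_mono) auto
      ultimately have "q \<le> C.prob {\<omega> \<in> space (M N). J.total_sum \<omega> \<ge> t}"
        unfolding q_def by (smt (verit) divide_right_mono exp_le_cancel_iff)
      then show ?thesis unfolding eq .
    qed
    have "\<exists>E\<in>C.events. C.prob E \<le> exp (- (real (m N) * q)) \<and>
        (\<forall>\<omega>\<in>space (M N) - E. \<exists>i\<in>{1..m N}. t \<le> trow N {m N<..N} i \<omega>)"
      by (rule Z.some_part_row_large[OF mN q])
    moreover have "exp (- (real (m N) * q)) \<le> ?f N"
    proof -
      have "exp (- ((1 - \<theta>\<^sup>2) * ln (real N))) = real N powr (\<theta>\<^sup>2 - 1)"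
        using N by (simp add: powr_def algebra_simps)
      then have q': "q = real N powr (\<theta>\<^sup>2 - 1) / 2" by (simp add: q_def)
      have "\<kappa> / 4 * real N powr (\<theta>\<^sup>2) = (\<kappa> / 2 * real N) * q"
        unfolding q' using N by (simp add: powr_diff)
      also have "\<dots> \<le> real (m N) * q"
        using elim by (intro mult_right_mono) (auto simp: q_def)
      finally show ?thesis by simp
    qed
    ultimately show ?case unfolding t_def by (meson order_trans)
  qed
qed

lemma whp_initial_rows_small:
  assumes \<theta>: "0 < \<theta>" and \<kappa>: "0 < \<kappa>" "\<kappa> \<le> \<theta>\<^sup>2 / 4" "\<kappa> \<le> 1"
  defines "m \<equiv> floor_part \<kappa>"
  shows "whp M (\<lambda>N \<omega>. \<forall>i\<in>{1..m N}. \<bar>trow N {1..m N} i \<omega>\<bar> < \<theta> * scale N)"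
proof (rule whpI)
  let ?f = "\<lambda>N. 2 * real N * exp (- (2 * ln (real N)))"
  show "?f \<longlonglongrightarrow> 0" by real_asymp
  have "\<forall>\<^sub>F N in sequentially. \<theta> * sqrt (2 * real N * ln (real N)) * (2 * real N powr (1/3)) / (\<theta>\<^sup>2 / 4 * real N) \<le> (1/2) / 3"
    using \<theta> by real_asymp
  then
  show "\<forall>\<^sub>F N in sequentially. \<exists>E\<in>sets (M N). measure (M N) E \<le> ?f N \<and>
      (\<forall>\<omega>\<in>space (M N) - E. \<forall>i\<in>{1..m N}. \<bar>trow N {1..m N} i \<omega>\<bar> < \<theta> * scale N)"
    using ev_lev_cut floor_part_bounds[OF \<kappa>(1,3), folded m_def]
  proof eventually_elim
    case (elim N)
    interpret C: centred_array "M N" N "X N" p K by (rule array)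
    interpret Z: bounded_array "M N" N "trunc N" "2 * cut N"
      using elim by (intro array_trunc) auto
    \<comment> \<open>With \<open>\<eta> = 1/2\<close> this makes the tail exponent equal to 2 ln N,
      which survives the union over at most N rows.\<close>
    define V where "V = \<theta>\<^sup>2 / 4 * real N"
    define t where "t = \<theta> * scale N"
    have N: "2 \<le> N" "real N > 0" using elim by auto
    have mN: "m N \<le> N" using elim by auto
    have V: "0 < V" using \<theta> N by (simp add: V_def)
    have t: "0 < t" using \<theta> N scale_pos by (simp add: t_def)
    have var: "tvar N {1..m N} i \<le> V" if i: "i \<in> {1..m N}" for i
    proof -
      have "tvar N {1..m N} i \<le> (\<Sum>k=1..m N. C.expectation (\<lambda>\<omega>. (X N (uedge i k) \<omega>)\<^sup>2))"
        unfolding Z.part_var_def using elim i by (intro sum_mono C.part_variance_le uedge_in_upairs) auto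
      also have "\<dots> \<le> (\<Sum>k=1..m N. 1)" using i mN by (intro sum_mono var_le_1 uedge_in_upairs) auto
      also have "\<dots> \<le> \<kappa> * real N" using elim by simp
      also have "\<dots> \<le> V" unfolding V_def using \<kappa> by (intro mult_right_mono) auto
      finally show ?thesis .
    qed
    have "\<exists>E\<in>C.events. C.prob E \<le> real (card {1..m N}) * (2 * exp (- (t\<^sup>2 * (1 - 1/2) / (2 * V)))) \<and>
        (\<forall>\<omega>\<in>space (M N) - E. \<forall>i\<in>{1..m N}. \<bar>trow N {1..m N} i \<omega>\<bar> < t)"
      by (rule Z.part_rows_bounded) (use var V t elim mN in \<open>auto simp: t_def V_def scale_def cut_def\<close>)
    moreover have "real (card {1..m N}) * (2 * exp (- (t\<^sup>2 * (1 - 1/2) / (2 * V)))) \<le> ?f N"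
    proof -
      have "t\<^sup>2 * (1 - 1/2) / (2 * V) = 2 * ln (real N)"
        using N \<theta> by (simp add: t_def V_def power_mult_distrib scale_square)
      then show ?thesis using mN by simp
    qed
    ultimately show ?case unfolding t_def by (meson order_trans)
  qed
qed

lemma whp_some_row_large:
  assumes \<theta>: "0 < \<theta>" "\<theta> \<le> 1/2"
  shows "whp M (\<lambda>N \<omega>. \<exists>i\<in>{1..N}. ((1 - \<theta>) * sqrt r - \<theta>) * scale N \<le> trow N {1..N} i \<omega>)"
proof -
  \<comment> \<open>The first bound keeps the variance of the shortened rows close to r N; the
    second makes the discarded initial parts smaller than \<open>\<theta> * scale N\<close>.\<close>
  define \<kappa> where "\<kappa> = min (r * \<theta> / 2) (\<theta>\<^sup>2 / 4)"
  have \<kappa>: "0 < \<kappa>" "\<kappa> \<le> r * \<theta> / 2" "\<kappa> \<le> \<theta>\<^sup>2 / 4" "\<kappa> \<le> 1"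
    using \<theta> r mult_mono[of r 1 \<theta> 1] by (auto simp: \<kappa>_def)
  define m where "m = floor_part \<kappa>"
  show ?thesis
  proof (rule whp_mono[OF whp_conj[OF whp_some_part_row_large[OF \<theta> \<kappa>(1,2), folded m_def]
          whp_initial_rows_small[OF \<theta>(1) \<kappa>(1,3,4), folded m_def]]])
    show "\<forall>\<^sub>F N in sequentially. \<forall>\<omega>\<in>space (M N).
        (\<exists>i\<in>{1..m N}. (1 - \<theta>) * sqrt r * scale N \<le> trow N {m N<..N} i \<omega>) \<and>
        (\<forall>i\<in>{1..m N}. \<bar>trow N {1..m N} i \<omega>\<bar> < \<theta> * scale N) \<longrightarrow>
        (\<exists>i\<in>{1..N}. ((1 - \<theta>) * sqrt r - \<theta>) * scale N \<le> trow N {1..N} i \<omega>)"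
      using ev_lev_cut floor_part_bounds[OF \<kappa>(1,4), folded m_def]
    proof (eventually_elim, intro ballI impI)
      fix N \<omega>
      assume N: "2 \<le> N \<and> 1 \<le> lev N \<and> lev N \<le> cut N"
        and m: "1 \<le> m N \<and> m N \<le> N \<and> \<kappa> / 2 * real N \<le> real (m N) \<and> real (m N) \<le> \<kappa> * real N"
        and both: "(\<exists>i\<in>{1..m N}. (1 - \<theta>) * sqrt r * scale N \<le> trow N {m N<..N} i \<omega>) \<and>
        (\<forall>i\<in>{1..m N}. \<bar>trow N {1..m N} i \<omega>\<bar> < \<theta> * scale N)"
      then have small: "\<forall>i\<in>{1..m N}. \<bar>trow N {1..m N} i \<omega>\<bar> < \<theta> * scale N" by blast
      from both obtain i where i: "i \<in> {1..m N}" "(1 - \<theta>) * sqrt r * scale N \<le> trow N {m N<..N} i \<omega>"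
        by blast
      interpret Z: bounded_array "M N" N "trunc N" "2 * cut N"
        using N by (intro array_trunc) auto
      have "trow N {1..N} i \<omega> = trow N {1..m N} i \<omega> + trow N {m N<..N} i \<omega>"
        unfolding Z.part_row_def using m by (intro sum_split_initial) auto
      moreover have "\<bar>trow N {1..m N} i \<omega>\<bar> < \<theta> * scale N" using small i by blast
      ultimately have "((1 - \<theta>) * sqrt r - \<theta>) * scale N \<le> trow N {1..N} i \<omega>"
        using i(2) unfolding left_diff_distrib by linarith
      moreover have "i \<in> {1..N}" using i m by auto
      ultimately show "\<exists>i\<in>{1..N}. ((1 - \<theta>) * sqrt r - \<theta>) * scale N \<le> trow N {1..N} i \<omega>" by blast
    qed
  qed
qed

theorem whp_spec_norm_lapl:
  assumes \<epsilon>: "0 < \<epsilon>"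
  shows "whp M (\<lambda>N \<omega>. \<bar>spec_norm N (lapl N (\<lambda>i j. X N (i, j) \<omega>)) / scale N - sqrt r\<bar> \<le> \<epsilon>)"
proof -
  \<comment> \<open>Error budget in units of \<open>scale N\<close>: the lower bound loses
    \<open>\<theta> * sqrt r\<close>, three times \<open>\<theta>\<close> for the norm of the
    matrix, and \<open>\<theta>\<close> each for the truncation means and the first m columns. As r
    \<le> 1 this is at most \<open>6 * \<theta>\<close>. The cap 1/2 is required by the lower
    tail.\<close>
  define \<theta> where "\<theta> = min (\<epsilon> / 6) (1/2)"
  have \<theta>: "0 < \<theta>" "\<theta> \<le> 1/2" "6 * \<theta> \<le> \<epsilon>" using \<epsilon> by (auto simp: \<theta>_def)
  have "\<theta> * sqrt r \<le> \<theta> * 1" using r \<theta> by (intro mult_left_mono) auto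
  then have sum_le: "\<theta> * sqrt r + 4 * \<theta> \<le> \<epsilon>" "\<theta> * sqrt r + 5 * \<theta> \<le> \<epsilon>" using \<theta> by linarith+
  show ?thesis
  proof (rule whp_mono[OF whp_conj[OF whp_conj[OF whp_entries_le_cut whp_norm[OF \<theta>(1)]]
        whp_conj[OF whp_rows_upper[OF \<theta>(1)] whp_some_row_large[OF \<theta>(1,2)]]]])
    show "\<forall>\<^sub>F N in sequentially. \<forall>\<omega>\<in>space (M N).
        ((\<forall>e\<in>upairs N. \<bar>X N e \<omega>\<bar> \<le> cut N) \<and> op_le {1..N} (\<lambda>i j. X N (uedge i j) \<omega>) (3 * \<theta> * scale N)) \<and>
        (\<forall>i\<in>{1..N}. \<bar>trow N {1..N} i \<omega>\<bar> < (1 + \<theta>) * sqrt r * scale N) \<and>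
        (\<exists>i\<in>{1..N}. ((1 - \<theta>) * sqrt r - \<theta>) * scale N \<le> trow N {1..N} i \<omega>) \<longrightarrow>
        \<bar>spec_norm N (lapl N (\<lambda>i j. X N (i, j) \<omega>)) / scale N - sqrt r\<bar> \<le> \<epsilon>"
      using ev_lev_cut ev_mean_small[OF \<theta>(1)]
    proof (eventually_elim, intro ballI impI)
      fix N \<omega>
      assume N: "2 \<le> N \<and> 1 \<le> lev N \<and> lev N \<le> cut N" "real N * (K * cut N powr (1 - p)) \<le> \<theta> * scale N"
        and all: "((\<forall>e\<in>upairs N. \<bar>X N e \<omega>\<bar> \<le> cut N) \<and> op_le {1..N} (\<lambda>i j. X N (uedge i j) \<omega>) (3 * \<theta> * scale N)) \<and>
        (\<forall>i\<in>{1..N}. \<bar>trow N {1..N} i \<omega>\<bar> < (1 + \<theta>) * sqrt r * scale N) \<and>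
        (\<exists>i\<in>{1..N}. ((1 - \<theta>) * sqrt r - \<theta>) * scale N \<le> trow N {1..N} i \<omega>)"
      then have le: "\<forall>e\<in>upairs N. \<bar>X N e \<omega>\<bar> \<le> cut N"
        and norm: "op_le {1..N} (\<lambda>i j. X N (uedge i j) \<omega>) (3 * \<theta> * scale N)"
        and up: "\<forall>i\<in>{1..N}. \<bar>trow N {1..N} i \<omega>\<bar> < (1 + \<theta>) * sqrt r * scale N" by blast+
      from all obtain i0 where i0: "i0 \<in> {1..N}" "((1 - \<theta>) * sqrt r - \<theta>) * scale N \<le> trow N {1..N} i0 \<omega>"
        by blast
      interpret C: centred_array "M N" N "X N" p K by (rule array)
      interpret Z: bounded_array "M N" N "trunc N" "2 * cut N"
        using N by (intro array_trunc) auto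
      let ?x = "\<lambda>i j. X N (i, j) \<omega>"
      define s where "s = scale N"
      have s: "0 < s" using N scale_pos by (simp add: s_def)
      have symA: "symA ?x i j = X N (uedge i j) \<omega>" for i j by (simp add: symA_def)
      have row: "\<bar>(\<Sum>k=1..N. symA ?x i k) - trow N {1..N} i \<omega>\<bar> \<le> \<theta> * s" if i: "i \<in> {1..N}" for i
      proof -
        have "(\<Sum>k=1..N. symA ?x i k) - trow N {1..N} i \<omega> = (\<Sum>k=1..N. mean N (uedge i k))"
          unfolding symA Z.part_row_def sum_subtractf[symmetric]
        proof (rule sum.cong)
          fix k assume "k \<in> {1..N}"
          then have "uedge i k \<in> upairs N" using i by (intro uedge_in_upairs)
          then show "X N (uedge i k) \<omega> - trunc N (uedge i k) \<omega> = mean N (uedge i k)"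
            using C.decomposition(1)[of "uedge i k" "cut N" \<omega>] le N by auto
        qed simp
        also have "\<bar>\<dots>\<bar> \<le> (\<Sum>k=1..N. K * cut N powr (1 - p))"
          by (rule order_trans[OF sum_abs sum_mono]) (use N i in \<open>intro C.abs_drift_le uedge_in_upairs, auto\<close>)
        also have "\<dots> \<le> \<theta> * s" using N by (simp add: s_def)
        finally show ?thesis .
      qed
      have norm': "op_le {1..N} (symA ?x) (3 * \<theta> * s)"
        using norm by (simp add: symA s_def op_le_cong[OF symA])
      have upper: "spec_norm N (lapl N ?x) \<le> 3 * \<theta> * s + ((1 + \<theta>) * sqrt r * s + \<theta> * s)"
      proof (rule spec_norm_lapl_le[OF norm'])
        fix i assume i: "i \<in> {1..N}"
        show "\<bar>\<Sum>k=1..N. symA ?x i k\<bar> \<le> (1 + \<theta>) * sqrt r * s + \<theta> * s"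
          using row[OF i] up i unfolding s_def by force
      qed (use N in auto)
      have lower: "((1 - \<theta>) * sqrt r - \<theta>) * s - \<theta> * s - 3 * \<theta> * s \<le> spec_norm N (lapl N ?x)"
        using spec_norm_lapl_ge[OF norm' i0(1)] row[OF i0(1)] i0(2) unfolding s_def by linarith

      have "spec_norm N (lapl N ?x) / s \<le> sqrt r + \<epsilon>"
      proof -
        have "spec_norm N (lapl N ?x) \<le> (sqrt r + (\<theta> * sqrt r + 4 * \<theta>)) * s" using upper by (simp add: algebra_simps)
        also have "\<dots> \<le> (sqrt r + \<epsilon>) * s" using sum_le s by (intro mult_right_mono) auto
        finally show ?thesis using s by (simp add: divide_le_eq)
      qed
      moreover have "sqrt r - \<epsilon> \<le> spec_norm N (lapl N ?x) / s"
      proof -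
        have "(sqrt r - \<epsilon>) * s \<le> (sqrt r - (\<theta> * sqrt r + 5 * \<theta>)) * s" using sum_le s by (intro mult_right_mono) auto
        also have "\<dots> \<le> spec_norm N (lapl N ?x)" using lower by (simp add: algebra_simps)
        finally show ?thesis using s by (simp add: le_divide_eq)
      qed
      ultimately show "\<bar>spec_norm N (lapl N ?x) / scale N - sqrt r\<bar> \<le> \<epsilon>"
        unfolding s_def by linarith
    qed
  qed
qed

end

theorem mainTheorem6:
  fixes M :: "nat \<Rightarrow> 'a measure"
    and X :: "nat \<Rightarrow> nat \<Rightarrow> nat \<Rightarrow> 'a \<Rightarrow> real"
    and W :: "real \<Rightarrow> real \<Rightarrow> real"
    and r \<delta> K :: real
  defines "\<sigma>2 \<equiv> (\<lambda>N i j. prob_space.variance (M N) (X N (min i j) (max i j)))"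
  assumes prob: "\<And>N. prob_space (M N)"
    and meas: "\<And>N i j. 1 \<le> i \<Longrightarrow> i \<le> j \<Longrightarrow> j \<le> N \<Longrightarrow> X N i j \<in> borel_measurable (M N)"
    and indep: "\<And>N. prob_space.indep_vars (M N) (\<lambda>_. borel) (\<lambda>(i, j). X N i j)
                       {(i, j). 1 \<le> i \<and> i \<le> j \<and> j \<le> N}"
    and centered: "\<And>N i j. 1 \<le> i \<Longrightarrow> i \<le> j \<Longrightarrow> j \<le> N \<Longrightarrow>
                      prob_space.expectation (M N) (X N i j) = 0"
    and S1: "\<exists>c>0. \<forall>N i j. 1 \<le> i \<and> i \<le> N \<and> 1 \<le> j \<and> j \<le> N \<longrightarrow>
                      c \<le> \<sigma>2 N i j \<and> \<sigma>2 N i j \<le> 1"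
    and S2: "\<delta> > 0" "\<And>N i j. 1 \<le> i \<Longrightarrow> i \<le> j \<Longrightarrow> j \<le> N \<Longrightarrow>
               (\<integral>\<^sup>+\<omega>. ennreal (\<bar>X N i j \<omega> - prob_space.expectation (M N) (X N i j)\<bar>
                                  powr (6 + \<delta>)) \<partial>M N) \<le> ennreal K"
    and S3: "graphon W" "(\<lambda>N. cut_dist (emp_graphon N (\<sigma>2 N)) W) \<longlonglongrightarrow> 0"
    and S4: "0 < r" "r \<le> 1"
      "(\<lambda>N. SUP i \<in> {1..N}. \<bar>(1 / real N) * (\<Sum>j=1..N. \<sigma>2 N i j) - r\<bar>) \<longlonglongrightarrow> 0"
  shows "\<forall>\<epsilon>>0. (\<lambda>N. measure (M N)
            {\<omega> \<in> space (M N).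
               \<bar>spec_norm N (lapl N (\<lambda>i j. X N i j \<omega>)) / sqrt (2 * real N * ln (real N))
                - sqrt r\<bar> > \<epsilon>}) \<longlonglongrightarrow> 0"
proof (intro allI impI)
  fix \<epsilon> :: real assume \<epsilon>: "0 < \<epsilon>"
  define Y where "Y N e \<omega> = X N (fst e) (snd e) \<omega>" for N e \<omega>
  have Y_edge: "Y N (uedge i j) = X N (min i j) (max i j)" for N i j by (auto simp: Y_def)
  have square: "\<sigma>2 N i j = prob_space.expectation (M N) (\<lambda>\<omega>. (Y N (uedge i j) \<omega>)\<^sup>2)"
    if "i \<in> {1..N}" "j \<in> {1..N}" for N i j
    using centered[of "min i j" "max i j" N] that by (simp add: \<sigma>2_def Y_edge)
  \<comment> \<open>Enlarging the moment bound to \<open>max K 1\<close> preserves (S.2) and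
    provides the strictly positive constant that the variance bound of the moment method
    needs.\<close>
  interpret A: array_sequence M Y "6 + \<delta>" "max K 1" r
  proof (rule array_sequence.intro)
    fix N :: nat
    interpret prob_space "M N" by (rule prob)
    show "centred_array (M N) N (Y N) (6 + \<delta>) (max K 1)"
    proof
      have "indep_vars (\<lambda>_. borel) (\<lambda>(i, j). X N i j) (upairs N)"
        using indep[of N] by (simp add: upairs_def)
      then show "indep_vars (\<lambda>_. borel) (Y N) (upairs N)"
        by (subst indep_vars_cong[of _ "upairs N" _ "\<lambda>(i, j). X N i j" _ "\<lambda>_. borel"]) (auto simp: Y_def)
      fix e assume "e \<in> upairs N"
      then obtain i j where e: "e = (i, j)" "1 \<le> i" "i \<le> j" "j \<le> N" by (auto simp: upairs_def)
      have YX: "Y N e = X N i j" by (auto simp: Y_def e)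
      show "expectation (Y N e) = 0" unfolding YX by (rule centered) fact+
      have "(\<integral>\<^sup>+\<omega>. ennreal (\<bar>X N i j \<omega>\<bar> powr (6 + \<delta>)) \<partial>M N) \<le> ennreal K"
        using S2(2)[OF e(2,3,4)] centered[OF e(2,3,4)] by simp
      also have "\<dots> \<le> ennreal (max K 1)" by (rule ennreal_leI) simp
      finally show "(\<integral>\<^sup>+\<omega>. ennreal (\<bar>Y N e \<omega>\<bar> powr (6 + \<delta>)) \<partial>M N) \<le> ennreal (max K 1)" unfolding YX .
    qed (use S2(1) in auto)
  next
    fix N e assume "e \<in> upairs N"
    then obtain i j where e: "e = uedge i j" "i \<in> {1..N}" "j \<in> {1..N}"
      by (cases e) (auto simp: upairs_def intro!: that[of "fst e" "snd e"])
    have "\<sigma>2 N i j \<le> 1" using S1 e by auto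
    then show "prob_space.expectation (M N) (\<lambda>\<omega>. (Y N e \<omega>)\<^sup>2) \<le> 1" using square e by simp
  next
    fix \<nu> :: real assume \<nu>: "0 < \<nu>"
    have "\<forall>\<^sub>F N in sequentially. (SUP i \<in> {1..N}. \<bar>(1 / real N) * (\<Sum>j=1..N. \<sigma>2 N i j) - r\<bar>) < \<nu>"
      using order_tendstoD(2)[OF S4(3) \<nu>] .
    then show "\<forall>\<^sub>F N in sequentially. \<forall>i\<in>{1..N}.
      \<bar>(\<Sum>k=1..N. prob_space.expectation (M N) (\<lambda>\<omega>. (Y N (uedge i k) \<omega>)\<^sup>2)) - r * real N\<bar> \<le> \<nu> * real N"
    proof (eventually_elim, intro ballI)
      fix N i
      let ?d = "\<lambda>i. \<bar>(1 / real N) * (\<Sum>j=1..N. \<sigma>2 N i j) - r\<bar>"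
      assume lt: "(SUP i \<in> {1..N}. ?d i) < \<nu>" and i: "i \<in> {1..N}"
      then have N: "0 < real N" by auto
      have "?d i \<le> (SUP i \<in> {1..N}. ?d i)" using i by (intro cSUP_upper) auto
      with lt have "?d i * real N \<le> \<nu> * real N" by (intro mult_right_mono) auto
      moreover have "?d i * real N = \<bar>(\<Sum>j=1..N. \<sigma>2 N i j) - r * real N\<bar>"
      proof -
        have "?d i * real N = \<bar>((1 / real N) * (\<Sum>j=1..N. \<sigma>2 N i j) - r) * real N\<bar>" by (simp add: abs_mult)
        also have "((1 / real N) * (\<Sum>j=1..N. \<sigma>2 N i j) - r) * real N = (\<Sum>j=1..N. \<sigma>2 N i j) - r * real N"
          using N by (simp add: left_diff_distrib)
        finally show ?thesis .
      qed
      moreover have "(\<Sum>j=1..N. \<sigma>2 N i j) = (\<Sum>k=1..N. prob_space.expectation (M N) (\<lambda>\<omega>. (Y N (uedge i k) \<omega>)\<^sup>2))"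
        using i by (intro sum.cong square) auto
      ultimately show "\<bar>(\<Sum>k=1..N. prob_space.expectation (M N) (\<lambda>\<omega>. (Y N (uedge i k) \<omega>)\<^sup>2)) - r * real N\<bar> \<le> \<nu> * real N"
        by simp
    qed
  qed (use S2 S4 in auto)
  have "whp M (\<lambda>N \<omega>. \<not> \<bar>spec_norm N (lapl N (\<lambda>i j. X N i j \<omega>)) / sqrt (2 * real N * ln (real N)) - sqrt r\<bar> > \<epsilon>)"
    using A.whp_spec_norm_lapl[OF \<epsilon>] by (simp add: Y_def A.scale_def not_less)
  then show "(\<lambda>N. measure (M N)
            {\<omega> \<in> space (M N).
               \<bar>spec_norm N (lapl N (\<lambda>i j. X N i j \<omega>)) / sqrt (2 * real N * ln (real N))
                - sqrt r\<bar> > \<epsilon>}) \<longlonglongrightarrow> 0"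
    by (rule measure_tendsto_0_of_whp[OF prob])
qed

end
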